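(* Let $\mathcal{F}_n=\{G_1,G_2,\ldots,G_n\}$ be a family of $n$ pairwise distinct great circles of $\mathbb{S}^2$. Then: (i) $r_{\rm gc}(2,\mathbb{S}^2)=\frac{\pi}{4}$, and $\mathcal{F}_2$ is $2$-optimal if and only if $G_1$ and $G_2$ are orthogonal; (ii) $r_{\rm gc}(3,\mathbb{S}^2)=\arcsin\frac{1}{\sqrt3}$, and $\mathcal{F}_3$ is $3$-optimal if and only if $G_1,G_2$ and $G_3$ are mutually orthogonal; (iii) $r_{\rm gc}(4,\mathbb{S}^2)=\arcsin\frac{1}{\sqrt5}$, and $\mathcal{F}_4$ is $4$-optimal if and only if (after a suitable relabeling) three of the great circles, say $G_1,G_2$ and $G_3$, meet at the same pair of antipodes $\pm\mathbf{p}$ at angles equal to $\frac{\pi}{3}$, and $G_4$ is the polar of $\pm\mathbf{p}$; (iv) $r_{\rm gc}(n,\mathbb{S}^2)\le\arccos\left(\frac{1}{\sqrt2\,\sin\left(\frac{n}{n-1}\cdot\frac{\pi}{4}\right)}\right)$ holds for $n>4$.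
   Context: $\mathbb{S}^2$ is the unit sphere centered at the origin in Euclidean $3$-space. A great circle is the intersection of $\mathbb{S}^2$ with a plane through the origin; two great circles are orthogonal if their planes are. The polar of a pair of antipodes $\pm\mathbf{p}$ is the great circle $\{\mathbf{y}\in\mathbb{S}^2:\langle\mathbf{y},\mathbf{p}\rangle=0\}$. The (closed) spherical cap of center $\mathbf{x}\in\mathbb{S}^2$ and angular radius $r\in(0,\frac{\pi}{2}]$ is $\{\mathbf{y}\in\mathbb{S}^2:\langle\mathbf{y},\mathbf{x}\rangle\ge\cos r\}$. Finitely many great circles generate a tiling of $\mathbb{S}^2$ whose $2$-dimensional cells are the closures of the connected components of the complement of their union. For $n>1$, $r_{\rm gc}(n,\mathbb{S}^2)$ denotes the largest $r>0$ such that there exists an arrangement of $n$ pairwise distinct great circles in $\mathbb{S}^2$ with the property that each $2$-dimensional cell of the tiling generated by them contains a spherical cap of radius $r$. An arrangement of $n$ pairwise distinct great circles is called $n$-optimal if each cell of the tiling generated by them contains a spherical cap of radius $r_{\rm gc}(n,\mathbb{S}^2)$. *)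

theory Defs
  imports "HOL-Analysis.Analysis"
begin

abbreviation S2 :: "(real ^ 3) set" where
  "S2 \<equiv> sphere 0 1"

definition central_plane :: "(real ^ 3) set \<Rightarrow> bool" where
  "central_plane P \<longleftrightarrow> subspace P \<and> dim P = 2"

definition great_circle :: "(real ^ 3) set \<Rightarrow> bool" where
  "great_circle G \<longleftrightarrow> (\<exists>P. central_plane P \<and> G = S2 \<inter> P)"

text \<open>Two planes are orthogonal if their normal vectors are.  (Orthogonality of all pairs of
  vectors would be the wrong notion: it never holds for two planes in 3-space.)\<close>

definition orthogonal_planes :: "(real ^ 3) set \<Rightarrow> (real ^ 3) set \<Rightarrow> bool" where
  "orthogonal_planes P Q \<longleftrightarrow>
     (\<exists>u v. u \<noteq> 0 \<and> v \<noteq> 0 \<and> P = {x. orthogonal u x} \<and> Q = {x. orthogonal v x} \<and> orthogonal u v)"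

definition orthogonal_circles :: "(real ^ 3) set \<Rightarrow> (real ^ 3) set \<Rightarrow> bool" where
  "orthogonal_circles G H \<longleftrightarrow>
     (\<exists>P Q. central_plane P \<and> central_plane Q \<and> G = S2 \<inter> P \<and> H = S2 \<inter> Q \<and> orthogonal_planes P Q)"

definition polar :: "real ^ 3 \<Rightarrow> (real ^ 3) set" where
  "polar p = {y \<in> S2. y \<bullet> p = 0}"

text \<open>The angle at which two great circles through \<open>p\<close> (and hence through \<open>- p\<close>) meet is the angle
  in \<open>[0, \<pi>/2]\<close> between their tangent lines at \<open>p\<close>.  The unit tangent vectors at \<open>p\<close> of a great
  circle \<open>G\<close> through \<open>p\<close> are exactly the two points of \<open>G\<close> orthogonal to \<open>p\<close>; the absolute value
  makes the angle independent of the choice among them.\<close>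

definition meet_at_angle ::
    "(real ^ 3) set \<Rightarrow> (real ^ 3) set \<Rightarrow> real ^ 3 \<Rightarrow> real \<Rightarrow> bool" where
  "meet_at_angle G H p \<alpha> \<longleftrightarrow>
     p \<in> G \<and> p \<in> H \<and>
     (\<exists>s\<in>G. \<exists>t\<in>H. orthogonal s p \<and> orthogonal t p \<and> \<alpha> = arccos \<bar>s \<bullet> t\<bar>)"

definition cap :: "real ^ 3 \<Rightarrow> real \<Rightarrow> (real ^ 3) set" where
  "cap x r = {y \<in> S2. y \<bullet> x \<ge> cos r}"

definition tiling_cells :: "(real ^ 3) set set \<Rightarrow> (real ^ 3) set set" where
  "tiling_cells F = closure ` components (S2 - \<Union>F)"

definition arrangement :: "nat \<Rightarrow> (real ^ 3) set set \<Rightarrow> bool" where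
  "arrangement n F \<longleftrightarrow> finite F \<and> card F = n \<and> (\<forall>G\<in>F. great_circle G)"

definition cells_contain_caps :: "(real ^ 3) set set \<Rightarrow> real \<Rightarrow> bool" where
  "cells_contain_caps F r \<longleftrightarrow> (\<forall>C\<in>tiling_cells F. \<exists>x\<in>S2. cap x r \<subseteq> C)"

text \<open>The bound \<open>r \<le> \<pi>/2\<close> is the admissible range for the radius of a cap.  \<open>GREATEST\<close> is a genuine
  maximum; it is unspecified if no largest such radius exists.\<close>

definition r_gc :: "nat \<Rightarrow> real" where
  "r_gc n = (GREATEST r. 0 < r \<and> r \<le> pi / 2 \<and> (\<exists>F. arrangement n F \<and> cells_contain_caps F r))"

definition optimal :: "nat \<Rightarrow> (real ^ 3) set set \<Rightarrow> bool" where
  "optimal n F \<longleftrightarrow> arrangement n F \<and> cells_contain_caps F (r_gc n)"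

end

theory Submission
  imports Defs
begin

text \<open>
  A great circle is determined by a unit normal \<open>u\<close>, up to sign, and a cell of the tiling consists of the
  points of the sphere at which the inner products with all normals have prescribed signs.  A cap
  of radius \<open>r\<close> fits into a cell iff its center \<open>x\<close> satisfies the sign conditions with margin: \<open>u \<bullet> x\<close>
  has the right sign and modulus at least \<open>t = sin r\<close>, for every normal \<open>u\<close>.  So the theorem is about
  finite sets \<open>N\<close> of unit vectors without antipodal pairs, and about the largest \<open>t\<close> such that every sign
  pattern that occurs off the planes is realized with margin \<open>t\<close> by a unit vector.  This is
  \<open>roomy N t\<close>, and \<open>cells_contain_caps_iff_roomy\<close> is the translation.

  All upper bounds for few circles come from one test.  If \<open>v\<^sub>1, \<dots>, v\<^sub>k\<close> are normals or negatives of
  normals that are simultaneously positive somewhere, then the center \<open>x\<close> of the cap in the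
  corresponding cell satisfies \<open>(\<Sum> \<lambda>\<^sub>i) t \<le> (\<Sum> \<lambda>\<^sub>i v\<^sub>i) \<bullet> x \<le> \<bar>\<Sum> \<lambda>\<^sub>i v\<^sub>i\<bar>\<close> for all weights \<open>\<lambda>\<^sub>i \<ge> 0\<close>.
  \<^item> Two normals \<open>u\<close>, \<open>v\<close>: testing \<open>u + v\<close> and \<open>u - v\<close> gives \<open>2 t\<^sup>2 \<le> 1 - \<bar>u \<bullet> v\<bar>\<close>.
  \<^item> Three independent normals: all eight sign choices occur, and the mean of \<open>\<bar>\<plusminus>a \<plusminus> b \<plusminus> c\<bar>\<^sup>2\<close> over them is
    \<open>3\<close>, hence \<open>t\<^sup>2 \<le> 1/3\<close>.  Three coplanar normals can be signed so that the origin is a positive combination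
    of them; two of them then enclose an angle of at least \<open>2\<pi>/3\<close>, which gives \<open>t\<^sup>2 \<le> 1/4\<close>.
  \<^item> Four normals, no three coplanar: after changing signs there is a relation \<open>\<Sum> \<alpha>\<^sub>i v\<^sub>i = 0\<close> with all
    \<open>\<alpha>\<^sub>i > 0\<close>.  Testing the three vectors other than the one with the smallest coefficient gives \<open>t \<le> 1/3\<close>.
  \<^item> Four normals, three of them coplanar and \<open>d\<close> outside their plane: take \<open>a\<close>, \<open>b\<close> among the three at an angle of
    at least \<open>2\<pi>/3\<close>; then \<open>2a + 2b \<plusminus> d\<close> gives \<open>t\<^sup>2 \<le> 1/5\<close>, with equality only if the three
    enclose angles of \<open>2\<pi>/3\<close> and \<open>d\<close> is orthogonal to them.  If all four are coplanar, two of the lines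
    that they span are at an angle of at most \<open>\<pi>/4\<close>, and the bound for pairs gives \<open>t\<^sup>2 < 1/5\<close>.

  For \<open>n \<ge> 5\<close>, deleting circles only enlarges cells, so \<open>t\<^sup>2 \<le> 1/5\<close> still holds; that settles
  \<open>n \<le> 7\<close>.  For \<open>n \<ge> 8\<close> there are two cases.  If all normals are coplanar, then two of the lines that they span are at an
  angle of at most \<open>\<pi>/n\<close>.  Otherwise there are at least \<open>4 (n - 1)\<close> cells, because each additional great circle
  crosses the others in at least four points.  The circular cones spanned by the origin and the
  caps are disjoint subsets of the unit ball, and comparing volumes gives
  \<open>(n - 1) t\<^sup>2 \<surd>(1 - t\<^sup>2) \<le> 1\<close>.  In both cases the stated bound follows by elementary estimates of the sine, in the
  second one with the help of \<open>t\<^sup>2 \<le> 1/5\<close>.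
  As \<open>r_gc\<close> is a maximum, it must also be shown to be attained; this is a compactness
  argument (\<open>roomy_maximum_exists\<close>), in which the bound for pairs keeps limits of distinct circles distinct.
\<close>


section \<open>Great circles and their unit normals\<close>

definition normal_system :: "nat \<Rightarrow> (real ^ 3) set \<Rightarrow> bool" where
  "normal_system n N \<longleftrightarrow> finite N \<and> card N = n \<and> N \<subseteq> S2 \<and> (\<forall>u\<in>N. - u \<notin> N)"

lemma great_circle_iff_polar: "great_circle G \<longleftrightarrow> (\<exists>u\<in>S2. G = polar u)"
proof
  assume "great_circle G"
  then obtain P where P: "subspace P" "dim P = 2" "G = S2 \<inter> P"
    by (auto simp: great_circle_def central_plane_def)
  obtain a where a: "a \<noteq> 0" "span P = {x. a \<bullet> x = 0}"
    using lowdim_eq_hyperplane[of P] P(2) by auto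
  have "P = {x. a \<bullet> x = 0}" using a(2) P(1) by (metis span_eq_iff)
  then have "G = polar (a /\<^sub>R norm a)"
    using P(3) a(1) by (auto simp: polar_def inner_commute)
  moreover have "a /\<^sub>R norm a \<in> S2" using a(1) by simp
  ultimately show "\<exists>u\<in>S2. G = polar u" by blast
next
  assume "\<exists>u\<in>S2. G = polar u"
  then obtain u where u: "norm u = 1" "G = polar u" by auto
  then have "dim {x. u \<bullet> x = 0} = 2" by (subst dim_hyperplane) auto
  moreover have "subspace {x. u \<bullet> x = 0}" by (rule subspace_hyperplane)
  moreover have "G = S2 \<inter> {x. u \<bullet> x = 0}" using u(2) by (auto simp: polar_def inner_commute)
  ultimately show "great_circle G" unfolding great_circle_def central_plane_def by blast
qed

lemma plane_eq_imp_parallel: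
  fixes u v :: "real ^ 3"
  assumes "v \<noteq> 0" "\<And>x. u \<bullet> x = 0 \<Longrightarrow> v \<bullet> x = 0"
  shows "v = (u \<bullet> v / (u \<bullet> u)) *\<^sub>R u"
proof -
  define w where "w = v - (u \<bullet> v / (u \<bullet> u)) *\<^sub>R u"
  have "u \<bullet> w = 0" by (cases "u = 0") (auto simp: w_def inner_diff_right)
  then have "v \<bullet> w = 0" by (rule assms)
  then have "w \<bullet> w = 0" using \<open>u \<bullet> w = 0\<close> by (subst w_def) (simp add: inner_diff_left)
  then show ?thesis by (simp add: w_def)
qed

lemma polar_eq_iff:
  assumes "u \<in> S2" "v \<in> S2"
  shows "polar u = polar v \<longleftrightarrow> u = v \<or> u = - v"
proof
  assume eq: "polar u = polar v"
  have "v \<bullet> x = 0" if "u \<bullet> x = 0" for x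
  proof (cases "x = 0")
    case False
    then have "x /\<^sub>R norm x \<in> polar u" using that by (simp add: polar_def inner_commute[of x])
    then have "x /\<^sub>R norm x \<in> polar v" by (simp only: eq)
    then show ?thesis using False by (simp add: polar_def inner_commute[of x])
  qed simp
  moreover have "v \<noteq> 0" using assms by auto
  ultimately have "v = (u \<bullet> v / (u \<bullet> u)) *\<^sub>R u" by (intro plane_eq_imp_parallel)
  then obtain c where c: "v = c *\<^sub>R u" by blast
  have "norm v = 1" "norm u = 1" using assms by simp_all
  then have "\<bar>c\<bar> = 1" unfolding c by simp
  then have "c = 1 \<or> c = - 1" by linarith
  then show "u = v \<or> u = - v" unfolding c by fastforce
next
  assume "u = v \<or> u = - v"
  then show "polar u = polar v"
  proof
    assume "u = - v"
    show ?thesis unfolding \<open>u = - v\<close> by (simp add: polar_def)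
  qed simp
qed

lemma arrangement_iff_normal_system:
  "arrangement n F \<longleftrightarrow> (\<exists>N. normal_system n N \<and> F = polar ` N)"
proof
  assume F: "arrangement n F"
  then have "\<forall>G\<in>F. \<exists>u\<in>S2. G = polar u"
    by (simp add: arrangement_def great_circle_iff_polar)
  then obtain f where f: "\<And>G. G \<in> F \<Longrightarrow> f G \<in> S2 \<and> G = polar (f G)" by metis
  have inj: "inj_on f F" using f by (metis inj_onI)
  have "- u \<notin> f ` F" if u: "u \<in> f ` F" for u
  proof
    assume "- u \<in> f ` F"
    then obtain G H where GH: "G \<in> F" "H \<in> F" "u = f G" "- u = f H" using u by auto
    have "polar (- u) = polar u" by (simp add: polar_def)
    then have "G = H" using GH f[OF GH(1)] f[OF GH(2)] by metis
    with GH have "- f G = f G" by metis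
    then have "f G \<bullet> f G = - (f G \<bullet> f G)" by (metis inner_minus_left)
    moreover have "norm (f G) = 1" using f[OF GH(1)] by (simp only: mem_sphere_0)
    ultimately show False by (simp add: norm_eq_1)
  qed
  then have "normal_system n (f ` F)"
    using F card_image[OF inj] conjunct1[OF f]
    unfolding normal_system_def arrangement_def by blast
  moreover have "polar ` f ` F = F"
  proof -
    have "(\<lambda>G. polar (f G)) ` F = (\<lambda>G. G) ` F" by (intro image_cong refl) (metis f)
    then show ?thesis by (simp add: image_image)
  qed
  ultimately show "\<exists>N. normal_system n N \<and> F = polar ` N" by metis
next
  assume "\<exists>N. normal_system n N \<and> F = polar ` N"
  then obtain N where N: "normal_system n N" "F = polar ` N" by blast
  have "inj_on polar N"
  proof (rule inj_onI)
    fix u v assume uv: "u \<in> N" "v \<in> N" "polar u = polar v"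
    then have "u \<in> S2" "v \<in> S2" using N(1) by (auto simp: normal_system_def)
    then have "u = v \<or> u = - v" using uv(3) by (simp only: polar_eq_iff)
    moreover have "- v \<notin> N" using N(1) uv(2) by (simp add: normal_system_def)
    ultimately show "u = v" using uv(1) by auto
  qed
  then show "arrangement n F"
    using N by (auto simp: arrangement_def normal_system_def card_image great_circle_iff_polar subset_iff)
qed

text \<open>The cardinality condition does the work: if \<open>M\<close> contained an antipodal pair, both members would
  have the same polar, and \<open>M\<close> would yield fewer than \<open>n\<close> circles.\<close>

lemma normal_systemI:
  assumes arr: "arrangement n (polar ` M)" and M: "finite M" "M \<subseteq> S2" "card M \<le> n"
  shows "normal_system n M"
proof -
  have c: "card (polar ` M) = n" using arr by (simp add: arrangement_def)
  then have n: "card M = n" using card_image_le[OF M(1), of polar] M(3) by simp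
  then have inj: "inj_on polar M" using c M(1) by (intro eq_card_imp_inj_on) simp_all
  have "- u \<notin> M" if u: "u \<in> M" for u
  proof
    assume "- u \<in> M"
    moreover have "polar (- u) = polar u" by (simp add: polar_def)
    ultimately have "- u = u" using inj u by (meson inj_onD)
    then have "- (u \<bullet> u) = u \<bullet> u" by (metis inner_minus_left)
    moreover have "u \<bullet> u = 1" using u M(2) by (auto simp: norm_eq_1)
    ultimately show False by simp
  qed
  then show ?thesis using M n by (simp add: normal_system_def)
qed

abbreviation symm :: "(real ^ 3) set \<Rightarrow> (real ^ 3) set" where
  "symm N \<equiv> N \<union> uminus ` N"

lemma normal_systemD:
  assumes "normal_system n N"
  shows "finite N" "card N = n" "N \<subseteq> S2" "symm N \<subseteq> S2" "0 \<notin> symm N"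
  using assms by (auto simp: normal_system_def)

lemma normal_system_subset:
  assumes "normal_system n N" "M \<subseteq> N"
  shows "normal_system (card M) M"
  using assms finite_subset by (auto simp: normal_system_def)

lemma normal_system_orthonormal:
  assumes "finite N" "N \<subseteq> S2" and orth: "\<And>u v. u \<in> N \<Longrightarrow> v \<in> N \<Longrightarrow> u \<noteq> v \<Longrightarrow> u \<bullet> v = 0"
  shows "normal_system (card N) N"
proof -
  have "- u \<notin> N" if u: "u \<in> N" for u
  proof
    assume "- u \<in> N"
    have uu: "u \<bullet> u = 1" using u assms(2) by (auto simp: norm_eq_1)
    then have "u \<bullet> (- u) \<noteq> u \<bullet> u" by simp
    then have "u \<noteq> - u" by metis
    then have "u \<bullet> (- u) = 0" using orth u \<open>- u \<in> N\<close> by blast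
    then show False using uu by simp
  qed
  then show ?thesis using assms by (simp add: normal_system_def)
qed


section \<open>Cells as sign classes\<close>

text \<open>The cell around \<open>y\<close>.  The sign of \<open>u \<bullet> y\<close> is used as a factor rather than as a case distinction, so that
  the cell is the sphere intersected with the half-spaces whose normals are \<open>sgn (u \<bullet> y) u\<close>.\<close>

definition sign_cell :: "(real ^ 3) set \<Rightarrow> real ^ 3 \<Rightarrow> (real ^ 3) set" where
  "sign_cell N y = {z \<in> S2. \<forall>u\<in>N. 0 < sgn (u \<bullet> y) * (u \<bullet> z)}"

text \<open>The vector \<open>y\<close> selects a cell, \<open>x\<close> is the center of a cap in it, and \<open>t\<close> is the sine of the radius.
  \<open>y\<close> ranges over the whole space and not only over the sphere, since only its signs matter; this spares
  normalizing the vectors that are constructed to realize given signs.\<close>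

definition roomy :: "(real ^ 3) set \<Rightarrow> real \<Rightarrow> bool" where
  "roomy N t \<longleftrightarrow>
     (\<forall>y. (\<forall>u\<in>N. u \<bullet> y \<noteq> 0) \<longrightarrow> (\<exists>x\<in>S2. \<forall>u\<in>N. t \<le> sgn (u \<bullet> y) * (u \<bullet> x)))"

text \<open>Half-spaces intersect in a convex cone, and the cell is the image of that cone under radial projection,
  which is continuous because the cone omits the origin.\<close>

lemma sign_cell_connected:
  assumes "N \<noteq> {}" shows "connected (sign_cell N y)"
proof -
  define K where "K = {z. \<forall>u\<in>N. 0 < sgn (u \<bullet> y) * (u \<bullet> z)}"
  have K: "K = (\<Inter>u\<in>N. {z. 0 < (sgn (u \<bullet> y) *\<^sub>R u) \<bullet> z})" by (auto simp: K_def)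
  have "convex K" unfolding K by (intro convex_INT convex_halfspace_gt)
  have nz: "z \<noteq> 0" if "z \<in> K" for z using assms that by (auto simp: K_def)
  have "continuous_on K (\<lambda>z. z /\<^sub>R norm z)" using nz by (intro continuous_intros) auto
  then have "connected ((\<lambda>z. z /\<^sub>R norm z) ` K)"
    using convex_connected[OF \<open>convex K\<close>] connected_continuous_image by blast
  moreover have "(\<lambda>z. z /\<^sub>R norm z) ` K = sign_cell N y"
  proof (intro equalityI subsetI)
    fix w assume "w \<in> sign_cell N y"
    then have "w \<in> K" "w = w /\<^sub>R norm w" by (auto simp: sign_cell_def K_def)
    then show "w \<in> (\<lambda>z. z /\<^sub>R norm z) ` K" by blast
  next
    fix w assume "w \<in> (\<lambda>z. z /\<^sub>R norm z) ` K"
    then obtain z where z: "z \<in> K" "w = z /\<^sub>R norm z" by blast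
    have "0 < sgn (u \<bullet> y) * (u \<bullet> w)" if "u \<in> N" for u
    proof -
      have "0 < sgn (u \<bullet> y) * (u \<bullet> z)" using z that by (auto simp: K_def)
      then have "0 < inverse (norm z) * (sgn (u \<bullet> y) * (u \<bullet> z))" using nz z by simp
      then show ?thesis using z by (simp add: mult.left_commute)
    qed
    then show "w \<in> sign_cell N y" using z nz by (simp add: sign_cell_def)
  qed
  ultimately show ?thesis by simp
qed

text \<open>The cell is connected, so it lies in the component.  Conversely a connected set that leaves the cell
  meets one of the planes, by the intermediate value theorem.\<close>

lemma component_eq_sign_cell:
  assumes "N \<noteq> {}" "y \<in> S2 - \<Union>(polar ` N)"
  shows "connected_component_set (S2 - \<Union>(polar ` N)) y = sign_cell N y"
proof
  let ?U = "S2 - \<Union>(polar ` N)"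
  have U: "z \<in> ?U \<longleftrightarrow> z \<in> S2 \<and> (\<forall>u\<in>N. u \<bullet> z \<noteq> 0)" for z
    by (auto simp: polar_def inner_commute)
  have pos: "0 < sgn (u \<bullet> y) * (u \<bullet> y)" if "u \<in> N" for u
  proof -
    have "u \<bullet> y \<noteq> 0" using U[of y] assms(2) that by blast
    then show ?thesis by (cases "0 < u \<bullet> y") simp_all
  qed
  have "y \<in> sign_cell N y" using assms(2) pos by (simp add: sign_cell_def)
  moreover have "sign_cell N y \<subseteq> ?U"
  proof
    fix z assume z: "z \<in> sign_cell N y"
    have "u \<bullet> z \<noteq> 0" if "u \<in> N" for u
    proof -
      have "0 < sgn (u \<bullet> y) * (u \<bullet> z)" using z that by (simp add: sign_cell_def)
      then show ?thesis by auto
    qed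
    moreover have "z \<in> S2" using z by (simp add: sign_cell_def)
    ultimately show "z \<in> ?U" by (subst U) simp
  qed
  ultimately show "sign_cell N y \<subseteq> connected_component_set ?U y"
    by (intro connected_component_maximal sign_cell_connected assms)
  show "connected_component_set ?U y \<subseteq> sign_cell N y"
  proof
    fix z assume z: "z \<in> connected_component_set ?U y"
    then have zU: "z \<in> ?U" by (meson connected_component_in mem_Collect_eq)
    have "0 < sgn (u \<bullet> y) * (u \<bullet> z)" if "u \<in> N" for u
    proof (rule ccontr)
      assume "\<not> ?thesis"
      then have "(sgn (u \<bullet> y) *\<^sub>R u) \<bullet> z \<le> 0" by simp
      moreover have "0 \<le> (sgn (u \<bullet> y) *\<^sub>R u) \<bullet> y" using pos[OF that] by simp
      moreover have "connected (connected_component_set ?U y)" "y \<in> connected_component_set ?U y"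
        using assms(2) by (auto intro: connected_component_refl)
      ultimately obtain x where "x \<in> connected_component_set ?U y" "(sgn (u \<bullet> y) *\<^sub>R u) \<bullet> x = 0"
        using connected_ivt_hyperplane z by blast
      moreover from this have "x \<in> ?U" by (meson connected_component_in mem_Collect_eq)
      ultimately show False using U[of x] U[of y] assms that by (auto simp: sgn_zero_iff)
    qed
    then show "z \<in> sign_cell N y" using zU by (auto simp: sign_cell_def)
  qed
qed

lemma closure_sign_cell_subset:
  "closure (sign_cell N y) \<subseteq> {z \<in> S2. \<forall>u\<in>N. 0 \<le> sgn (u \<bullet> y) * (u \<bullet> z)}"
proof (rule closure_minimal)
  have "{z \<in> S2. \<forall>u\<in>N. 0 \<le> sgn (u \<bullet> y) * (u \<bullet> z)}
      = S2 \<inter> (\<Inter>u\<in>N. {z. 0 \<le> (sgn (u \<bullet> y) *\<^sub>R u) \<bullet> z})" by auto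
  moreover have "closed \<dots>"
    by (intro closed_Int closed_INT ballI closed_halfspace_ge) auto
  ultimately show "closed {z \<in> S2. \<forall>u\<in>N. 0 \<le> sgn (u \<bullet> y) * (u \<bullet> z)}" by simp
qed (auto simp: sign_cell_def less_imp_le)

text \<open>Moving \<open>z\<close> slightly towards an interior point \<open>x\<close> of the cell makes all weak inequalities strict.\<close>

lemma in_closure_sign_cell:
  assumes "N \<noteq> {}" "x \<in> sign_cell N y" "z \<in> S2" "\<And>u. u \<in> N \<Longrightarrow> 0 \<le> sgn (u \<bullet> y) * (u \<bullet> z)"
  shows "z \<in> closure (sign_cell N y)"
proof -
  define w where "w k = z + inverse (real (Suc k)) *\<^sub>R x" for k
  have "w \<longlonglongrightarrow> z + 0 *\<^sub>R x"
    unfolding w_def by (intro tendsto_intros LIMSEQ_inverse_real_of_nat)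
  then have lim: "w \<longlonglongrightarrow> z" by simp
  have pos: "0 < sgn (u \<bullet> y) * (u \<bullet> w k)" if "u \<in> N" for u k
  proof -
    have "0 < sgn (u \<bullet> y) * (u \<bullet> x)" using assms(2) that by (auto simp: sign_cell_def)
    then have "0 < inverse (real (Suc k)) * (sgn (u \<bullet> y) * (u \<bullet> x))" by simp
    then show ?thesis using assms(4)[OF that]
      by (simp add: w_def inner_add_right algebra_simps del: of_nat_Suc)
  qed
  have nz: "w k \<noteq> 0" for k using pos[of _ k] assms(1) by fastforce
  have "w k /\<^sub>R norm (w k) \<in> sign_cell N y" for k
  proof -
    have "0 < sgn (u \<bullet> y) * (u \<bullet> (w k /\<^sub>R norm (w k)))" if "u \<in> N" for u
    proof -
      have "0 < inverse (norm (w k)) * (sgn (u \<bullet> y) * (u \<bullet> w k))" using pos[OF that] nz by simp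
      then show ?thesis by (simp add: mult.left_commute)
    qed
    then show ?thesis using nz by (simp add: sign_cell_def)
  qed
  moreover have "(\<lambda>k. w k /\<^sub>R norm (w k)) \<longlonglongrightarrow> z"
  proof -
    have "(\<lambda>k. w k /\<^sub>R norm (w k)) \<longlonglongrightarrow> z /\<^sub>R norm z"
      using assms(3) by (intro tendsto_intros lim) auto
    then show ?thesis using assms(3) by simp
  qed
  ultimately show ?thesis
    unfolding closure_sequential by (intro exI[of _ "\<lambda>k. w k /\<^sub>R norm (w k)"]) simp
qed

text \<open>The point of the cap that is furthest from \<open>v\<close> lies on the great circle through \<open>x\<close> and \<open>v\<close>, at distance
  \<open>r\<close> from \<open>x\<close>.  If \<open>v \<bullet> x = sin \<phi>\<close>, its inner product with \<open>v\<close> is \<open>sin (\<phi> - r)\<close>.  In the proof,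
  \<open>a\<close> and \<open>b\<close> are the components of \<open>v\<close> along and across \<open>x\<close>.\<close>

lemma cap_in_halfspace_iff:
  assumes "x \<in> S2" "v \<in> S2" "0 < r" "r \<le> pi / 2"
  shows "(\<forall>z\<in>cap x r. 0 \<le> v \<bullet> z) \<longleftrightarrow> sin r \<le> v \<bullet> x"
proof -
  have xx: "x \<bullet> x = 1" "v \<bullet> v = 1" using assms by (simp_all add: norm_eq_1)
  have sc: "0 < sin r" "0 \<le> cos r" "(sin r)\<^sup>2 + (cos r)\<^sup>2 = 1"
    using assms by (auto intro!: sin_gt_zero cos_ge_zero)
  define a where "a = v \<bullet> x"
  define b where "b = v - a *\<^sub>R x"
  have bx: "b \<bullet> x = 0" "x \<bullet> b = 0" by (simp_all add: b_def inner_diff_left inner_diff_right a_def xx inner_commute)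
  have vb: "v \<bullet> b = b \<bullet> b" "b \<bullet> b = 1 - a\<^sup>2"
    by (simp_all add: b_def inner_diff_left inner_diff_right a_def xx inner_commute power2_eq_square algebra_simps)
  show ?thesis
  proof
    assume cap: "\<forall>z\<in>cap x r. 0 \<le> v \<bullet> z"
    have "x \<in> cap x r" using assms(1) by (simp add: cap_def xx)
    then have a0: "0 \<le> a" using cap by (auto simp: a_def)
    show "sin r \<le> v \<bullet> x"
    proof (cases "b = 0")
      case True
      then have "a\<^sup>2 = 1" using vb by simp
      then have "a = 1" using a0 by (simp add: power2_eq_1_iff)
      then show ?thesis by (simp add: a_def[symmetric])
    next
      case False
      \<comment> \<open>the point of the cap furthest from \<open>v\<close>\<close>
      define z where "z = cos r *\<^sub>R x - (sin r / norm b) *\<^sub>R b"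
      have nb: "norm b * norm b = b \<bullet> b" by (metis power2_eq_square power2_norm_eq_inner)
      have "z \<bullet> z = cos r * cos r + (sin r / norm b) * (sin r / norm b) * (b \<bullet> b)"
        by (simp add: z_def inner_diff_left inner_diff_right xx bx inner_commute)
      also have "\<dots> = 1" using False sc(3)
        by (simp add: nb[symmetric] power2_eq_square)
      finally have "norm z = 1" by (simp add: norm_eq_1)
      moreover have "z \<bullet> x = cos r" by (simp add: z_def inner_diff_left xx bx)
      ultimately have "z \<in> cap x r" by (simp add: cap_def)
      then have "0 \<le> v \<bullet> z" using cap by blast
      also have "v \<bullet> z = cos r * a - sin r * norm b"
        using False by (simp add: z_def inner_diff_right a_def vb(1) nb[symmetric])
      finally have "sin r * norm b \<le> cos r * a" by simp
      then have "(sin r * norm b)\<^sup>2 \<le> (cos r * a)\<^sup>2"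
        using sc by (intro power_mono) auto
      then have "(sin r)\<^sup>2 * (1 - a\<^sup>2) \<le> (cos r)\<^sup>2 * a\<^sup>2"
        by (simp add: power_mult_distrib power2_norm_eq_inner vb)
      then have "(sin r)\<^sup>2 \<le> (sin r)\<^sup>2 * a\<^sup>2 + (cos r)\<^sup>2 * a\<^sup>2"
        by (simp add: right_diff_distrib)
      also have "\<dots> = ((sin r)\<^sup>2 + (cos r)\<^sup>2) * a\<^sup>2" by (simp only: distrib_right)
      finally have "(sin r)\<^sup>2 \<le> a\<^sup>2" unfolding sc(3) by simp
      then show ?thesis using a0 by (simp add: a_def[symmetric] power2_le_iff_abs_le)
    qed
  next
    assume *: "sin r \<le> v \<bullet> x"
    show "\<forall>z\<in>cap x r. 0 \<le> v \<bullet> z"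
    proof
      fix z assume z: "z \<in> cap x r"
      then have zz: "z \<bullet> z = 1" "cos r \<le> z \<bullet> x" by (auto simp: cap_def norm_eq_1)
      define h where "h = z \<bullet> x"
      define c where "c = z - h *\<^sub>R x"
      have cc: "c \<bullet> c = 1 - h\<^sup>2"
        by (simp add: c_def inner_diff_left inner_diff_right h_def xx zz inner_commute power2_eq_square algebra_simps)
      have vz: "v \<bullet> z = a * h + b \<bullet> c"
        by (simp add: b_def c_def inner_diff_left inner_diff_right h_def a_def xx inner_commute algebra_simps)
      have "(norm b)\<^sup>2 \<le> (cos r)\<^sup>2"
      proof -
        have "(sin r)\<^sup>2 \<le> a\<^sup>2" using * sc by (intro power_mono) (auto simp: a_def)
        then show ?thesis using sc(3) unfolding power2_norm_eq_inner vb(2) by linarith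
      qed
      then have nb: "norm b \<le> cos r" using sc(2) by (simp add: power2_le_iff_abs_le)
      have "(norm c)\<^sup>2 \<le> (sin r)\<^sup>2"
      proof -
        have "(cos r)\<^sup>2 \<le> h\<^sup>2" using zz sc by (intro power_mono) (auto simp: h_def)
        then show ?thesis using sc(3) unfolding power2_norm_eq_inner cc by linarith
      qed
      then have nc: "norm c \<le> sin r" using sc(1) by (simp add: power2_le_iff_abs_le)
      have "\<bar>b \<bullet> c\<bar> \<le> norm b * norm c" by (rule Cauchy_Schwarz_ineq2)
      also have "\<dots> \<le> cos r * sin r" using nb nc sc by (intro mult_mono) auto
      finally have "- (cos r * sin r) \<le> b \<bullet> c" by linarith
      moreover have "sin r * cos r \<le> a * h" using * zz sc by (intro mult_mono) (auto simp: a_def h_def)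
      ultimately show "0 \<le> v \<bullet> z" unfolding vz by (simp add: mult.commute)
    qed
  qed
qed

lemma cells_contain_caps_iff_roomy:
  assumes N: "normal_system n N" and "n > 0" and r: "0 < r" "r \<le> pi / 2"
  shows "cells_contain_caps (polar ` N) r \<longleftrightarrow> roomy N (sin r)"
proof -
  let ?U = "S2 - \<Union>(polar ` N)"
  have ne: "N \<noteq> {}" using N \<open>n > 0\<close> by (auto simp: normal_system_def)
  have U: "z \<in> ?U \<longleftrightarrow> z \<in> S2 \<and> (\<forall>u\<in>N. u \<bullet> z \<noteq> 0)" for z
    by (auto simp: polar_def inner_commute)
  have sin0: "0 < sin r" using r by (auto intro!: sin_gt_zero)
  have cells: "tiling_cells (polar ` N) = (\<lambda>y. closure (sign_cell N y)) ` ?U"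
  proof -
    have "components ?U = sign_cell N ` ?U"
      unfolding components_def by (rule image_cong[OF refl component_eq_sign_cell[OF ne]])
    then show ?thesis by (simp add: tiling_cells_def image_image)
  qed
  have cell: "cap x r \<subseteq> closure (sign_cell N y) \<longleftrightarrow> (\<forall>u\<in>N. sin r \<le> sgn (u \<bullet> y) * (u \<bullet> x))"
    if x: "x \<in> S2" and y: "y \<in> ?U" for x y
  proof -
    have half: "(\<forall>z\<in>cap x r. 0 \<le> sgn (u \<bullet> y) * (u \<bullet> z)) \<longleftrightarrow> sin r \<le> sgn (u \<bullet> y) * (u \<bullet> x)" if "u \<in> N" for u
    proof -
      have "sgn (u \<bullet> y) *\<^sub>R u \<in> S2"
        using that N y U[of y] by (auto simp: normal_system_def sgn_if)
      from cap_in_halfspace_iff[OF x this r] show ?thesis by simp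
    qed
    show ?thesis
    proof
      assume "cap x r \<subseteq> closure (sign_cell N y)"
      then have "cap x r \<subseteq> {z \<in> S2. \<forall>u\<in>N. 0 \<le> sgn (u \<bullet> y) * (u \<bullet> z)}"
        using closure_sign_cell_subset by blast
      then show "\<forall>u\<in>N. sin r \<le> sgn (u \<bullet> y) * (u \<bullet> x)" using half by blast
    next
      assume *: "\<forall>u\<in>N. sin r \<le> sgn (u \<bullet> y) * (u \<bullet> x)"
      then have "x \<in> sign_cell N y" using x sin0 by (fastforce simp: sign_cell_def)
      then show "cap x r \<subseteq> closure (sign_cell N y)"
        using * half by (auto intro!: in_closure_sign_cell[OF ne] simp: cap_def)
    qed
  qed
  have "cells_contain_caps (polar ` N) r \<longleftrightarrow>
      (\<forall>y\<in>?U. \<exists>x\<in>S2. \<forall>u\<in>N. sin r \<le> sgn (u \<bullet> y) * (u \<bullet> x))"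
    unfolding cells_contain_caps_def cells using cell by auto
  also have "\<dots> \<longleftrightarrow> roomy N (sin r)"
  proof
    assume *: "\<forall>y\<in>?U. \<exists>x\<in>S2. \<forall>u\<in>N. sin r \<le> sgn (u \<bullet> y) * (u \<bullet> x)"
    show "roomy N (sin r)" unfolding roomy_def
    proof (intro allI impI)
      fix y assume y: "\<forall>u\<in>N. u \<bullet> y \<noteq> 0"
      then have "y \<noteq> 0" using ne by auto
      then have "y /\<^sub>R norm y \<in> ?U" using y by (subst U) auto
      moreover have "sgn (u \<bullet> (y /\<^sub>R norm y)) = sgn (u \<bullet> y)" for u
        using \<open>y \<noteq> 0\<close> by (simp add: sgn_mult)
      ultimately show "\<exists>x\<in>S2. \<forall>u\<in>N. sin r \<le> sgn (u \<bullet> y) * (u \<bullet> x)" using * by metis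
    qed
  next
    assume "roomy N (sin r)"
    then show "\<forall>y\<in>?U. \<exists>x\<in>S2. \<forall>u\<in>N. sin r \<le> sgn (u \<bullet> y) * (u \<bullet> x)"
      unfolding roomy_def using U by blast
  qed
  finally show ?thesis .
qed


section \<open>Vectors and planes in three-space\<close>

text \<open>The determinant of the three vectors, serving as a test for linear independence: unlike independence
  it comes with explicit dual vectors and coordinates.\<close>

definition triple :: "real ^ 3 \<Rightarrow> real ^ 3 \<Rightarrow> real ^ 3 \<Rightarrow> real" where
  "triple a b c = a \<bullet> cross3 b c"

lemma triple_minus [simp]:
  "triple (- a) b c = - triple a b c" "triple a (- b) c = - triple a b c" "triple a b (- c) = - triple a b c"
  by (simp_all add: triple_def)

lemma triple_rotate: "triple b c a = triple a b c"
  by (simp add: triple_def cross3_simps)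

lemma triple_swap: "triple b a c = - triple a b c"
  by (simp add: triple_def cross3_simps)

text \<open>Cramer's rule.\<close>

lemma triple_expansion:
  "triple a b c *\<^sub>R x = triple x b c *\<^sub>R a + triple a x c *\<^sub>R b + triple a b x *\<^sub>R c"
  by (simp add: triple_def vec_eq_iff forall_3) (simp add: cross3_simps)

text \<open>The cross products of pairs form the dual basis up to the factor \<open>triple a b c\<close>.\<close>

lemma exists_prescribed_inner:
  assumes "triple a b c \<noteq> 0"
  obtains y where "a \<bullet> y = \<alpha>" "b \<bullet> y = \<beta>" "c \<bullet> y = \<gamma>"
proof
  define y where "y = inverse (triple a b c) *\<^sub>R
     (\<alpha> *\<^sub>R cross3 b c + \<beta> *\<^sub>R cross3 c a + \<gamma> *\<^sub>R cross3 a b)"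
  have e: "b \<bullet> cross3 c a = triple a b c" "c \<bullet> cross3 a b = triple a b c" "a \<bullet> cross3 b c = triple a b c"
    using triple_rotate by (simp_all add: triple_def)
  show "a \<bullet> y = \<alpha>" "b \<bullet> y = \<beta>" "c \<bullet> y = \<gamma>"
    using assms by (simp_all add: y_def inner_add_right dot_cross_self e field_simps)
qed

lemma unit_inner_eq_1:
  fixes u v :: "real ^ 3" assumes "u \<in> S2" "v \<in> S2" "u \<bullet> v = 1" shows "u = v"
proof -
  have "u \<bullet> u = 1" "v \<bullet> v = 1" using assms by (simp_all add: norm_eq_1)
  then have "(u - v) \<bullet> (u - v) = 0" using assms(3) by (simp add: inner_diff_left inner_diff_right inner_commute)
  then show ?thesis by simp
qed

lemma cross_eq_0_imp_parallel:
  assumes "u \<in> S2" "v \<in> S2" "cross3 u v = 0" shows "u = v \<or> u = - v"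
proof -
  have "(u \<bullet> v)\<^sup>2 = 1" using norm_cross_dot[of u v] assms by simp
  then have "u \<bullet> v = 1 \<or> u \<bullet> v = -1" by (simp add: power2_eq_1_iff)
  then show ?thesis using unit_inner_eq_1[of u v] unit_inner_eq_1[of u "- v"] assms by auto
qed

text \<open>Finitely many planes have measure zero.  This is how a vector that realizes certain signs is moved
  off all the other planes.\<close>

lemma exists_off_planes:
  fixes N :: "(real ^ 3) set"
  assumes "open S" "S \<noteq> {}" "finite N" "0 \<notin> N"
  shows "\<exists>y\<in>S. \<forall>u\<in>N. u \<bullet> y \<noteq> 0"
proof (rule ccontr)
  assume "\<not> ?thesis"
  then have "S \<subseteq> \<Union>((\<lambda>u. {y. u \<bullet> y = 0}) ` N)" by blast
  moreover have "negligible (\<Union>((\<lambda>u. {y. u \<bullet> y = 0}) ` N))"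
    using assms(3,4) by (intro negligible_Union) (auto intro!: negligible_hyperplane)
  ultimately have "negligible S" using negligible_subset by blast
  then show False using open_not_negligible assms by blast
qed

lemma sgn_eq_iff_mult_pos:
  fixes a b :: real assumes "a \<noteq> 0" shows "sgn b = sgn a \<longleftrightarrow> 0 < sgn a * b"
  using assms by (auto simp: sgn_if)

lemma open_same_signs:
  fixes N :: "(real ^ 3) set"
  assumes "finite N" "\<And>u. u \<in> N \<Longrightarrow> u \<bullet> y \<noteq> 0"
  shows "open {z. \<forall>u\<in>N. sgn (u \<bullet> z) = sgn (u \<bullet> y)}"
proof -
  have "{z. \<forall>u\<in>N. sgn (u \<bullet> z) = sgn (u \<bullet> y)} = (\<Inter>u\<in>N. {z. 0 < (sgn (u \<bullet> y) *\<^sub>R u) \<bullet> z})"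
    using assms(2) by (auto simp: sgn_eq_iff_mult_pos)
  moreover have "open \<dots>" using assms(1) by (intro open_INT ballI open_halfspace_gt)
  ultimately show ?thesis by simp
qed


section \<open>Testing a cell against positive combinations\<close>

text \<open>Fewer circles have larger cells: a vector \<open>y\<close> off the planes of \<open>M\<close> can be moved off those of \<open>N\<close> without
  changing its signs on \<open>M\<close>.\<close>

lemma roomy_subset:
  assumes "roomy N t" "M \<subseteq> N" "finite N" "0 \<notin> N"
  shows "roomy M t"
  unfolding roomy_def
proof (intro allI impI)
  fix y assume y: "\<forall>u\<in>M. u \<bullet> y \<noteq> 0"
  have "finite M" using assms finite_subset by blast
  let ?S = "{z. \<forall>u\<in>M. sgn (u \<bullet> z) = sgn (u \<bullet> y)}"
  have "open ?S" using y \<open>finite M\<close> by (intro open_same_signs) auto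
  moreover have "y \<in> ?S" by simp
  ultimately obtain z where z: "z \<in> ?S" "\<forall>u\<in>N. u \<bullet> z \<noteq> 0"
    using exists_off_planes[of ?S N] assms by blast
  obtain x where x: "x \<in> S2" "\<forall>u\<in>N. t \<le> sgn (u \<bullet> z) * (u \<bullet> x)"
    using assms(1) z(2) unfolding roomy_def by blast
  have "t \<le> sgn (u \<bullet> y) * (u \<bullet> x)" if "u \<in> M" for u
    using x(2) z(1) that assms(2) by (metis (mono_tags, lifting) mem_Collect_eq subsetD)
  then show "\<exists>x\<in>S2. \<forall>u\<in>M. t \<le> sgn (u \<bullet> y) * (u \<bullet> x)" using x(1) by blast
qed

text \<open>Replacing a normal by its negative changes both signs in the product.  Working with \<open>N\<close> together with the
  negatives allows assuming that all signs are positive.\<close>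

lemma roomy_symm: "roomy N t \<Longrightarrow> roomy (symm N) t"
  unfolding roomy_def by (simp add: ball_Un sgn_minus)

lemma roomy_cap:
  assumes N: "normal_system n N" and "roomy N t" "V \<subseteq> symm N" "\<And>v. v \<in> V \<Longrightarrow> 0 < v \<bullet> y"
  obtains x where "x \<in> S2" "\<And>v. v \<in> V \<Longrightarrow> t \<le> v \<bullet> x"
proof -
  have "roomy V t"
    using normal_systemD[OF N] roomy_symm[OF assms(2)] assms(3) by (elim roomy_subset) auto
  moreover have "\<forall>v\<in>V. v \<bullet> y \<noteq> 0" using assms(4) by force
  ultimately obtain x where "x \<in> S2" "\<forall>v\<in>V. t \<le> sgn (v \<bullet> y) * (v \<bullet> x)"
    unfolding roomy_def by blast
  then show thesis using assms(4) that by simp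
qed

text \<open>The test with \<open>u + v\<close>, which is also the vector at which both signs are positive.\<close>

lemma roomy_pair:
  assumes N: "normal_system n N" and "roomy N t" "0 \<le> t" "u \<in> symm N" "v \<in> symm N" "u \<noteq> - v"
  shows "2 * t\<^sup>2 \<le> 1 + u \<bullet> v"
proof -
  have uv: "u \<in> S2" "v \<in> S2" using assms normal_systemD(4)[OF N] by blast+
  then have uu: "u \<bullet> u = 1" "v \<bullet> v = 1" by (simp_all add: norm_eq_1)
  have "\<bar>u \<bullet> v\<bar> \<le> 1" using Cauchy_Schwarz_ineq2[of u v] uv by simp
  moreover have "u \<bullet> v \<noteq> -1" using unit_inner_eq_1[of u "- v"] uv assms(6) by auto
  ultimately have p: "0 < 1 + u \<bullet> v" by linarith
  have "{u, v} \<subseteq> symm N" using assms by blast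
  moreover have "0 < w \<bullet> (u + v)" if "w \<in> {u, v}" for w
    using that p uu by (auto simp: inner_add_right inner_commute)
  ultimately obtain x where x: "x \<in> S2" "\<And>w. w \<in> {u, v} \<Longrightarrow> t \<le> w \<bullet> x"
    using roomy_cap[OF N assms(2)] by metis
  have "2 * t \<le> (u + v) \<bullet> x" using x(2)[of u] x(2)[of v] by (simp add: inner_add_left)
  also have "\<dots> \<le> norm (u + v) * norm x" by (rule norm_cauchy_schwarz)
  finally have "2 * t \<le> norm (u + v)" using x(1) by simp
  then have "(2 * t)\<^sup>2 \<le> (norm (u + v))\<^sup>2" using \<open>0 \<le> t\<close> by (intro power_mono) auto
  also have "\<dots> = 2 + 2 * (u \<bullet> v)"
    by (simp add: power2_norm_eq_inner inner_add_left inner_add_right uu inner_commute)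
  finally show ?thesis by (simp add: power2_eq_square)
qed

lemma roomy_pair_abs:
  assumes N: "normal_system n N" and "roomy N t" "0 \<le> t" "u \<in> N" "v \<in> N" "u \<noteq> v"
  shows "2 * t\<^sup>2 \<le> 1 - \<bar>u \<bullet> v\<bar>"
proof -
  have "u \<noteq> - v" using assms by (auto simp: normal_system_def)
  then have "2 * t\<^sup>2 \<le> 1 + u \<bullet> v" using assms by (intro roomy_pair[OF N]) auto
  moreover have "2 * t\<^sup>2 \<le> 1 + u \<bullet> (- v)" using assms by (intro roomy_pair[OF N]) auto
  ultimately show ?thesis by simp
qed

text \<open>The test with weights for three independent vectors.  Independence makes the signs realizable.\<close>

lemma roomy_triple:
  assumes N: "normal_system n N" and "roomy N t" and t: "0 \<le> t"
    and abc: "a \<in> symm N" "b \<in> symm N" "c \<in> symm N" "triple a b c \<noteq> 0"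
    and w: "0 \<le> \<alpha>" "0 \<le> \<beta>" "0 \<le> \<gamma>"
  shows "(\<alpha> + \<beta> + \<gamma>) * t \<le> norm (\<alpha> *\<^sub>R a + \<beta> *\<^sub>R b + \<gamma> *\<^sub>R c)"
proof -
  obtain y where "a \<bullet> y = 1" "b \<bullet> y = 1" "c \<bullet> y = 1"
    using exists_prescribed_inner[OF abc(4)] by metis
  then have "0 < v \<bullet> y" if "v \<in> {a, b, c}" for v using that by auto
  moreover have "{a, b, c} \<subseteq> symm N" using abc by blast
  ultimately obtain x where x: "x \<in> S2" "\<And>v. v \<in> {a, b, c} \<Longrightarrow> t \<le> v \<bullet> x"
    using roomy_cap[OF N assms(2)] by metis
  have "(\<alpha> + \<beta> + \<gamma>) * t = \<alpha> * t + \<beta> * t + \<gamma> * t" by (simp add: algebra_simps)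
  also have "\<dots> \<le> \<alpha> * (a \<bullet> x) + \<beta> * (b \<bullet> x) + \<gamma> * (c \<bullet> x)"
    using x(2) w by (intro add_mono mult_left_mono) auto
  also have "\<dots> = (\<alpha> *\<^sub>R a + \<beta> *\<^sub>R b + \<gamma> *\<^sub>R c) \<bullet> x" by (simp add: inner_add_left)
  also have "\<dots> \<le> norm (\<alpha> *\<^sub>R a + \<beta> *\<^sub>R b + \<gamma> *\<^sub>R c) * norm x" by (rule norm_cauchy_schwarz)
  finally show ?thesis using x(1) by simp
qed

lemma roomy_triple_sum:
  assumes N: "normal_system n N" and "roomy N t" and t: "0 \<le> t"
    and abc: "a \<in> symm N" "b \<in> symm N" "c \<in> symm N" "triple a b c \<noteq> 0"
  shows "9 * t\<^sup>2 \<le> 3 + 2 * (a \<bullet> b + a \<bullet> c + b \<bullet> c)"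
proof -
  have u: "a \<bullet> a = 1" "b \<bullet> b = 1" "c \<bullet> c = 1"
    using abc normal_systemD(4)[OF N] by (auto simp: norm_eq_1)
  have "3 * t \<le> norm (a + b + c)"
    using roomy_triple[OF assms, of 1 1 1] by simp
  then have "(3 * t)\<^sup>2 \<le> (norm (a + b + c))\<^sup>2" using t by (intro power_mono) auto
  then show ?thesis
    by (simp add: power2_norm_eq_inner inner_add_left inner_add_right u inner_commute power_mult_distrib)
qed


section \<open>Coplanar normals\<close>

text \<open>In the linear relation between three pairwise non-parallel coplanar vectors no coefficient vanishes; flipping the vectors with the
  wrong sign makes all of them positive.\<close>

lemma coplanar_positive_relation:
  assumes abc: "a \<in> S2" "b \<in> S2" "c \<in> S2" "triple a b c = 0"
    and ne: "a \<noteq> b" "a \<noteq> - b" "a \<noteq> c" "a \<noteq> - c" "b \<noteq> c" "b \<noteq> - c"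
  obtains a' b' \<alpha> \<beta> where "a' \<in> {a, - a}" "b' \<in> {b, - b}" "0 < \<alpha>" "0 < \<beta>"
    "\<alpha> *\<^sub>R a' + \<beta> *\<^sub>R b' + c = 0"
proof -
  define m where "m = cross3 a b"
  have "m \<noteq> 0" using cross_eq_0_imp_parallel[of a b] abc ne by (auto simp: m_def)
  have m: "triple a b m = m \<bullet> m" unfolding m_def triple_def by (simp add: cross3_simps)
  define p where "p = triple c b m / (m \<bullet> m)"
  define q where "q = triple a c m / (m \<bullet> m)"
  have "(m \<bullet> m) *\<^sub>R c = triple c b m *\<^sub>R a + triple a c m *\<^sub>R b"
    using triple_expansion[of a b m c] by (simp add: m abc)
  then have "c = inverse (m \<bullet> m) *\<^sub>R (triple c b m *\<^sub>R a + triple a c m *\<^sub>R b)"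
    using \<open>m \<noteq> 0\<close> by (metis inner_eq_zero_iff scaleR_left_imp_eq scaleR_scaleR right_inverse scaleR_one)
  then have c: "c = p *\<^sub>R a + q *\<^sub>R b"
    by (simp add: p_def q_def scaleR_add_right divide_inverse mult.commute)
  have par: "\<bar>k\<bar> = 1" if "c = k *\<^sub>R d" "d \<in> S2" for k d
    using that abc(3) by auto
  have "p \<noteq> 0" 
  proof
    assume "p = 0"
    then have "c = q *\<^sub>R b" using c by simp
    moreover from this have "q = 1 \<or> q = -1" using par[of q b] abc by linarith
    ultimately show False using ne by auto
  qed
  have "q \<noteq> 0" 
  proof
    assume "q = 0"
    then have "c = p *\<^sub>R a" using c by simp
    moreover from this have "p = 1 \<or> p = -1" using par[of p a] abc by linarith
    ultimately show False using ne by auto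
  qed
  show thesis
  proof
    show "- sgn p *\<^sub>R a \<in> {a, - a}" "- sgn q *\<^sub>R b \<in> {b, - b}" by (auto simp: sgn_if \<open>p \<noteq> 0\<close> \<open>q \<noteq> 0\<close>)
    show "0 < \<bar>p\<bar>" "0 < \<bar>q\<bar>" using \<open>p \<noteq> 0\<close> \<open>q \<noteq> 0\<close> by auto
    show "\<bar>p\<bar> *\<^sub>R (- sgn p *\<^sub>R a) + \<bar>q\<bar> *\<^sub>R (- sgn q *\<^sub>R b) + c = 0"
      by (subst c) (simp add: abs_mult_sgn)
  qed
qed

text \<open>If all angles are at most \<open>2\<pi>/3\<close>, taking inner products of the relation with each vector shows that
  every coefficient is at most the mean of the other two.  So the coefficients are equal, and all angles are \<open>2\<pi>/3\<close>.\<close>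

lemma positive_relation_angles:
  fixes a b c :: "real ^ 3"
  assumes "a \<in> S2" "b \<in> S2" "c \<in> S2" and pos: "0 < \<alpha>" "0 < \<beta>" "0 < \<gamma>"
    and rel: "\<alpha> *\<^sub>R a + \<beta> *\<^sub>R b + \<gamma> *\<^sub>R c = 0"
    and ge: "-1/2 \<le> a \<bullet> b" "-1/2 \<le> a \<bullet> c" "-1/2 \<le> b \<bullet> c"
  shows "a \<bullet> b = -1/2 \<and> a \<bullet> c = -1/2 \<and> b \<bullet> c = -1/2"
proof -
  have u: "a \<bullet> a = 1" "b \<bullet> b = 1" "c \<bullet> c = 1" using assms by (auto simp: norm_eq_1)
  have "a \<bullet> (\<alpha> *\<^sub>R a + \<beta> *\<^sub>R b + \<gamma> *\<^sub>R c) = 0" "b \<bullet> (\<alpha> *\<^sub>R a + \<beta> *\<^sub>R b + \<gamma> *\<^sub>R c) = 0"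
    "c \<bullet> (\<alpha> *\<^sub>R a + \<beta> *\<^sub>R b + \<gamma> *\<^sub>R c) = 0" unfolding rel by simp_all
  then have e: "\<alpha> + \<beta> * (a \<bullet> b) + \<gamma> * (a \<bullet> c) = 0" "\<beta> + \<alpha> * (a \<bullet> b) + \<gamma> * (b \<bullet> c) = 0"
    "\<gamma> + \<alpha> * (a \<bullet> c) + \<beta> * (b \<bullet> c) = 0"
    by (simp_all add: inner_add_right u inner_commute algebra_simps)
  have m: "\<alpha> * (-1/2) \<le> \<alpha> * (a \<bullet> b)" "\<alpha> * (-1/2) \<le> \<alpha> * (a \<bullet> c)" "\<beta> * (-1/2) \<le> \<beta> * (a \<bullet> b)"
    "\<beta> * (-1/2) \<le> \<beta> * (b \<bullet> c)" "\<gamma> * (-1/2) \<le> \<gamma> * (a \<bullet> c)" "\<gamma> * (-1/2) \<le> \<gamma> * (b \<bullet> c)"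
    by (simp_all only: mult_left_mono ge pos less_imp_le)
  have eq: "\<alpha> = \<beta>" "\<beta> = \<gamma>" using e m by linarith+
  have "1 + a \<bullet> b + a \<bullet> c = 0" "1 + a \<bullet> b + b \<bullet> c = 0" "1 + a \<bullet> c + b \<bullet> c = 0"
  proof -
    have "\<gamma> * (1 + a \<bullet> b + a \<bullet> c) = 0" "\<gamma> * (1 + a \<bullet> b + b \<bullet> c) = 0" "\<gamma> * (1 + a \<bullet> c + b \<bullet> c) = 0"
      using e unfolding eq by (simp_all add: algebra_simps)
    then show "1 + a \<bullet> b + a \<bullet> c = 0" "1 + a \<bullet> b + b \<bullet> c = 0" "1 + a \<bullet> c + b \<bullet> c = 0"
      using pos by (simp_all only: mult_eq_0_iff) auto
  qed
  then show ?thesis by linarith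
qed

text \<open>The lines spanned by the \<open>n\<close> normals divide the half-turn into \<open>n\<close> angles, and one of these is at most
  \<open>\<pi>/n\<close>.  Instead of sorting the lines, the half-turn is cut into \<open>n\<close> intervals of length \<open>\<pi>/n\<close>, starting at one of
  the lines.  Either two lines fall into the same interval, or every interval contains a line; then the
  line in the last one is close to the initial line, from the other side.\<close>

lemma planar_close_pair:
  assumes N: "normal_system n N" and "2 \<le> n" and m: "m \<noteq> 0" "\<And>u. u \<in> N \<Longrightarrow> m \<bullet> u = 0"
  obtains u v where "u \<in> N" "v \<in> N" "u \<noteq> v" "cos (pi / n) \<le> \<bar>u \<bullet> v\<bar>"
proof -
  have fin: "finite N" "card N = n" using normal_systemD[OF N] by auto
  then obtain e where e: "e \<in> N" using \<open>2 \<le> n\<close> by (metis card.empty ex_in_conv not_numeral_le_zero)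
  have unit: "u \<bullet> u = 1" if "u \<in> N" for u
    using that normal_systemD(3)[OF N] by (auto simp: norm_eq_1)
  define f where "f = inverse (norm m) *\<^sub>R cross3 m e"
  have "(norm (cross3 m e))\<^sup>2 = (norm m)\<^sup>2"
    using norm_cross_dot[of m e] m(2)[OF e] unit[OF e] by (simp add: norm_eq_1[symmetric])
  then have "norm f = 1" using m(1) by (simp add: f_def)
  then have ff: "f \<bullet> f = 1" by (simp add: norm_eq_1)
  have fo: "f \<bullet> e = 0" "m \<bullet> f = 0" by (simp_all add: f_def dot_cross_self)
  have tr: "triple e f m \<noteq> 0"
  proof -
    have "triple e f m = inverse (norm m) * ((m \<bullet> m) * (e \<bullet> e) - (m \<bullet> e)\<^sup>2)"
      unfolding f_def triple_def by (simp add: cross3_simps power2_eq_square)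
    then show ?thesis using m e unit by simp
  qed
  \<comment> \<open>\<open>e\<close> and \<open>f\<close> form an orthonormal basis of the plane that contains \<open>N\<close>.\<close>
  have dec: "u \<bullet> v = (u \<bullet> e) * (v \<bullet> e) + (u \<bullet> f) * (v \<bullet> f)" if "u \<in> N" "v \<in> N" for u v
  proof -
    define w where "w = v - (v \<bullet> e) *\<^sub>R e - (v \<bullet> f) *\<^sub>R f"
    have "e \<bullet> w = 0" "f \<bullet> w = 0"
      using unit[OF e] ff fo by (simp_all add: w_def inner_diff_right inner_commute)
    have "m \<bullet> w = 0" using fo(2) m(2) that e by (simp add: w_def inner_diff_right)
    have "triple e f m *\<^sub>R w = 0"
    proof -
      define z where "z = triple e f m *\<^sub>R w"
      have "z = (e \<bullet> w) *\<^sub>R cross3 f m + (f \<bullet> w) *\<^sub>R cross3 m e + (m \<bullet> w) *\<^sub>R cross3 e f"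
        unfolding z_def triple_def by (simp add: vec_eq_iff forall_3) (simp add: cross3_simps)
      then show ?thesis by (simp add: z_def \<open>e \<bullet> w = 0\<close> \<open>f \<bullet> w = 0\<close> \<open>m \<bullet> w = 0\<close>)
    qed
    then have "u \<bullet> w = 0" using tr by simp
    then show ?thesis by (simp add: w_def inner_diff_right mult.commute)
  qed
  have "\<exists>\<theta> \<sigma>. 0 \<le> \<theta> \<and> \<theta> < pi \<and> \<bar>\<sigma>\<bar> = 1 \<and> u \<bullet> e = \<sigma> * cos \<theta> \<and> u \<bullet> f = \<sigma> * sin \<theta>" if "u \<in> N" for u
  proof -
    have "(u \<bullet> e)\<^sup>2 + (u \<bullet> f)\<^sup>2 = 1" using dec[OF that that] unit[OF that] by (simp add: power2_eq_square)
    then obtain x where x: "0 \<le> x" "x < 2 * pi" "u \<bullet> e = cos x" "u \<bullet> f = sin x"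
      using sincos_total_2pi by metis
    show ?thesis
    proof (cases "x < pi")
      case True
      then show ?thesis using x by (intro exI[of _ x] exI[of _ 1]) simp
    next
      case False
      then show ?thesis using x by (intro exI[of _ "x - pi"] exI[of _ "-1"]) simp
    qed
  qed
  then obtain \<theta> \<sigma> where \<theta>: "\<And>u. u \<in> N \<Longrightarrow> 0 \<le> \<theta> u" "\<And>u. u \<in> N \<Longrightarrow> \<theta> u < pi"
    "\<And>u. u \<in> N \<Longrightarrow> \<bar>\<sigma> u\<bar> = (1::real)" "\<And>u. u \<in> N \<Longrightarrow> u \<bullet> e = \<sigma> u * cos (\<theta> u)"
    "\<And>u. u \<in> N \<Longrightarrow> u \<bullet> f = \<sigma> u * sin (\<theta> u)"
    by metis
  have ip: "\<bar>u \<bullet> v\<bar> = \<bar>cos (\<theta> u - \<theta> v)\<bar>" if "u \<in> N" "v \<in> N" for u v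
  proof -
    have "u \<bullet> v = (\<sigma> u * \<sigma> v) * cos (\<theta> u - \<theta> v)"
      unfolding dec[OF that] by (simp add: \<theta> that cos_diff algebra_simps)
    then show ?thesis using \<theta>(3) that by (simp add: abs_mult)
  qed
  \<comment> \<open>The first interval starts at \<open>e\<close> itself; the last case below depends on this.\<close>
  have "\<theta> e = 0"
  proof -
    have "sin (\<theta> e) = 0" using \<theta>(5)[OF e] \<theta>(3)[OF e] fo by (auto simp: inner_commute)
    then show ?thesis using \<theta>(1,2)[OF e] sin_gt_zero[of "\<theta> e"] by linarith
  qed
  define k where "k u = nat \<lfloor>\<theta> u * n / pi\<rfloor>" for u
  have kle: "real (k u) \<le> \<theta> u * n / pi" "\<theta> u * n / pi < real (k u) + 1" if "u \<in> N" for u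
    using \<theta>(1)[OF that] by (auto simp: k_def of_nat_nat floor_correct)
  have kn: "k u < n" if "u \<in> N" for u
  proof -
    have "\<theta> u * n / pi < n" using \<theta>(2)[OF that] \<open>2 \<le> n\<close> by (simp add: field_simps)
    then show ?thesis using kle(1)[OF that] by linarith
  qed
  show thesis
  proof (cases "inj_on k N")
    case False
    then obtain u v where uv: "u \<in> N" "v \<in> N" "u \<noteq> v" "k u = k v" by (auto simp: inj_on_def)
    have "\<bar>\<theta> u * n / pi - \<theta> v * n / pi\<bar> \<le> 1" using kle[OF uv(1)] kle[OF uv(2)] uv(4) by linarith
    moreover have "\<bar>\<theta> u * n / pi - \<theta> v * n / pi\<bar> = \<bar>\<theta> u - \<theta> v\<bar> * (n / pi)"
      by (simp add: abs_mult left_diff_distrib[symmetric] diff_divide_distrib[symmetric])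
    ultimately have "\<bar>\<theta> u - \<theta> v\<bar> \<le> pi / n" using \<open>2 \<le> n\<close> by (simp add: field_simps)
    moreover have "pi / n \<le> pi" using \<open>2 \<le> n\<close> by (simp add: field_simps)
    ultimately have "cos (pi / n) \<le> cos \<bar>\<theta> u - \<theta> v\<bar>" by (intro cos_monotone_0_pi_le) auto
    then show ?thesis using that[OF uv(1-3)] ip[OF uv(1,2)] by simp
  next
    case True
    then have "k ` N = {..<n}" using kn fin by (intro card_subset_eq) (auto simp: card_image)
    then obtain u where u: "u \<in> N" "k u = n - 1" using \<open>2 \<le> n\<close> by (metis (no_types, lifting) diff_less imageE lessThan_iff less_numeral_extra(1) order_less_le_trans pos2)
    have "u \<noteq> e" using u(2) \<open>\<theta> e = 0\<close> \<open>2 \<le> n\<close> by (auto simp: k_def)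
    have "real n - 1 \<le> \<theta> u * n / pi" using kle(1)[OF u(1)] u(2) \<open>2 \<le> n\<close> by (simp add: of_nat_diff)
    then have "pi - \<theta> u \<le> pi / n" using \<open>2 \<le> n\<close> by (simp add: field_simps)
    moreover have "pi / n \<le> pi" using \<open>2 \<le> n\<close> by (simp add: field_simps)
    ultimately have "cos (pi / n) \<le> cos (pi - \<theta> u)"
      using \<theta>(2)[OF u(1)] by (intro cos_monotone_0_pi_le) auto
    also have "\<dots> \<le> \<bar>u \<bullet> e\<bar>" using ip[OF u(1) e] \<open>\<theta> e = 0\<close> by simp
    finally show ?thesis using that[OF u(1) e \<open>u \<noteq> e\<close>] by simp
  qed
qed


section \<open>Upper bounds for three and four circles\<close>

lemma roomy_coplanar_triple:
  assumes N: "normal_system n N" and R: "roomy N t" "0 \<le> t" and abc: "a \<in> N" "b \<in> N" "c \<in> N"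
    "a \<noteq> b" "a \<noteq> c" "b \<noteq> c" "triple a b c = 0"
  shows "t\<^sup>2 \<le> 1/4"
proof -
  have S: "a \<in> S2" "b \<in> S2" "c \<in> S2" using abc normal_systemD(3)[OF N] by auto
  have ne: "a \<noteq> - b" "a \<noteq> - c" "b \<noteq> - c" using abc N by (auto simp: normal_system_def)
  obtain a' b' \<alpha> \<beta> where r: "a' \<in> {a, - a}" "b' \<in> {b, - b}" "0 < \<alpha>" "0 < \<beta>"
    "\<alpha> *\<^sub>R a' + \<beta> *\<^sub>R b' + c = 0"
    using coplanar_positive_relation[OF S abc(7,4) ne(1) abc(5) ne(2) abc(6) ne(3)] by metis
  have S': "a' \<in> S2" "b' \<in> S2" using r S by auto
  have sy: "a' \<in> symm N" "b' \<in> symm N" "c \<in> symm N" using r abc by auto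
  have ne': "a' \<noteq> - b'" "a' \<noteq> - c" "b' \<noteq> - c" using r(1,2) ne abc by auto
  have p: "2 * t\<^sup>2 \<le> 1 + a' \<bullet> b'" "2 * t\<^sup>2 \<le> 1 + a' \<bullet> c" "2 * t\<^sup>2 \<le> 1 + b' \<bullet> c"
    using roomy_pair[OF N R] sy ne' by blast+
  have "a' \<bullet> b' \<le> -1/2 \<or> a' \<bullet> c \<le> -1/2 \<or> b' \<bullet> c \<le> -1/2"
    using positive_relation_angles[OF S' S(3) r(3,4), of 1] r(5) by fastforce
  then show ?thesis using p by linarith
qed

lemma roomy_three:
  assumes N: "normal_system n N" and R: "roomy N t" "0 \<le> t" and abc: "a \<in> N" "b \<in> N" "c \<in> N"
    "a \<noteq> b" "a \<noteq> c" "b \<noteq> c"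
  shows "t\<^sup>2 \<le> 1/3" and "t\<^sup>2 = 1/3 \<Longrightarrow> a \<bullet> b = 0 \<and> a \<bullet> c = 0 \<and> b \<bullet> c = 0"
proof -
  have "t\<^sup>2 \<le> 1/3 \<and> (t\<^sup>2 = 1/3 \<longrightarrow> a \<bullet> b = 0 \<and> a \<bullet> c = 0 \<and> b \<bullet> c = 0)"
  proof (cases "triple a b c = 0")
    case True
    then show ?thesis using roomy_coplanar_triple[OF N R abc] by simp
  next
    case False
    have s: "a \<in> symm N" "b \<in> symm N" "c \<in> symm N" "- a \<in> symm N" "- b \<in> symm N" "- c \<in> symm N"
      using abc by auto
    have "9 * t\<^sup>2 \<le> 3 + 2 * (a \<bullet> b + a \<bullet> c + b \<bullet> c)"
      "9 * t\<^sup>2 \<le> 3 + 2 * (- (a \<bullet> b) - a \<bullet> c + b \<bullet> c)"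
      "9 * t\<^sup>2 \<le> 3 + 2 * (- (a \<bullet> b) + a \<bullet> c - b \<bullet> c)"
      "9 * t\<^sup>2 \<le> 3 + 2 * (a \<bullet> b - a \<bullet> c - b \<bullet> c)"
      using roomy_triple_sum[OF N R s(1) s(2) s(3)] roomy_triple_sum[OF N R s(4) s(2) s(3)]
        roomy_triple_sum[OF N R s(1) s(5) s(3)] roomy_triple_sum[OF N R s(1) s(2) s(6)] False
      by simp_all
    then show ?thesis by argo
  qed
  then show "t\<^sup>2 \<le> 1/3" "t\<^sup>2 = 1/3 \<Longrightarrow> a \<bullet> b = 0 \<and> a \<bullet> c = 0 \<and> b \<bullet> c = 0" by auto
qed

text \<open>The relation makes the weighted sum of three of the vectors as short as the smallest coefficient, while the weights
  add up to at least three times that coefficient.\<close>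

lemma roomy_smallest_coefficient:
  assumes N: "normal_system n N" and R: "roomy N t" "0 \<le> t"
    and abc: "a \<in> symm N" "b \<in> symm N" "c \<in> symm N" "d \<in> symm N" "triple a b c \<noteq> 0"
    and rel: "\<alpha> *\<^sub>R a + \<beta> *\<^sub>R b + \<gamma> *\<^sub>R c + \<delta> *\<^sub>R d = 0"
    and pos: "0 < \<delta>" "\<delta> \<le> \<alpha>" "\<delta> \<le> \<beta>" "\<delta> \<le> \<gamma>"
  shows "t \<le> 1/3"
proof -
  have "norm d = 1" using abc normal_systemD(4)[OF N] by auto
  have "\<alpha> *\<^sub>R a + \<beta> *\<^sub>R b + \<gamma> *\<^sub>R c = - (\<delta> *\<^sub>R d)" using rel by (simp add: eq_neg_iff_add_eq_0)
  then have "norm (\<alpha> *\<^sub>R a + \<beta> *\<^sub>R b + \<gamma> *\<^sub>R c) = \<delta>" using \<open>norm d = 1\<close> pos by simp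
  then have "(\<alpha> + \<beta> + \<gamma>) * t \<le> \<delta>"
    using roomy_triple[OF N R abc(1-3,5), of \<alpha> \<beta> \<gamma>] pos by simp
  moreover have "(\<delta> + \<delta> + \<delta>) * t \<le> (\<alpha> + \<beta> + \<gamma>) * t"
    using pos R(2) by (intro mult_right_mono) auto
  ultimately have "\<delta> * (3 * t) \<le> \<delta> * 1" by (simp add: algebra_simps)
  then have "3 * t \<le> 1" using pos(1) by (simp only: mult_le_cancel_left_pos)
  then show ?thesis by simp
qed

lemma roomy_general_position:
  assumes N: "normal_system n N" and R: "roomy N t" "0 \<le> t"
    and abc: "a \<in> N" "b \<in> N" "c \<in> N" "d \<in> N"
    and T: "triple a b c \<noteq> 0" "triple a b d \<noteq> 0" "triple a c d \<noteq> 0" "triple b c d \<noteq> 0"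
  shows "t \<le> 1/3"
proof -
  \<comment> \<open>Cramer's rule gives the relation; its coefficients are the four triple products.\<close>
  define p q r s where "p = triple b c d" and "q = triple a c d" and "r = triple a b d" and "s = triple a b c"
  have nz: "p \<noteq> 0" "q \<noteq> 0" "r \<noteq> 0" "s \<noteq> 0" using T by (simp_all add: p_def q_def r_def s_def)
  have "triple a d c = - q" "triple d b c = p" 
    unfolding p_def q_def by (metis triple_rotate triple_swap)+
  then have rel: "p *\<^sub>R a - q *\<^sub>R b + r *\<^sub>R c - s *\<^sub>R d = 0"
    using triple_expansion[of a b c d] by (simp add: p_def q_def r_def s_def)
  define a' b' c' d' where "a' = sgn p *\<^sub>R a" and "b' = - sgn q *\<^sub>R b" and "c' = sgn r *\<^sub>R c" and "d' = - sgn s *\<^sub>R d"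
  have sy: "a' \<in> symm N" "b' \<in> symm N" "c' \<in> symm N" "d' \<in> symm N"
    using abc nz by (auto simp: a'_def b'_def c'_def d'_def sgn_if)
  have rel': "\<bar>p\<bar> *\<^sub>R a' + \<bar>q\<bar> *\<^sub>R b' + \<bar>r\<bar> *\<^sub>R c' + \<bar>s\<bar> *\<^sub>R d' = 0"
    using rel by (simp add: a'_def b'_def c'_def d'_def abs_mult_sgn)
  have T': "triple a' b' c' \<noteq> 0" "triple a' b' d' \<noteq> 0" "triple a' c' d' \<noteq> 0" "triple b' c' d' \<noteq> 0"
    using nz T by (simp_all add: a'_def b'_def c'_def d'_def sgn_if)
  have pos: "0 < \<bar>p\<bar>" "0 < \<bar>q\<bar>" "0 < \<bar>r\<bar>" "0 < \<bar>s\<bar>" using nz by auto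
  consider "\<bar>p\<bar> \<le> \<bar>q\<bar>" "\<bar>p\<bar> \<le> \<bar>r\<bar>" "\<bar>p\<bar> \<le> \<bar>s\<bar>" | "\<bar>q\<bar> \<le> \<bar>p\<bar>" "\<bar>q\<bar> \<le> \<bar>r\<bar>" "\<bar>q\<bar> \<le> \<bar>s\<bar>"
    | "\<bar>r\<bar> \<le> \<bar>p\<bar>" "\<bar>r\<bar> \<le> \<bar>q\<bar>" "\<bar>r\<bar> \<le> \<bar>s\<bar>" | "\<bar>s\<bar> \<le> \<bar>p\<bar>" "\<bar>s\<bar> \<le> \<bar>q\<bar>" "\<bar>s\<bar> \<le> \<bar>r\<bar>" by argo
  then show ?thesis
  proof cases
    case 1
    show ?thesis by (rule roomy_smallest_coefficient[OF N R sy(2,3,4,1) T'(4) _ pos(1) 1])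
       (use rel' in \<open>simp add: algebra_simps\<close>)
  next
    case 2
    show ?thesis by (rule roomy_smallest_coefficient[OF N R sy(1,3,4,2) T'(3) _ pos(2) 2])
       (use rel' in \<open>simp add: algebra_simps\<close>)
  next
    case 3
    show ?thesis by (rule roomy_smallest_coefficient[OF N R sy(1,2,4,3) T'(2) _ pos(3) 3])
       (use rel' in \<open>simp add: algebra_simps\<close>)
  next
    case 4
    show ?thesis by (rule roomy_smallest_coefficient[OF N R sy(1,2,3,4) T'(1) rel' pos(4) 4])
  qed
qed

text \<open>For orthogonal \<open>d\<close> and \<open>a\<close>, \<open>b\<close> at an angle of \<open>2\<pi>/3\<close> the weights \<open>2, 2, 1\<close> are the ones
  that minimize the length of the combination relative to the total weight.  Taking both \<open>d\<close> and \<open>-d\<close>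
  gives the absolute value, which is what forces \<open>d\<close> to be orthogonal in the case of equality.\<close>

lemma roomy_near_pencil_pair:
  assumes N: "normal_system n N" and R: "roomy N t" "0 \<le> t"
    and abd: "a \<in> symm N" "b \<in> symm N" "d \<in> symm N" "triple a b d \<noteq> 0"
  shows "25 * t\<^sup>2 \<le> 9 + 8 * (a \<bullet> b) - 4 * \<bar>a \<bullet> d + b \<bullet> d\<bar>"
proof -
  have u: "a \<bullet> a = 1" "b \<bullet> b = 1" "d \<bullet> d = 1"
    using abd normal_systemD(4)[OF N] by (auto simp: norm_eq_1)
  have *: "25 * t\<^sup>2 \<le> 9 + 8 * (a \<bullet> b) + 4 * (a \<bullet> e + b \<bullet> e)" if "e \<in> {d, - d}" for e
  proof -
    have e: "e \<in> symm N" "triple a b e \<noteq> 0" "e \<bullet> e = 1" using that abd u by auto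
    have "5 * t \<le> norm (2 *\<^sub>R a + 2 *\<^sub>R b + e)"
      using roomy_triple[OF N R abd(1,2) e(1,2), of 2 2 1] by simp
    then have "(5 * t)\<^sup>2 \<le> (norm (2 *\<^sub>R a + 2 *\<^sub>R b + e))\<^sup>2" using R by (intro power_mono) auto
    then show ?thesis
      unfolding power2_norm_eq_inner
      by (simp add: inner_add_left inner_add_right u e inner_commute power_mult_distrib)
  qed
  show ?thesis using *[of d] *[of "- d"] by (simp add: abs_if)
qed

text \<open>If \<open>d\<close> lies in the plane of \<open>a\<close>, \<open>b\<close>, \<open>c\<close> too, two of the four lines are at an angle of at most \<open>\<pi>/4\<close>, and the
  inequality is strict.  Otherwise it comes from a pair of signed normals at an angle of at least \<open>2\<pi>/3\<close>.
  Equality makes all three angles \<open>2\<pi>/3\<close>; then the test is sharp for every pair, so that \<open>d\<close> is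
  orthogonal to all sums of two of the signed normals, hence to each of them.\<close>

lemma roomy_near_pencil:
  assumes N: "normal_system 4 N" and R: "roomy N t" "0 \<le> t"
    and Neq: "N = {a, b, c, d}" and ne: "a \<noteq> b" "a \<noteq> c" "b \<noteq> c" and T: "triple a b c = 0"
  shows "t\<^sup>2 \<le> 1/5 \<and> (t\<^sup>2 = 1/5 \<longrightarrow> \<bar>a \<bullet> b\<bar> = 1/2 \<and> \<bar>a \<bullet> c\<bar> = 1/2 \<and> \<bar>b \<bullet> c\<bar> = 1/2
           \<and> a \<bullet> d = 0 \<and> b \<bullet> d = 0 \<and> c \<bullet> d = 0)"
proof (cases "triple a b d = 0")
  case True
  define m where "m = cross3 a b"
  have S: "a \<in> S2" "b \<in> S2" using normal_systemD(3)[OF N] Neq by auto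
  have "a \<noteq> - b" using N Neq by (auto simp: normal_system_def)
  then have m0: "m \<noteq> 0" using cross_eq_0_imp_parallel[OF S] ne by (auto simp: m_def)
  have mN: "m \<bullet> u = 0" if "u \<in> N" for u
  proof -
    have "m \<bullet> u = triple a b u" by (simp add: m_def triple_def cross3_simps)
    also have "\<dots> = 0" using that T True Neq by (auto simp: triple_def dot_cross_self)
    finally show ?thesis .
  qed
  have "(2::nat) \<le> 4" by simp
  from planar_close_pair[OF N this m0 mN]
  obtain u v where uv: "u \<in> N" "v \<in> N" "u \<noteq> v" "cos (pi / real 4) \<le> \<bar>u \<bullet> v\<bar>" by blast
  have "6/5 < sqrt 2" by (rule real_less_rsqrt) (simp add: power2_eq_square)
  then have "3/5 < \<bar>u \<bullet> v\<bar>" using uv(4) by (simp add: cos_45)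
  then have "t\<^sup>2 < 1/5" using roomy_pair_abs[OF N R uv(1-3)] by linarith
  then show ?thesis by simp
next
  case False
  have S: "a \<in> S2" "b \<in> S2" "c \<in> S2" using normal_systemD(3)[OF N] Neq by auto
  have ne': "a \<noteq> - b" "a \<noteq> - c" "b \<noteq> - c" using N Neq by (auto simp: normal_system_def)
  obtain a' b' \<alpha> \<beta> where r: "a' \<in> {a, - a}" "b' \<in> {b, - b}" "0 < \<alpha>" "0 < \<beta>"
    "\<alpha> *\<^sub>R a' + \<beta> *\<^sub>R b' + c = 0"
    using coplanar_positive_relation[OF S T ne(1) ne'(1) ne(2) ne'(2) ne(3) ne'(3)] by metis
  have S': "a' \<in> S2" "b' \<in> S2" using r S by auto
  have sy: "a' \<in> symm N" "b' \<in> symm N" "c \<in> symm N" "d \<in> symm N" using r Neq by auto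
  have c: "c = - (\<alpha> *\<^sub>R a' + \<beta> *\<^sub>R b')" using r(5) by (metis add.commute eq_neg_iff_add_eq_0)
  have t1: "triple a' b' d \<noteq> 0" using r(1,2) False by auto
  have "triple a' c d = - \<beta> * triple a' b' d" unfolding c
    by (simp add: triple_def cross3_simps)
  then have t2: "triple a' c d \<noteq> 0" using t1 r by simp
  have "triple b' c d = \<alpha> * triple a' b' d" unfolding c
    by (simp add: triple_def cross3_simps)
  then have t3: "triple b' c d \<noteq> 0" using t1 r by simp
  note p = roomy_near_pencil_pair[OF N R sy(1,2,4) t1] roomy_near_pencil_pair[OF N R sy(1,3,4) t2]
    roomy_near_pencil_pair[OF N R sy(2,3,4) t3]
  have A: "-1/2 \<le> a' \<bullet> b' \<Longrightarrow> -1/2 \<le> a' \<bullet> c \<Longrightarrow> -1/2 \<le> b' \<bullet> c \<Longrightarrow>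
      a' \<bullet> b' = -1/2 \<and> a' \<bullet> c = -1/2 \<and> b' \<bullet> c = -1/2"
    using positive_relation_angles[OF S' S(3) r(3,4), of 1] r(5) by simp
  have q: "25 * t\<^sup>2 \<le> 9 + 8 * (a' \<bullet> b')" "25 * t\<^sup>2 \<le> 9 + 8 * (a' \<bullet> c)" "25 * t\<^sup>2 \<le> 9 + 8 * (b' \<bullet> c)"
    by (rule order_trans[OF p(1)] order_trans[OF p(2)] order_trans[OF p(3)], simp)+
  have "a' \<bullet> b' \<le> -1/2 \<or> a' \<bullet> c \<le> -1/2 \<or> b' \<bullet> c \<le> -1/2" using A by argo
  then have "t\<^sup>2 \<le> 1/5" using q by argo
  moreover have "\<bar>a \<bullet> b\<bar> = 1/2 \<and> \<bar>a \<bullet> c\<bar> = 1/2 \<and> \<bar>b \<bullet> c\<bar> = 1/2 \<and> a \<bullet> d = 0 \<and> b \<bullet> d = 0 \<and> c \<bullet> d = 0"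
    if t: "t\<^sup>2 = 1/5"
  proof -
    have i: "a' \<bullet> b' = -1/2 \<and> a' \<bullet> c = -1/2 \<and> b' \<bullet> c = -1/2" by (rule A) (use q t in argo)+
    then have "\<bar>a' \<bullet> d + b' \<bullet> d\<bar> \<le> 0" "\<bar>a' \<bullet> d + c \<bullet> d\<bar> \<le> 0" "\<bar>b' \<bullet> d + c \<bullet> d\<bar> \<le> 0"
      using p t by simp_all
    then have "a' \<bullet> d = 0" "b' \<bullet> d = 0" "c \<bullet> d = 0" by linarith+
    then show ?thesis using i r(1,2) by auto
  qed
  ultimately show ?thesis by blast
qed

lemma roomy_four:
  assumes N: "normal_system 4 N" and R: "roomy N t" "0 \<le> t"
  shows "t\<^sup>2 \<le> 1/5"
    and "t\<^sup>2 = 1/5 \<Longrightarrow> \<exists>a b c d. N = {a, b, c, d} \<and> \<bar>a \<bullet> b\<bar> = 1/2 \<and> \<bar>a \<bullet> c\<bar> = 1/2 \<and> \<bar>b \<bullet> c\<bar> = 1/2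
           \<and> a \<bullet> d = 0 \<and> b \<bullet> d = 0 \<and> c \<bullet> d = 0"
proof -
  obtain a b c d where Neq: "N = {a, b, c, d}" and ne: "a \<noteq> b" "a \<noteq> c" "a \<noteq> d" "b \<noteq> c" "b \<noteq> d" "c \<noteq> d"
    using normal_systemD(2)[OF N] by (auto simp: card_Suc_eq numeral_eq_Suc)
  have perm: "N = {a, b, d, c}" "N = {a, c, d, b}" "N = {b, c, d, a}" using Neq by auto
  consider "triple a b c = 0" | "triple a b d = 0" | "triple a c d = 0" | "triple b c d = 0"
    | "triple a b c \<noteq> 0" "triple a b d \<noteq> 0" "triple a c d \<noteq> 0" "triple b c d \<noteq> 0" by blast
  then have "t\<^sup>2 \<le> 1/5 \<and> (t\<^sup>2 = 1/5 \<longrightarrow> (\<exists>a b c d. N = {a, b, c, d} \<and> \<bar>a \<bullet> b\<bar> = 1/2 \<and> \<bar>a \<bullet> c\<bar> = 1/2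
      \<and> \<bar>b \<bullet> c\<bar> = 1/2 \<and> a \<bullet> d = 0 \<and> b \<bullet> d = 0 \<and> c \<bullet> d = 0))"
  proof cases
    case 1 then show ?thesis using roomy_near_pencil[OF N R Neq] ne Neq by blast
  next
    case 2 then show ?thesis using roomy_near_pencil[OF N R perm(1)] ne perm(1) by blast
  next
    case 3 then show ?thesis using roomy_near_pencil[OF N R perm(2)] ne perm(2) by blast
  next
    case 4 then show ?thesis using roomy_near_pencil[OF N R perm(3)] ne perm(3) by blast
  next
    case 5
    then have "t \<le> 1/3" using roomy_general_position[OF N R] Neq by blast
    then have "t\<^sup>2 \<le> (1/3)\<^sup>2" using R by (intro power_mono) auto
    then show ?thesis by (simp add: power2_eq_square)
  qed
  then show "t\<^sup>2 \<le> 1/5" "t\<^sup>2 = 1/5 \<Longrightarrow> \<exists>a b c d. N = {a, b, c, d} \<and> \<bar>a \<bullet> b\<bar> = 1/2 \<and> \<bar>a \<bullet> c\<bar> = 1/2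
      \<and> \<bar>b \<bullet> c\<bar> = 1/2 \<and> a \<bullet> d = 0 \<and> b \<bullet> d = 0 \<and> c \<bullet> d = 0" by blast+
qed

lemma roomy_at_least_four:
  assumes N: "normal_system n N" and "4 \<le> n" "roomy N t" "0 \<le> t"
  shows "t\<^sup>2 \<le> 1/5"
proof -
  obtain M where M: "M \<subseteq> N" "card M = 4"
    using obtain_subset_with_card_n[of 4 N] normal_systemD(2)[OF N] assms(2) by metis
  have "normal_system 4 M" using normal_system_subset[OF N M(1)] M(2) by simp
  moreover have "roomy M t"
    using roomy_subset[OF assms(3) M(1)] normal_systemD[OF N] by auto
  ultimately show ?thesis using roomy_four(1) assms(4) by blast
qed


section \<open>Arrangements attaining the bounds\<close>

text \<open>The cap in the cell of \<open>y\<close> is centered at the normalized sum of the vectors, signed as at \<open>y\<close>.\<close>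

lemma roomy_orthonormal:
  assumes fin: "finite N" "N \<noteq> {}" and S: "N \<subseteq> S2"
    and orth: "\<And>u v. u \<in> N \<Longrightarrow> v \<in> N \<Longrightarrow> u \<noteq> v \<Longrightarrow> u \<bullet> v = 0"
  shows "roomy N (1 / sqrt (card N))"
  unfolding roomy_def
proof (intro allI impI)
  fix y assume y: "\<forall>u\<in>N. u \<bullet> y \<noteq> 0"
  define s where "s u = sgn (u \<bullet> y)" for u
  have ss: "s u * s u = 1" if "u \<in> N" for u using y that by (auto simp: s_def sgn_if)
  have unit: "u \<bullet> u = 1" if "u \<in> N" for u using S that by (auto simp: norm_eq_1)
  have n: "0 < real (card N)" using fin by (simp add: card_gt_0_iff)
  define w where "w = (\<Sum>u\<in>N. s u *\<^sub>R u)"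
  have vw: "v \<bullet> w = s v" if "v \<in> N" for v
  proof -
    have "v \<bullet> w = (\<Sum>u\<in>N. if u = v then s v else 0)"
      unfolding w_def inner_sum_right using that orth unit by (intro sum.cong) auto
    then show ?thesis using fin that by simp
  qed
  have "w \<bullet> w = (\<Sum>u\<in>N. s u * (u \<bullet> w))" by (subst w_def) (simp add: inner_sum_left)
  also have "\<dots> = card N" using vw ss by simp
  finally have "norm w = sqrt (card N)" by (simp add: norm_eq_sqrt_inner)
  then have "(1 / sqrt (card N)) *\<^sub>R w \<in> S2" using n by simp
  moreover have "1 / sqrt (card N) \<le> s v * (v \<bullet> ((1 / sqrt (card N)) *\<^sub>R w))" if "v \<in> N" for v
    using ss[OF that] by (simp add: vw that)
  ultimately show "\<exists>x\<in>S2. \<forall>u\<in>N. 1 / sqrt (card N) \<le> sgn (u \<bullet> y) * (u \<bullet> x)"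
    unfolding s_def by blast
qed

lemma one_sign_differs:
  fixes x y z :: real
  assumes "x \<noteq> 0" "y \<noteq> 0" "z \<noteq> 0" "x + y + z = 0"
  shows "sgn y = - sgn x \<and> sgn z = - sgn x \<or> sgn x = - sgn y \<and> sgn z = - sgn y \<or>
    sgn x = - sgn z \<and> sgn y = - sgn z"
  using assms by (cases "0 < x"; cases "0 < y"; cases "0 < z") (simp_all add: sgn_if)

text \<open>As \<open>a + b + c = 0\<close>, exactly one of the three signs at \<open>y\<close> differs from the other two.  The vector with the odd sign,
  signed suitably, is the bisector \<open>w\<close> of the sector containing the projection of \<open>y\<close>; the center of the cap is \<open>2 w \<plusminus> d\<close>,
  normalized.\<close>

lemma roomy_near_pencil_symmetric:
  assumes S: "a \<in> S2" "b \<in> S2" "c \<in> S2" "d \<in> S2"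
    and sum: "a + b + c = 0" and ip: "a \<bullet> b = -1/2" "a \<bullet> c = -1/2" "b \<bullet> c = -1/2"
    and d: "a \<bullet> d = 0" "b \<bullet> d = 0" "c \<bullet> d = 0"
  shows "roomy {a, b, c, d} (1 / sqrt 5)"
  unfolding roomy_def
proof (intro allI impI)
  fix y assume y: "\<forall>u\<in>{a, b, c, d}. u \<bullet> y \<noteq> 0"
  have unit: "a \<bullet> a = 1" "b \<bullet> b = 1" "c \<bullet> c = 1" "d \<bullet> d = 1" using S by (simp_all add: norm_eq_1)
  have sy: "a \<bullet> y + b \<bullet> y + c \<bullet> y = 0" using sum by (metis inner_add_left inner_zero_left)
  have "\<exists>w. w \<bullet> w = 1 \<and> w \<bullet> d = 0 \<and> (\<forall>v\<in>{a, b, c}. 1/2 \<le> sgn (v \<bullet> y) * (v \<bullet> w))"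
  proof -
    have nz: "a \<bullet> y \<noteq> 0" "b \<bullet> y \<noteq> 0" "c \<bullet> y \<noteq> 0" using y by auto
    have odd: "\<exists>w. w \<bullet> w = 1 \<and> w \<bullet> d = 0 \<and> (\<forall>v\<in>{p, q, r}. 1/2 \<le> sgn (v \<bullet> y) * (v \<bullet> w))"
      if h: "p \<bullet> p = 1" "q \<bullet> p = -1/2" "r \<bullet> p = -1/2" "p \<bullet> d = 0"
        "sgn (p \<bullet> y) = \<sigma>" "sgn (q \<bullet> y) = - \<sigma>" "sgn (r \<bullet> y) = - \<sigma>" "\<sigma> * \<sigma> = 1" for p q r \<sigma>
      by (rule exI[of _ "\<sigma> *\<^sub>R p"]) (simp add: h)
    have ip': "b \<bullet> a = -1/2" "c \<bullet> a = -1/2" "c \<bullet> b = -1/2" using ip by (simp_all add: inner_commute)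
    consider "sgn (b \<bullet> y) = - sgn (a \<bullet> y)" "sgn (c \<bullet> y) = - sgn (a \<bullet> y)"
      | "sgn (a \<bullet> y) = - sgn (b \<bullet> y)" "sgn (c \<bullet> y) = - sgn (b \<bullet> y)"
      | "sgn (a \<bullet> y) = - sgn (c \<bullet> y)" "sgn (b \<bullet> y) = - sgn (c \<bullet> y)"
      using one_sign_differs[OF nz sy] by blast
    then show ?thesis
    proof cases
      case 1
      from odd[OF unit(1) ip'(1,2) d(1) refl 1] nz show ?thesis by (auto simp: sgn_if)
    next
      case 2
      from odd[OF unit(2) ip(1) ip'(3) d(2) refl 2] nz show ?thesis by (auto simp: sgn_if)
    next
      case 3
      from odd[OF unit(3) ip(2,3) d(3) refl 3] nz show ?thesis by (auto simp: sgn_if)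
    qed
  qed
  then obtain w where w: "w \<bullet> w = 1" "w \<bullet> d = 0" "\<And>v. v \<in> {a, b, c} \<Longrightarrow> 1/2 \<le> sgn (v \<bullet> y) * (v \<bullet> w)"
    by blast
  define s where "s = sgn (d \<bullet> y)"
  have s: "s * s = 1" using y by (auto simp: s_def sgn_if)
  define x where "x = (1 / sqrt 5) *\<^sub>R (2 *\<^sub>R w + s *\<^sub>R d)"
  have "(2 *\<^sub>R w + s *\<^sub>R d) \<bullet> (2 *\<^sub>R w + s *\<^sub>R d) = 5"
    by (simp add: inner_add_left inner_add_right w unit s inner_commute[of d w] power2_eq_square)
  then have "norm x = 1" unfolding x_def by (simp add: norm_eq_sqrt_inner)
  then have "x \<in> S2" by simp
  moreover have "1 / sqrt 5 \<le> sgn (v \<bullet> y) * (v \<bullet> x)" if v: "v \<in> {a, b, c}" for v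
  proof -
    have "v \<bullet> d = 0" using v d by auto
    then have "sgn (v \<bullet> y) * (v \<bullet> x) = (1 / sqrt 5) * (2 * (sgn (v \<bullet> y) * (v \<bullet> w)))"
      by (simp add: x_def inner_add_right)
    moreover have "(1 / sqrt 5) * 1 \<le> (1 / sqrt 5) * (2 * (sgn (v \<bullet> y) * (v \<bullet> w)))"
      using w(3)[OF v] by (intro mult_left_mono) auto
    ultimately show ?thesis by simp
  qed
  moreover have "1 / sqrt 5 \<le> sgn (d \<bullet> y) * (d \<bullet> x)"
    using s by (simp add: x_def inner_add_right unit w(2) inner_commute[of d w] s_def[symmetric])
  ultimately show "\<exists>x\<in>S2. \<forall>u\<in>{a, b, c, d}. 1 / sqrt 5 \<le> sgn (u \<bullet> y) * (u \<bullet> x)" by blast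
qed

lemma roomy_near_pencil_60:
  assumes S: "a \<in> S2" "b \<in> S2" "c \<in> S2" "d \<in> S2"
    and ip: "\<bar>a \<bullet> b\<bar> = 1/2" "\<bar>a \<bullet> c\<bar> = 1/2" "\<bar>b \<bullet> c\<bar> = 1/2"
    and d: "a \<bullet> d = 0" "b \<bullet> d = 0" "c \<bullet> d = 0"
  shows "roomy {a, b, c, d} (1 / sqrt 5)"
proof -
  have unit: "a \<bullet> a = 1" "b \<bullet> b = 1" "c \<bullet> c = 1" "d \<bullet> d = 1" using S by (simp_all add: norm_eq_1)
  have T: "triple a b c = 0"
  proof -
    have "(triple a b c *\<^sub>R d) \<bullet> d = 0"
      unfolding triple_expansion[of a b c d] by (simp add: inner_add_left d)
    then show ?thesis by (simp add: unit)
  qed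
  have ne: "a \<noteq> b" "a \<noteq> - b" "a \<noteq> c" "a \<noteq> - c" "b \<noteq> c" "b \<noteq> - c" using ip unit by auto
  obtain a' b' \<alpha> \<beta> where r: "a' \<in> {a, - a}" "b' \<in> {b, - b}" "0 < \<alpha>" "0 < \<beta>"
    "\<alpha> *\<^sub>R a' + \<beta> *\<^sub>R b' + c = 0"
    by (rule coplanar_positive_relation[OF S(1-3) T ne])
  have S': "a' \<in> S2" "b' \<in> S2" using r S by auto
  have "\<bar>a' \<bullet> b'\<bar> = 1/2" "\<bar>a' \<bullet> c\<bar> = 1/2" "\<bar>b' \<bullet> c\<bar> = 1/2" using r(1,2) ip by auto
  then have "-1/2 \<le> a' \<bullet> b'" "-1/2 \<le> a' \<bullet> c" "-1/2 \<le> b' \<bullet> c" by linarith+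
  then have i: "a' \<bullet> b' = -1/2" "a' \<bullet> c = -1/2" "b' \<bullet> c = -1/2"
    using positive_relation_angles[OF S' S(3) r(3,4), of 1] r(5) by simp_all
  have "(a' + b' + c) \<bullet> (a' + b' + c) = 0"
  proof -
    have "b' \<bullet> a' = -1/2" "c \<bullet> a' = -1/2" "c \<bullet> b' = -1/2" using i by (simp_all add: inner_commute)
    moreover have "a' \<bullet> a' = 1" "b' \<bullet> b' = 1" using S' by (simp_all add: norm_eq_1)
    ultimately show ?thesis by (simp add: inner_add_left inner_add_right i unit)
  qed
  then have "a' + b' + c = 0" by simp
  then have R: "roomy {a', b', c, d} (1 / sqrt 5)"
    using r(1,2) d by (intro roomy_near_pencil_symmetric S' S i) auto
  show ?thesis
  proof (rule roomy_subset[OF roomy_symm[OF R]])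
    show "{a, b, c, d} \<subseteq> symm {a', b', c, d}" using r(1,2) by auto
    show "0 \<notin> symm {a', b', c, d}" using S' S by auto
  qed simp
qed


section \<open>Volumes of circular cones\<close>

text \<open>The circular cone with apex \<open>0\<close>, axis \<open>c\<close>, height \<open>h\<close> and slope \<open>k\<close>: for a unit vector \<open>c\<close>, the expression
  \<open>z \<bullet> z - (z \<bullet> c)\<^sup>2\<close> is the squared distance of \<open>z\<close> from the axis.  Only inner products occur, so
  orthogonal transformations map cones to cones.\<close>

definition solid_cone :: "real ^ 3 \<Rightarrow> real \<Rightarrow> real \<Rightarrow> (real ^ 3) set" where
  "solid_cone c h k = {z. 0 < z \<bullet> c \<and> z \<bullet> c \<le> h \<and> z \<bullet> z - (z \<bullet> c)\<^sup>2 < (k * (z \<bullet> c))\<^sup>2}"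

text \<open>Transports Lebesgue measure from a product space, where slices are available, to \<open>real ^ 3\<close>.\<close>

definition of_triple :: "real \<times> real \<times> real \<Rightarrow> real ^ 3" where
  "of_triple p = fst p *\<^sub>R axis 1 1 + fst (snd p) *\<^sub>R axis 2 1 + snd (snd p) *\<^sub>R axis 3 1"

lemma of_triple_nth [simp]:
  "of_triple (a, b, c) $ 1 = a" "of_triple (a, b, c) $ 2 = b" "of_triple (a, b, c) $ 3 = c"
  by (simp_all add: of_triple_def axis_def)

lemma of_triple_measurable [measurable]: "of_triple \<in> borel_measurable borel"
  unfolding of_triple_def by (intro borel_measurable_continuous_onI continuous_intros)

lemma emeasure_lborel_Times:
  fixes A :: "'a::euclidean_space set" and B :: "'b::euclidean_space set"
  assumes "A \<in> sets borel" "B \<in> sets borel"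
  shows "emeasure lborel (A \<times> B) = emeasure lborel A * emeasure lborel B"
  by (subst lborel_prod[symmetric], rule lborel.emeasure_pair_measure_Times) (simp_all add: assms)

lemma lborel_eq_distr_of_triple: "(lborel :: (real ^ 3) measure) = distr lborel borel of_triple"
proof (rule lborel_eqI)
  fix l u :: "real ^ 3" assume lu: "\<And>b. b \<in> Basis \<Longrightarrow> l \<bullet> b \<le> u \<bullet> b"
  have le: "l $ i \<le> u $ i" for i
    using lu[of "axis i 1"] by (simp add: inner_axis axis_in_Basis_iff)
  have "emeasure (distr lborel borel of_triple) (box l u)
      = emeasure lborel (of_triple -` box l u)"
    by (subst emeasure_distr) auto
  also have "of_triple -` box l u = {l $ 1<..<u $ 1} \<times> {l $ 2<..<u $ 2} \<times> {l $ 3<..<u $ 3}"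
    by (auto simp: mem_box_cart forall_3)
  also have "emeasure lborel \<dots>
      = ennreal ((u $ 1 - l $ 1) * ((u $ 2 - l $ 2) * (u $ 3 - l $ 3)))"
    using le by (simp add: emeasure_lborel_Times ennreal_mult borel_Times)
  also have "(u $ 1 - l $ 1) * ((u $ 2 - l $ 2) * (u $ 3 - l $ 3)) = (\<Prod>b\<in>Basis. (u - l) \<bullet> b)"
  proof -
    have B: "(Basis :: (real ^ 3) set) = range (\<lambda>i. axis i 1)" by (auto simp: Basis_vec_def)
    have "(\<Prod>b\<in>Basis. (u - l) \<bullet> b) = (\<Prod>i\<in>UNIV. (u - l) \<bullet> axis i 1)"
      unfolding B by (subst prod.reindex) (auto simp: inj_on_def axis_eq_axis)
    also have "\<dots> = (\<Prod>i\<in>UNIV. u $ i - l $ i)" by (simp add: inner_axis)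
    also have "\<dots> = (u $ 1 - l $ 1) * ((u $ 2 - l $ 2) * (u $ 3 - l $ 3))"
      unfolding UNIV_3 by simp
    finally show ?thesis by (rule sym)
  qed
  finally show "emeasure (distr lborel borel of_triple) (box l u) = (\<Prod>b\<in>Basis. (u - l) \<bullet> b)" .
qed simp

lemma cone_borel [measurable]: "solid_cone c h k \<in> sets borel"
  unfolding solid_cone_def by measurable

text \<open>The slice at height \<open>a\<close> is a disc of radius \<open>k a\<close>.\<close>

lemma emeasure_cone_axis:
  assumes "0 < h" "0 < k"
  shows "emeasure lborel (solid_cone (axis 1 1) h k) = ennreal (pi * k\<^sup>2 * h ^ 3 / 3)"
proof -
  let ?A = "of_triple -` solid_cone (axis 1 1) h k"
  have A: "p \<in> ?A \<longleftrightarrow> 0 < fst p \<and> fst p \<le> h \<and> (fst (snd p))\<^sup>2 + (snd (snd p))\<^sup>2 < (k * fst p)\<^sup>2" for p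
  proof (cases p)
    case (fields a b c)
    have "of_triple p \<bullet> axis 1 1 = a" "of_triple p \<bullet> of_triple p = a\<^sup>2 + b\<^sup>2 + c\<^sup>2"
      by (simp_all add: fields inner_axis inner_vec_def[of "of_triple _" "of_triple _"] sum_3 power2_eq_square)
    then show ?thesis by (simp add: solid_cone_def fields)
  qed
  have Am: "?A \<in> sets (lborel \<Otimes>\<^sub>M lborel)"
  proof -
    have "?A \<in> sets lborel" using measurable_sets[OF of_triple_measurable cone_borel] by simp
    then show ?thesis by (simp only: lborel_prod)
  qed
  have slice: "emeasure lborel (Pair a -` ?A) = ennreal (pi * k\<^sup>2 * a\<^sup>2) * indicator {0..h} a" for a
  proof (cases "0 < a \<and> a \<le> h")
    case True
    have "Pair a -` ?A = ball 0 (k * a)"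
    proof (intro set_eqI)
      fix q :: "real \<times> real"
      have "0 < k * a" using True assms by simp
      then have "norm q < k * a \<longleftrightarrow> (norm q)\<^sup>2 < (k * a)\<^sup>2"
        using power_strict_mono[of "norm q" "k * a" 2] power2_less_imp_less[of "norm q" "k * a"] by auto
      moreover have "(norm q)\<^sup>2 = (fst q)\<^sup>2 + (snd q)\<^sup>2" by (simp add: norm_prod_def)
      moreover have "q \<in> Pair a -` ?A \<longleftrightarrow> (a, q) \<in> ?A" by (rule vimage_eq)
      ultimately show "q \<in> Pair a -` ?A \<longleftrightarrow> q \<in> ball 0 (k * a)"
        using True A[of "(a, q)"] by simp
    qed
    then show ?thesis using True assms
      by (simp add: emeasure_ball unit_ball_vol_2 power2_eq_square algebra_simps)
  next
    case False
    then have "Pair a -` ?A = {}" using A by auto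
    then show ?thesis using False by (cases "a = 0") (auto simp: indicator_def)
  qed
  have "emeasure lborel (solid_cone (axis 1 1) h k) = emeasure lborel ?A"
    by (subst lborel_eq_distr_of_triple) (simp add: emeasure_distr)
  also have "\<dots> = emeasure (lborel \<Otimes>\<^sub>M lborel) ?A" by (simp add: lborel_prod)
  also have "\<dots> = (\<integral>\<^sup>+a. ennreal (pi * k\<^sup>2 * a\<^sup>2) * indicator {0..h} a \<partial>lborel)"
    by (subst lborel.emeasure_pair_measure_alt[OF Am]) (simp add: slice)
  also have "\<dots> = ennreal (pi * k\<^sup>2 * h ^ 3 / 3 - pi * k\<^sup>2 * 0 ^ 3 / 3)"
    using assms
    by (intro nn_integral_FTC_Icc) (auto intro!: derivative_eq_intros simp: power2_eq_square)
  finally show ?thesis by simp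
qed

lemma cone_bounded: "c \<in> S2 \<Longrightarrow> 0 < h \<Longrightarrow> solid_cone c h k \<subseteq> cball 0 (h * sqrt (1 + k\<^sup>2))"
proof
  fix z assume c: "c \<in> S2" and h: "0 < h" and z: "z \<in> solid_cone c h k"
  then have "z \<bullet> z \<le> (1 + k\<^sup>2) * (z \<bullet> c)\<^sup>2" by (auto simp: solid_cone_def algebra_simps power_mult_distrib)
  also have "\<dots> \<le> (1 + k\<^sup>2) * h\<^sup>2"
    using z by (intro mult_left_mono power_mono) (auto simp: solid_cone_def)
  finally have "(norm z)\<^sup>2 \<le> (h * sqrt (1 + k\<^sup>2))\<^sup>2"
    by (simp add: power2_norm_eq_inner power_mult_distrib mult.commute add_nonneg_nonneg)
  then show "z \<in> cball 0 (h * sqrt (1 + k\<^sup>2))" using h by (simp add: power2_le_iff_abs_le)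
qed

lemma cone_lmeasurable: "c \<in> S2 \<Longrightarrow> 0 < h \<Longrightarrow> solid_cone c h k \<in> lmeasurable"
  by (intro bounded_set_imp_lmeasurable bounded_subset[OF bounded_cball cone_bounded] sets_completionI_sets)
    (simp_all)

lemma measure_cone:
  assumes "c \<in> S2" "0 < h" "0 < k"
  shows "measure lebesgue (solid_cone c h k) = pi * k\<^sup>2 * h ^ 3 / 3"
proof -
  obtain f :: "real ^ 3 \<Rightarrow> real ^ 3" where f: "orthogonal_transformation f" "f (axis 1 1) = c"
    using orthogonal_transformation_exists_1[of "axis 1 1" c] assms(1) by (auto simp: norm_axis_1)
  have ip: "f z \<bullet> f w = z \<bullet> w" for z w using f(1) by (simp add: orthogonal_transformation_def)
  have eq: "solid_cone c h k = f ` solid_cone (axis 1 1) h k"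
  proof (intro equalityI subsetI)
    fix w assume w: "w \<in> solid_cone c h k"
    obtain z where "w = f z" using orthogonal_transformation_surj[OF f(1)] by (metis surjD)
    moreover from this have "z \<in> solid_cone (axis 1 1) h k"
      using w unfolding solid_cone_def f(2)[symmetric] by (simp add: ip)
    ultimately show "w \<in> f ` solid_cone (axis 1 1) h k" by blast
  next
    fix w assume "w \<in> f ` solid_cone (axis 1 1) h k"
    then show "w \<in> solid_cone c h k" unfolding solid_cone_def f(2)[symmetric] by (auto simp: ip)
  qed
  have "axis 1 1 \<in> S2" by (simp add: norm_axis_1)
  then have "measure lebesgue (solid_cone c h k) = measure lebesgue (solid_cone (axis 1 1) h k)"
    unfolding eq using measure_orthogonal_image[OF f(1) cone_lmeasurable] assms by blast
  also have "\<dots> = measure lborel (solid_cone (axis 1 1) h k)" by (simp add: measure_completion)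
  also have "\<dots> = pi * k\<^sup>2 * h ^ 3 / 3" using assms by (simp add: measure_def emeasure_cone_axis)
  finally show ?thesis .
qed

text \<open>By the relation between \<open>h\<close> and \<open>k\<close> the cones lie in the unit ball, with their rims on the sphere.\<close>

lemma disjoint_cones_card_le:
  assumes P: "finite P" "P \<subseteq> S2" and hk: "0 < h" "0 < k" "h\<^sup>2 * (1 + k\<^sup>2) = 1"
    and disj: "\<And>x x'. x \<in> P \<Longrightarrow> x' \<in> P \<Longrightarrow> x \<noteq> x' \<Longrightarrow> solid_cone x h k \<inter> solid_cone x' h k = {}"
  shows "real (card P) * (k\<^sup>2 * h ^ 3) \<le> 4"
proof -
  have "h * sqrt (1 + k\<^sup>2) = 1"
    using hk by (metis power2_eq_1_iff less_imp_le mult_nonneg_nonneg real_sqrt_abs real_sqrt_mult real_sqrt_one abs_of_nonneg)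
  then have sub: "solid_cone x h k \<subseteq> cball 0 1" if "x \<in> P" for x
    using cone_bounded[of x h k] subsetD[OF P(2) that] hk(1) by simp
  have "real (card P) * (pi * k\<^sup>2 * h ^ 3 / 3) = (\<Sum>x\<in>P. measure lebesgue (solid_cone x h k))"
  proof -
    have "(\<Sum>x\<in>P. measure lebesgue (solid_cone x h k)) = (\<Sum>x\<in>P. pi * k\<^sup>2 * h ^ 3 / 3)"
      by (intro sum.cong refl measure_cone hk subsetD[OF P(2)])
    then show ?thesis by simp
  qed
  also have "\<dots> = measure lebesgue (\<Union>x\<in>P. solid_cone x h k)"
  proof (rule measure_finite_Union[symmetric])
    show "finite P" by fact
    show "(\<lambda>x. solid_cone x h k) ` P \<subseteq> sets lebesgue"
      by (auto intro!: sets_completionI_sets)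
    show "disjoint_family_on (\<lambda>x. solid_cone x h k) P" using disj by (auto simp: disjoint_family_on_def)
    show "emeasure lebesgue (solid_cone x h k) \<noteq> \<infinity>" if "x \<in> P" for x
      using fmeasurableD2[OF cone_lmeasurable[OF subsetD[OF P(2) that] hk(1)]]
      by (simp only: infinity_ennreal_def not_False_eq_True)
  qed
  also have "\<dots> \<le> measure lebesgue (cball (0 :: real ^ 3) 1)"
  proof (rule measure_mono_fmeasurable)
    show "(\<Union>x\<in>P. solid_cone x h k) \<subseteq> cball 0 1" using sub by blast
    show "(\<Union>x\<in>P. solid_cone x h k) \<in> sets lebesgue"
      using P(1) by (intro sets.finite_UN) (auto intro!: sets_completionI_sets)
    show "cball (0 :: real ^ 3) 1 \<in> lmeasurable" by (rule lmeasurable_cball)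
  qed
  also have "\<dots> = 4 / 3 * pi"
    by (simp add: content_cball unit_ball_vol_3)
  finally have "pi * (real (card P) * (k\<^sup>2 * h ^ 3)) \<le> pi * 4" by (simp add: field_simps)
  then show ?thesis by simp
qed


section \<open>Counting cells\<close>

text \<open>A cell is recorded by the set of normals that are positive on it.\<close>

definition patterns :: "(real ^ 3) set \<Rightarrow> (real ^ 3) set set" where
  "patterns N = (\<lambda>y. {u \<in> N. 0 < u \<bullet> y}) ` {y. \<forall>u\<in>N. u \<bullet> y \<noteq> 0}"

lemma finite_patterns: "finite N \<Longrightarrow> finite (patterns N)"
  by (rule finite_subset[of _ "Pow N"]) (auto simp: patterns_def)

lemma patternsI: "(\<And>u. u \<in> N \<Longrightarrow> u \<bullet> y \<noteq> 0) \<Longrightarrow> {u \<in> N. 0 < u \<bullet> y} \<in> patterns N"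
  unfolding patterns_def by blast

lemma card_patterns_triple:
  assumes "triple a b c \<noteq> 0"
  shows "8 \<le> card (patterns {a, b, c})"
proof -
  have ne: "a \<noteq> b" "a \<noteq> c" "b \<noteq> c" using assms by (auto simp: triple_def dot_cross_self)
  have "Pow {a, b, c} \<subseteq> patterns {a, b, c}"
  proof
    fix A assume A: "A \<in> Pow {a, b, c}"
    obtain y where y: "a \<bullet> y = (if a \<in> A then 1 else -1)" "b \<bullet> y = (if b \<in> A then 1 else -1)"
      "c \<bullet> y = (if c \<in> A then 1 else -1)"
      by (rule exists_prescribed_inner[OF assms])
    then have "{u \<in> {a, b, c}. 0 < u \<bullet> y} = A" using A by (auto split: if_splits)
    moreover have "{u \<in> {a, b, c}. 0 < u \<bullet> y} \<in> patterns {a, b, c}"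
      by (rule patternsI) (use y in \<open>auto split: if_splits\<close>)
    ultimately show "A \<in> patterns {a, b, c}" by simp
  qed
  then have "card (Pow {a, b, c}) \<le> card (patterns {a, b, c})"
    by (intro card_mono finite_patterns) auto
  then show ?thesis using ne by (simp add: card_Pow)
qed

text \<open>Generic points of the plane \<open>u\<^sup>\<bottom>\<close> are projections of generic points of space: on a projected
  point, \<open>w\<close> takes the value that the projection of \<open>w\<close> takes on the original point.\<close>

lemma exists_in_plane_off_planes:
  assumes fin: "finite N" and u: "u \<in> S2" and N: "N \<subseteq> S2" "u \<notin> N" "- u \<notin> N"
    and ab: "a \<in> N" "b \<in> N" "triple u a b \<noteq> 0" and "\<alpha> \<noteq> 0" "\<beta> \<noteq> 0"
  obtains y where "u \<bullet> y = 0" "\<And>w. w \<in> N \<Longrightarrow> w \<bullet> y \<noteq> 0" "sgn (a \<bullet> y) = sgn \<alpha>" "sgn (b \<bullet> y) = sgn \<beta>"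
proof -
  define pr where "pr z = z - (z \<bullet> u) *\<^sub>R u" for z :: "real ^ 3"
  have uu: "u \<bullet> u = 1" using u by (simp add: norm_eq_1)
  have pr: "w \<bullet> pr z = pr w \<bullet> z" "u \<bullet> pr z = 0" for w z
    by (simp_all add: pr_def inner_diff_left inner_diff_right uu inner_commute)
  have nz: "0 \<notin> pr ` N"
  proof
    assume "0 \<in> pr ` N"
    then obtain w where w: "w \<in> N" "w = (w \<bullet> u) *\<^sub>R u" by (auto simp: pr_def)
    have "cross3 w u = 0" by (subst w(2)) (simp add: cross_mult_left)
    then show False using cross_eq_0_imp_parallel[of w u] w(1) N u by auto
  qed
  obtain y1 where y1: "u \<bullet> y1 = 0" "a \<bullet> y1 = \<alpha>" "b \<bullet> y1 = \<beta>"
    by (rule exists_prescribed_inner[OF ab(3)])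
  have p1: "pr a \<bullet> y1 = \<alpha>" "pr b \<bullet> y1 = \<beta>" using y1 by (simp_all add: pr_def inner_diff_left)
  let ?S = "{z. \<forall>w\<in>{pr a, pr b}. sgn (w \<bullet> z) = sgn (w \<bullet> y1)}"
  have "open ?S" by (rule open_same_signs) (use p1 assms in auto)
  moreover have "y1 \<in> ?S" by simp
  ultimately obtain z where z: "z \<in> ?S" "\<forall>w\<in>pr ` N. w \<bullet> z \<noteq> 0"
    using exists_off_planes[of ?S "pr ` N"] fin nz by blast
  show thesis
  proof
    show "u \<bullet> pr z = 0" by (rule pr)
    show "w \<bullet> pr z \<noteq> 0" if "w \<in> N" for w using z(2) that by (simp add: pr)
    show "sgn (a \<bullet> pr z) = sgn \<alpha>" "sgn (b \<bullet> pr z) = sgn \<beta>" using z(1) p1 by (simp_all add: pr)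
  qed
qed

text \<open>A new circle cuts every cell that it meets into two.  Two old circles that are independent of the new one
  divide it into four arcs, on which their signs take all four combinations; so at least four cells are cut.
  In the proof, \<open>X\<close> and \<open>Y\<close> are the old patterns of the cells on the negative and on the positive side of the
  new circle.  Together they are all old patterns, and the cells that are cut are counted by \<open>X \<inter> Y\<close>.\<close>

lemma card_patterns_insert:
  assumes fin: "finite N" and u: "u \<in> S2" and N: "N \<subseteq> S2" "u \<notin> N" "- u \<notin> N"
    and abc: "a \<in> N" "b \<in> N" "c \<in> N" "triple a b c \<noteq> 0"
  shows "card (patterns N) + 4 \<le> card (patterns (insert u N))"
proof -
  have uu: "u \<bullet> u = 1" using u by (simp add: norm_eq_1)
  obtain a' b' where ab: "a' \<in> N" "b' \<in> N" "triple u a' b' \<noteq> 0"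
  proof -
    have "triple a b c *\<^sub>R u = triple u b c *\<^sub>R a + triple a u c *\<^sub>R b + triple a b u *\<^sub>R c"
      by (rule triple_expansion)
    moreover have "triple a b c *\<^sub>R u \<noteq> 0" using abc u by auto
    ultimately consider "triple u b c \<noteq> 0" | "triple a u c \<noteq> 0" | "triple a b u \<noteq> 0" by force
    then show thesis
    proof cases
      case 1 then show thesis using that abc by blast
    next
      case 2 
      then have "triple u a c \<noteq> 0" using triple_swap[of a u c] by simp
      then show thesis using that abc by blast
    next
      case 3
      then have "triple u a b \<noteq> 0" using triple_rotate[of a b u] by simp
      then show thesis using that abc by blast
    qed
  qed
  have ne: "a' \<noteq> b'" using ab(3) by (auto simp: triple_def)
  define X where "X = {A \<in> patterns (insert u N). u \<notin> A}"
  define Y where "Y = (\<lambda>A. A - {u}) ` {A \<in> patterns (insert u N). u \<in> A}"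
  have fX: "finite X" "finite Y" using fin by (auto simp: X_def Y_def finite_patterns)
  have eqp: "{w \<in> insert u N. 0 < w \<bullet> y} - {u} = {w \<in> N. 0 < w \<bullet> y}" for y using N(2) by auto
  have card: "card (patterns (insert u N)) = card X + card Y"
  proof -
    have "card Y = card {A \<in> patterns (insert u N). u \<in> A}"
      unfolding Y_def by (intro card_image inj_onI) blast
    moreover have "patterns (insert u N) = X \<union> {A \<in> patterns (insert u N). u \<in> A}"
      by (auto simp: X_def)
    moreover have "card (X \<union> {A \<in> patterns (insert u N). u \<in> A}) = card X + card {A \<in> patterns (insert u N). u \<in> A}"
      using fin by (intro card_Un_disjoint) (auto simp: X_def finite_patterns)
    ultimately show ?thesis by simp
  qed
  have "patterns N \<subseteq> X \<union> Y"
  proof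
    fix A assume "A \<in> patterns N"
    then obtain y where y: "\<forall>w\<in>N. w \<bullet> y \<noteq> 0" "A = {w \<in> N. 0 < w \<bullet> y}" by (auto simp: patterns_def)
    let ?S = "{z. \<forall>w\<in>N. sgn (w \<bullet> z) = sgn (w \<bullet> y)}"
    have "open ?S" by (rule open_same_signs) (use fin y in auto)
    moreover have "y \<in> ?S" by simp
    moreover have "0 \<notin> insert u N" using N u by auto
    ultimately obtain z where z: "z \<in> ?S" "\<forall>w\<in>insert u N. w \<bullet> z \<noteq> 0"
      using exists_off_planes[of ?S "insert u N"] fin by blast
    have "0 < w \<bullet> z \<longleftrightarrow> 0 < w \<bullet> y" if "w \<in> N" for w
      using z(1) that by (metis (mono_tags, lifting) mem_Collect_eq sgn_greater)
    then have "A = {w \<in> N. 0 < w \<bullet> z}" using y(2) by auto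
    then have A: "A = {w \<in> insert u N. 0 < w \<bullet> z} - {u}" by (simp only: eqp)
    have P: "{w \<in> insert u N. 0 < w \<bullet> z} \<in> patterns (insert u N)" using z(2) by (intro patternsI) auto
    show "A \<in> X \<union> Y"
    proof (cases "0 < u \<bullet> z")
      case True
      then have "A \<in> Y" unfolding Y_def using A P by blast
      then show ?thesis ..
    next
      case False
      then have "A = {w \<in> insert u N. 0 < w \<bullet> z}" using A by blast
      then have "A \<in> X" unfolding X_def using P False by blast
      then show ?thesis ..
    qed
  qed
  then have c1: "card (patterns N) \<le> card (X \<union> Y)" using fX by (intro card_mono) auto
  \<comment> \<open>A point of the new plane off the old ones, moved to either side of the new plane, shows that its cell is cut.\<close>
  have "Pow {a', b'} \<subseteq> (\<lambda>A. A \<inter> {a', b'}) ` (X \<inter> Y)"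
  proof
    fix B assume B: "B \<in> Pow {a', b'}"
    define \<alpha> \<beta> :: real where "\<alpha> = (if a' \<in> B then 1 else -1)" and "\<beta> = (if b' \<in> B then 1 else -1)"
    have nz: "\<alpha> \<noteq> 0" "\<beta> \<noteq> 0" by (auto simp: \<alpha>_def \<beta>_def)
    obtain y where y: "u \<bullet> y = 0" "\<And>w. w \<in> N \<Longrightarrow> w \<bullet> y \<noteq> 0" "sgn (a' \<bullet> y) = sgn \<alpha>" "sgn (b' \<bullet> y) = sgn \<beta>"
      using exists_in_plane_off_planes[OF fin u N ab nz] by metis
    define A where "A = {w \<in> N. 0 < w \<bullet> y}"
    let ?S = "{z. \<forall>w\<in>N. sgn (w \<bullet> z) = sgn (w \<bullet> y)}"
    have "open ?S" by (rule open_same_signs) (use fin y in auto)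
    moreover have "y \<in> ?S" by simp
    ultimately obtain e where e: "e > 0" "ball y e \<subseteq> ?S" by (meson open_contains_ball)
    have near: "y + d *\<^sub>R u \<in> ?S" if "\<bar>d\<bar> < e" for d
      using e(2) that u by (intro subsetD[OF e(2)]) (simp add: dist_norm)
    have side: "{w \<in> insert u N. 0 < w \<bullet> (y + d *\<^sub>R u)} \<in> patterns (insert u N)"
      "{w \<in> N. 0 < w \<bullet> (y + d *\<^sub>R u)} = A" "u \<bullet> (y + d *\<^sub>R u) = d" if d: "\<bar>d\<bar> < e" "d \<noteq> 0" for d
    proof -
      show ud: "u \<bullet> (y + d *\<^sub>R u) = d" by (simp add: inner_add_right y uu)
      have s: "sgn (w \<bullet> (y + d *\<^sub>R u)) = sgn (w \<bullet> y)" if "w \<in> N" for w using near[OF d(1)] that by simp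
      show "{w \<in> insert u N. 0 < w \<bullet> (y + d *\<^sub>R u)} \<in> patterns (insert u N)"
      proof (rule patternsI)
        fix w assume "w \<in> insert u N"
        then show "w \<bullet> (y + d *\<^sub>R u) \<noteq> 0"
        proof
          assume "w = u" then show ?thesis using ud d by simp
        next
          assume "w \<in> N" then show ?thesis using s[of w] y(2)[of w] by (metis sgn_0_0)
        qed
      qed
      have "0 < w \<bullet> (y + d *\<^sub>R u) \<longleftrightarrow> 0 < w \<bullet> y" if "w \<in> N" for w
        using s[OF that] by (metis sgn_greater)
      then show "{w \<in> N. 0 < w \<bullet> (y + d *\<^sub>R u)} = A" unfolding A_def by blast
    qed
    have d: "\<bar>e/2\<bar> < e" "e/2 \<noteq> 0" "\<bar>-e/2\<bar> < e" "-e/2 \<noteq> 0" using e(1) by auto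
    have "{w \<in> insert u N. 0 < w \<bullet> (y + (-e/2) *\<^sub>R u)} = A"
      using side(2,3)[OF d(3,4)] e(1) by auto
    then have "A \<in> X" unfolding X_def using side(1)[OF d(3,4)] N(2) by (auto simp: A_def)
    moreover have "A \<in> Y"
    proof -
      let ?A = "{w \<in> insert u N. 0 < w \<bullet> (y + (e/2) *\<^sub>R u)}"
      have "?A - {u} = A" using side(2)[OF d(1,2)] by (simp only: eqp)
      moreover have "u \<in> ?A" using side(3)[OF d(1,2)] e(1) by simp
      ultimately show ?thesis unfolding Y_def using side(1)[OF d(1,2)] by blast
    qed
    moreover have "A \<inter> {a', b'} = B"
    proof -
      have "0 < a' \<bullet> y \<longleftrightarrow> a' \<in> B" "0 < b' \<bullet> y \<longleftrightarrow> b' \<in> B"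
        using y(3,4) by (auto simp: \<alpha>_def \<beta>_def sgn_1_pos sgn_1_neg split: if_splits)
      then show ?thesis using B ab by (auto simp: A_def)
    qed
    ultimately show "B \<in> (\<lambda>A. A \<inter> {a', b'}) ` (X \<inter> Y)" by blast
  qed
  then have "card (Pow {a', b'}) \<le> card (X \<inter> Y)"
    using fX by (intro surj_card_le) auto
  then have "4 \<le> card (X \<inter> Y)" using ne by (simp add: card_Pow)
  then show ?thesis using card c1 card_Un_Int[OF fX] by simp
qed

text \<open>Three independent circles have eight cells, and each of the other \<open>n - 3\<close> circles adds at least four.\<close>

lemma card_patterns_ge:
  assumes N: "normal_system n N" and abc: "a \<in> N" "b \<in> N" "c \<in> N" "triple a b c \<noteq> 0"
  shows "4 * (n - 1) \<le> card (patterns N)"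
proof -
  have ne: "a \<noteq> b" "a \<noteq> c" "b \<noteq> c" using abc by (auto simp: triple_def dot_cross_self)
  have fin: "finite N" "card N = n" using normal_systemD[OF N] by auto
  have "8 + 4 * card D \<le> card (patterns ({a, b, c} \<union> D))" if "finite D" "D \<subseteq> N - {a, b, c}" for D
    using that
  proof (induction D rule: finite_induct)
    case empty
    then show ?case using card_patterns_triple[OF abc(4)] by simp
  next
    case (insert u D)
    have "card (patterns ({a, b, c} \<union> D)) + 4 \<le> card (patterns (insert u ({a, b, c} \<union> D)))"
    proof (rule card_patterns_insert[of _ u a b c])
      show "{a, b, c} \<union> D \<subseteq> S2" "u \<in> S2" using insert.prems abc normal_systemD(3)[OF N] by auto
      show "- u \<notin> {a, b, c} \<union> D" using insert.prems abc N by (auto simp: normal_system_def)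
    qed (use insert abc in auto)
    then show ?case using insert by simp
  qed
  from this[of "N - {a, b, c}"] have "8 + 4 * card (N - {a, b, c}) \<le> card (patterns ({a, b, c} \<union> (N - {a, b, c})))"
    using fin by blast
  moreover have "{a, b, c} \<union> (N - {a, b, c}) = N" using abc by auto
  moreover have "card (N - {a, b, c}) = n - 3" using abc ne fin by (subst card_Diff_subset) auto
  moreover have "3 \<le> n" using card_mono[OF fin(1), of "{a, b, c}"] abc ne fin(2) by simp
  ultimately show ?thesis by simp
qed


section \<open>Packing the caps\<close>

text \<open>The cone over a cap stays in the cell of the cap.  With \<open>t = sin r\<close> and \<open>h = cos r\<close> the slope \<open>t / h\<close> is \<open>tan r\<close>; \<open>b\<close> and
  \<open>c\<close> are the components of \<open>u\<close> and \<open>z\<close> across the axis.\<close>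

lemma solid_cone_in_halfspace:
  assumes "u \<in> S2" "x \<in> S2" "0 < t" "0 < h" "t\<^sup>2 + h\<^sup>2 = 1" "t \<le> u \<bullet> x" and z: "z \<in> solid_cone x h' (t / h)"
  shows "0 < u \<bullet> z"
proof -
  have uu: "u \<bullet> u = 1" "x \<bullet> x = 1" using assms by (simp_all add: norm_eq_1)
  define b where "b = u - (u \<bullet> x) *\<^sub>R x"
  define c where "c = z - (z \<bullet> x) *\<^sub>R x"
  have zx: "0 < z \<bullet> x" using z by (simp add: solid_cone_def)
  have "u \<bullet> z = (u \<bullet> x) * (z \<bullet> x) + b \<bullet> c"
    by (simp add: b_def c_def inner_diff_left inner_diff_right uu inner_commute algebra_simps)
  moreover have "norm b \<le> h"
  proof -
    have "(norm b)\<^sup>2 = 1 - (u \<bullet> x)\<^sup>2"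
      unfolding power2_norm_eq_inner by (simp add: b_def inner_diff_left inner_diff_right uu inner_commute power2_eq_square algebra_simps)
    moreover have "t\<^sup>2 \<le> (u \<bullet> x)\<^sup>2" using assms by (intro power_mono) auto
    ultimately have "(norm b)\<^sup>2 \<le> h\<^sup>2" using assms(5) by linarith
    then show ?thesis using assms(4) by (simp add: power2_le_iff_abs_le)
  qed
  moreover have "norm c < t / h * (z \<bullet> x)"
  proof -
    have "(norm c)\<^sup>2 = z \<bullet> z - (z \<bullet> x)\<^sup>2"
      unfolding power2_norm_eq_inner by (simp add: c_def inner_diff_left inner_diff_right uu inner_commute power2_eq_square algebra_simps)
    then have "(norm c)\<^sup>2 < (t / h * (z \<bullet> x))\<^sup>2" using z by (simp add: solid_cone_def)
    moreover have "0 \<le> t / h * (z \<bullet> x)" using assms(3,4) zx by simp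
    ultimately show ?thesis by (rule power2_less_imp_less)
  qed
  moreover have "h * norm c < t * (z \<bullet> x)" using calculation(3) assms(4) by (simp add: field_simps)
  moreover have "\<bar>b \<bullet> c\<bar> \<le> norm b * norm c" by (rule Cauchy_Schwarz_ineq2)
  moreover have "norm b * norm c \<le> h * norm c" using calculation(2) by (intro mult_right_mono) auto
  moreover have "t * (z \<bullet> x) \<le> (u \<bullet> x) * (z \<bullet> x)" using assms zx by (intro mult_right_mono) auto
  ultimately show ?thesis by linarith
qed

lemma roomy_card_patterns:
  assumes N: "normal_system n N" and R: "roomy N t" and t: "0 < t" "t < 1"
  shows "real (card (patterns N)) * (t\<^sup>2 * sqrt (1 - t\<^sup>2)) \<le> 4"
proof -
  define h where "h = sqrt (1 - t\<^sup>2)"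
  have t2: "t\<^sup>2 < 1" using t by (simp add: power_less_one_iff abs_square_less_1)
  then have h: "0 < h" "h\<^sup>2 = 1 - t\<^sup>2" by (simp_all add: h_def)
  define k where "k = t / h"
  have "\<exists>x\<in>S2. (\<forall>u\<in>A. t \<le> u \<bullet> x) \<and> (\<forall>u\<in>N - A. t \<le> (- u) \<bullet> x)" if A: "A \<in> patterns N" for A
  proof -
    obtain y where y: "\<forall>u\<in>N. u \<bullet> y \<noteq> 0" "A = {u \<in> N. 0 < u \<bullet> y}" using A by (auto simp: patterns_def)
    obtain x where x: "x \<in> S2" "\<forall>u\<in>N. t \<le> sgn (u \<bullet> y) * (u \<bullet> x)" using R y(1) unfolding roomy_def by blast
    have "t \<le> u \<bullet> x" if "u \<in> A" for u using bspec[OF x(2), of u] y that by simp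
    moreover have "t \<le> (- u) \<bullet> x" if "u \<in> N - A" for u
    proof -
      have "u \<bullet> y < 0" using that y by force
      then show ?thesis using bspec[OF x(2), of u] that by simp
    qed
    ultimately show ?thesis using x(1) by blast
  qed
  then obtain f where f: "\<And>A. A \<in> patterns N \<Longrightarrow> f A \<in> S2" "\<And>A u. A \<in> patterns N \<Longrightarrow> u \<in> A \<Longrightarrow> t \<le> u \<bullet> f A"
    "\<And>A u. A \<in> patterns N \<Longrightarrow> u \<in> N \<Longrightarrow> u \<notin> A \<Longrightarrow> t \<le> (- u) \<bullet> f A"
    by (metis Diff_iff)
  have S: "u \<in> S2" "- u \<in> S2" if "u \<in> N" for u using that normal_systemD(3)[OF N] by auto
  have sub: "A \<subseteq> N" if "A \<in> patterns N" for A using that by (auto simp: patterns_def)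
  have th: "t\<^sup>2 + h\<^sup>2 = 1" using h by simp
  \<comment> \<open>A normal on which two patterns disagree separates both the cones and their axes.\<close>
  have key: "solid_cone (f A) h k \<inter> solid_cone (f B) h k = {} \<and> f A \<noteq> f B"
    if AB: "A \<in> patterns N" "B \<in> patterns N" "u \<in> A" "u \<notin> B" for A B u
  proof -
    have u: "u \<in> N" using sub AB by blast
    have "0 < u \<bullet> z" if "z \<in> solid_cone (f A) h k" for z
      using solid_cone_in_halfspace[OF S(1)[OF u] f(1)[OF AB(1)] t(1) h(1) th f(2)[OF AB(1,3)]] that
      by (simp add: k_def)
    moreover have "0 < (- u) \<bullet> z" if "z \<in> solid_cone (f B) h k" for z
      using solid_cone_in_halfspace[OF S(2)[OF u] f(1)[OF AB(2)] t(1) h(1) th f(3)[OF AB(2) u AB(4)]] that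
      by (simp add: k_def)
    ultimately have "solid_cone (f A) h k \<inter> solid_cone (f B) h k = {}" by force
    moreover have "f A \<noteq> f B" using f(2)[OF AB(1,3)] f(3)[OF AB(2) u AB(4)] t(1) by auto
    ultimately show ?thesis by blast
  qed
  have key': "solid_cone (f A) h k \<inter> solid_cone (f B) h k = {} \<and> f A \<noteq> f B"
    if AB: "A \<in> patterns N" "B \<in> patterns N" "A \<noteq> B" for A B
  proof -
    consider u where "u \<in> A" "u \<notin> B" | u where "u \<in> B" "u \<notin> A" using AB(3) by blast
    then show ?thesis using key[OF AB(1,2)] key[OF AB(2,1)] by cases (blast, metis Int_commute)
  qed
  then have "inj_on f (patterns N)" by (meson inj_onI)
  then have "card (f ` patterns N) = card (patterns N)" by (rule card_image)
  moreover have "real (card (f ` patterns N)) * (k\<^sup>2 * h ^ 3) \<le> 4"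
  proof (rule disjoint_cones_card_le)
    show "finite (f ` patterns N)" using finite_patterns normal_systemD(1)[OF N] by blast
    show "f ` patterns N \<subseteq> S2" using f(1) by blast
    show "0 < h" "0 < k" using h t by (simp_all add: k_def)
    show "h\<^sup>2 * (1 + k\<^sup>2) = 1" using h by (simp add: k_def power_divide field_simps)
    fix x x' assume "x \<in> f ` patterns N" "x' \<in> f ` patterns N" "x \<noteq> x'"
    then show "solid_cone x h k \<inter> solid_cone x' h k = {}" using key' by blast
  qed
  moreover have "k\<^sup>2 * h ^ 3 = t\<^sup>2 * h" using h(1) by (simp add: k_def power2_eq_square power3_eq_cube)
  ultimately show ?thesis by (simp add: h_def)
qed


section \<open>The bound for five or more circles\<close>

text \<open>The estimates \<open>3 < \<pi> < 4\<close> and \<open>x - x\<^sup>3/6 \<le> sin x \<le> x\<close> are precise enough: for \<open>x = \<pi>/(2m) \<le> 2/7\<close> the right-hand side of the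
  second claim is at least \<open>2.18\<close>, and the left-hand side is at most \<open>2.13\<close>.\<close>

lemma sin_pi_over_bounds:
  fixes m :: nat
  assumes "7 \<le> m"
  shows "sin (pi / (2 * real m)) \<le> 2 / 7" and "(1 + sin (pi / (2 * real m))) ^ 3 < (real m * sin (pi / (2 * real m)))\<^sup>2"
proof -
  define x where "x = pi / (2 * real m)"
  have m: "7 \<le> real m" using assms by simp
  have x0: "0 < x" using m by (simp add: x_def)
  have x1: "x \<le> 2 / 7"
  proof -
    have "x \<le> 4 / (2 * 7)" unfolding x_def using m pi_less_4 by (intro frac_le) auto
    then show ?thesis by simp
  qed
  have up: "sin x \<le> x" using x0 by (intro sin_x_le_x) simp
  then show A: "sin (pi / (2 * real m)) \<le> 2 / 7" using x1 by (simp add: x_def)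
  \<comment> \<open>\<open>145/147\<close> is \<open>1 - x\<^sup>2/6\<close> at \<open>x = 2/7\<close>.\<close>
  have "\<bar>sin x - (\<Sum>k<3. sin_coeff k * x ^ k)\<bar> \<le> inverse (fact 3) * \<bar>x\<bar> ^ 3"
    by (rule Maclaurin_sin_bound)
  moreover have "(\<Sum>k<3. sin_coeff k * x ^ k) = x"
    by (simp add: numeral_3_eq_3 sin_coeff_def)
  moreover have "inverse (fact 3 :: real) = 1 / 6" by (simp add: fact_numeral)
  ultimately have "\<bar>sin x - x\<bar> \<le> x ^ 3 / 6" using x0 by simp
  then have "x - x ^ 3 / 6 \<le> sin x" by linarith
  moreover have "x * (145 / 147) \<le> x - x ^ 3 / 6"
  proof -
    have "x\<^sup>2 \<le> (2 / 7)\<^sup>2" using x0 x1 by (intro power_mono) auto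
    then have "x * (145 / 147) \<le> x * (1 - x\<^sup>2 / 6)" using x0 by (intro mult_left_mono) (auto simp: power2_eq_square)
    then show ?thesis by (simp add: algebra_simps power2_eq_square power3_eq_cube)
  qed
  ultimately have "x * (145 / 147) \<le> sin x" by linarith
  then have "m * (x * (145 / 147)) \<le> m * sin x" using m by (intro mult_left_mono) auto
  moreover have "m * x = pi / 2" using m by (simp add: x_def)
  ultimately have "pi / 2 * (145 / 147) \<le> m * sin x" by (metis mult.assoc)
  then have "3 / 2 * (145 / 147) \<le> m * sin x" using pi_gt3 by linarith
  then have "(3 / 2 * (145 / 147))\<^sup>2 \<le> (m * sin x)\<^sup>2" by (intro power_mono) auto
  moreover have "(1 + sin x) ^ 3 \<le> (1 + 2 / 7) ^ 3"
    using A sin_ge_zero[of x] x0 x1 pi_gt3 by (intro power_mono) (auto simp: x_def)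
  ultimately show "(1 + sin (pi / (2 * real m))) ^ 3 < (real m * sin (pi / (2 * real m)))\<^sup>2"
    by (simp add: x_def power2_eq_square power3_eq_cube)
qed

lemma sin_pi_twelfth: "1 / 4 \<le> sin (pi / 12)"
proof -
  have "cos (pi / 6) = 1 - 2 * (sin (pi / 12))\<^sup>2"
    using cos_double_sin[of "pi / 12"] by simp
  then have s: "(sin (pi / 12))\<^sup>2 = (1 - sqrt 3 / 2) / 2" unfolding cos_30 by argo
  have "sqrt 3 \<le> 7 / 4" by (rule real_le_lsqrt) (auto simp: power2_eq_square)
  then have "(1 / 4)\<^sup>2 \<le> (sin (pi / 12))\<^sup>2" unfolding s by (simp add: power2_eq_square)
  moreover have "0 \<le> sin (pi / 12)" by (rule sin_ge_zero) auto
  ultimately show ?thesis by (rule power2_le_imp_le)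
qed

text \<open>The claimed inequality is the bound of the theorem: with \<open>S = sin (\<pi>/(2(n - 1)))\<close>, the square of
  \<open>\<surd>2 sin (n/(n - 1) \<pi>/4)\<close> is \<open>1 + S\<close>, so that \<open>cos\<^sup>2 r \<ge> 1/(1 + S)\<close> says \<open>t\<^sup>2 (1 + S) \<le> S\<close> for \<open>t = sin r\<close>.\<close>

lemma roomy_five_or_more:
  assumes N: "normal_system n N" and n: "5 \<le> n" and R: "roomy N t" "0 < t"
  defines "S \<equiv> sin (pi / (2 * real (n - 1)))"
  shows "t\<^sup>2 * (1 + S) \<le> S"
proof -
  have t5: "t\<^sup>2 \<le> 1/5" using roomy_at_least_four[OF N _ R(1)] n R(2) by auto
  show ?thesis
  proof (cases "n \<le> 7")
    case True
    have "pi / 12 \<le> pi / (2 * real (n - 1))" using True n by (intro divide_left_mono) auto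
    moreover have "pi / (2 * real (n - 1)) \<le> pi / 2" using n by (intro divide_left_mono) auto
    ultimately have "sin (pi / 12) \<le> S" unfolding S_def by (intro sin_monotone_2pi_le) auto
    then have S: "1 / 4 \<le> S" using sin_pi_twelfth by linarith
    have "t\<^sup>2 * (1 + S) \<le> 1 / 5 * (1 + S)" using t5 S by (intro mult_right_mono) auto
    also have "\<dots> \<le> S" using S by simp
    finally show ?thesis .
  next
    case False
    define m where "m = n - 1"
    have m: "7 \<le> m" using False by (simp add: m_def)
    have Sm: "S = sin (pi / (2 * real m))" by (simp add: S_def m_def)
    note S = sin_pi_over_bounds[OF m, folded Sm]
    have S0: "0 < S" unfolding Sm using m by (intro sin_gt_zero) (auto simp: field_simps)
    show ?thesis
    proof (cases "\<exists>a\<in>N. \<exists>b\<in>N. \<exists>c\<in>N. triple a b c \<noteq> 0")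
      case True
      then obtain a b c where abc: "a \<in> N" "b \<in> N" "c \<in> N" "triple a b c \<noteq> 0" by blast
      have "t < 1"
      proof (rule ccontr)
        assume "\<not> t < 1"
        then have "1\<^sup>2 \<le> t\<^sup>2" by (intro power_mono) auto
        then show False using t5 by simp
      qed
      have w0: "0 \<le> t\<^sup>2 * sqrt (1 - t\<^sup>2)" using t5 by simp
      have "real (4 * m) * (t\<^sup>2 * sqrt (1 - t\<^sup>2)) \<le> real (card (patterns N)) * (t\<^sup>2 * sqrt (1 - t\<^sup>2))"
        using card_patterns_ge[OF N abc] w0 by (intro mult_right_mono) (auto simp: m_def)
      also have "\<dots> \<le> 4" by (rule roomy_card_patterns[OF N R \<open>t < 1\<close>])
      finally have "m * (t\<^sup>2 * sqrt (1 - t\<^sup>2)) \<le> 1" by simp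
      then have "(m * (t\<^sup>2 * sqrt (1 - t\<^sup>2)))\<^sup>2 \<le> 1\<^sup>2" using w0 by (intro power_mono) auto
      then have vol: "(real m)\<^sup>2 * ((t\<^sup>2)\<^sup>2 * (1 - t\<^sup>2)) \<le> 1"
        using t5 by (simp add: power_mult_distrib)
      show ?thesis
      proof (rule ccontr)
        assume "\<not> ?thesis"
        then have less: "S < t\<^sup>2 * (1 + S)" by simp
        define q where "q = S / (1 + S)"
        have q: "0 < q" "q < t\<^sup>2" using S0 less by (simp_all add: q_def field_simps)
        \<comment> \<open>\<open>x\<^sup>2 (1 - x)\<close> increases on the relevant range; this is the factorization of its difference at \<open>t\<^sup>2\<close> and \<open>q\<close>.\<close>
        have "0 \<le> (t\<^sup>2 - q) * (t\<^sup>2 * (1 - t\<^sup>2 - q) + q * (1 - q))"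
          using q t5 by (intro mult_nonneg_nonneg add_nonneg_nonneg) auto
        then have "q\<^sup>2 * (1 - q) \<le> (t\<^sup>2)\<^sup>2 * (1 - t\<^sup>2)"
          by (simp add: algebra_simps power2_eq_square)
        then have "(real m)\<^sup>2 * (q\<^sup>2 * (1 - q)) \<le> 1"
          using vol by (meson mult_left_mono order_trans zero_le_power2)
        moreover have "q\<^sup>2 * (1 - q) = S\<^sup>2 / (1 + S) ^ 3"
          using S0 by (simp add: q_def power_divide field_simps power2_eq_square power3_eq_cube)
        ultimately have "(m * S)\<^sup>2 / (1 + S) ^ 3 \<le> 1" by (simp add: power_mult_distrib)
        then have "(m * S)\<^sup>2 \<le> (1 + S) ^ 3" using S0 by (simp add: divide_le_eq)
        then show False using S(2) by simp
      qed
    next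
      case False
      obtain M where "M \<subseteq> N" "card M = 2"
        using obtain_subset_with_card_n[of 2 N] normal_systemD(2)[OF N] n by auto
      then obtain a b where ab: "a \<in> N" "b \<in> N" "a \<noteq> b" by (auto simp: card_2_iff)
      have Sab: "a \<in> S2" "b \<in> S2" using ab normal_systemD(3)[OF N] by auto
      have "a \<noteq> - b" using ab N by (auto simp: normal_system_def)
      then have c0: "cross3 a b \<noteq> 0" using cross_eq_0_imp_parallel[OF Sab] ab by blast
      have "cross3 a b \<bullet> u = 0" if "u \<in> N" for u
      proof -
        have "cross3 a b \<bullet> u = triple a b u" by (simp add: triple_def cross3_simps)
        then show ?thesis using False ab that by simp
      qed
      from planar_close_pair[OF N _ c0 this] n
      obtain u v where uv: "u \<in> N" "v \<in> N" "u \<noteq> v" "cos (pi / real n) \<le> \<bar>u \<bullet> v\<bar>" by auto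
      have "2 * t\<^sup>2 \<le> 1 - \<bar>u \<bullet> v\<bar>" using R by (intro roomy_pair_abs[OF N _ _ uv(1-3)]) auto
      then have "2 * t\<^sup>2 \<le> 1 - cos (pi / real n)" using uv(4) by linarith
      also have "\<dots> = 2 * (sin (pi / (2 * real n)))\<^sup>2" using cos_double_sin[of "pi / (2 * real n)"] by simp
      finally have "t\<^sup>2 \<le> (sin (pi / (2 * real n)))\<^sup>2" by simp
      also have "\<dots> \<le> S\<^sup>2"
      proof (rule power_mono)
        have "pi / (2 * real n) \<le> pi / (2 * real m)" using m by (intro divide_left_mono) (auto simp: m_def)
        moreover have "pi / (2 * real m) \<le> pi / 2" using m by (intro divide_left_mono) auto
        moreover have "- (pi / 2) \<le> pi / (2 * real n)" by (rule order_trans[of _ 0]) auto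
        ultimately show "sin (pi / (2 * real n)) \<le> S" unfolding Sm by (intro sin_monotone_2pi_le)
        show "0 \<le> sin (pi / (2 * real n))" using n by (intro sin_ge_zero) (auto simp: field_simps)
      qed
      finally have "t\<^sup>2 * (1 + S) \<le> S\<^sup>2 * (1 + S)" using S0 by (intro mult_right_mono) auto
      also have "\<dots> = S * (S * (1 + S))" by (simp add: power2_eq_square)
      also have "\<dots> \<le> S * 1"
      proof (rule mult_left_mono)
        have "S * (1 + S) \<le> 2 / 7 * (1 + 2 / 7)" using S(1) S0 by (intro mult_mono) auto
        then show "S * (1 + S) \<le> 1" by simp
      qed (use S0 in simp)
      finally show ?thesis by simp
    qed
  qed
qed


section \<open>Attainment of the maximum\<close>

text \<open>Normalizing the vectors \<open>(1, i, 0)\<close> keeps them distinct, since \<open>i\<close> is the ratio of two coordinates, and the positive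
  first coordinate rules out antipodes.\<close>

lemma normal_system_exists: "\<exists>N. normal_system n N"
proof -
  define v :: "nat \<Rightarrow> real ^ 3" where "v i = axis 1 1 + real i *\<^sub>R axis 2 1" for i
  define f where "f i = v i /\<^sub>R norm (v i)" for i
  have v: "v i $ 1 = 1" "v i $ 2 = real i" for i by (simp_all add: v_def axis_def)
  have nz: "0 < norm (v i)" for i using v(1)[of i] by auto
  have f: "0 < f i $ 1" "f i $ 2 = real i * f i $ 1" for i
    using nz[of i] by (simp_all add: f_def v)
  have "inj f"
  proof (rule injI)
    fix i j assume "f i = f j"
    then have "real i * f i $ 1 = real j * f i $ 1" using f(2)[of i] f(2)[of j] by metis
    then show "i = j" using f(1)[of i] by auto
  qed
  moreover have "f i \<noteq> - f j" for i j using f(1)[of i] f(1)[of j] by (metis neg_less_0_iff_less not_less_iff_gr_or_eq vector_uminus_component)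
  moreover have "norm (f i) = 1" for i using nz[of i] by (simp add: f_def)
  ultimately have "normal_system n (f ` {..<n})"
    by (auto simp: normal_system_def card_image inj_on_subset) metis
  then show ?thesis by blast
qed

lemma roomy_le_1:
  assumes "normal_system n N" "0 < n" "roomy N t"
  shows "t \<le> 1"
proof -
  obtain u where u: "u \<in> N" using assms by (fastforce simp: normal_system_def)
  have "finite N" "0 \<notin> N" using normal_systemD[OF assms(1)] by auto
  then obtain y where "\<forall>u\<in>N. u \<bullet> y \<noteq> 0" using exists_off_planes[of UNIV N] by auto
  then obtain x where x: "x \<in> S2" "t \<le> sgn (u \<bullet> y) * (u \<bullet> x)"
    using assms(3) u unfolding roomy_def by blast
  have "sgn (u \<bullet> y) * (u \<bullet> x) \<le> \<bar>u \<bullet> x\<bar>" by (auto simp: sgn_if)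
  also have "\<dots> \<le> norm u * norm x" by (rule Cauchy_Schwarz_ineq2)
  also have "\<dots> = 1" using u x normal_systemD(3)[OF assms(1)] by auto
  finally show ?thesis using x(2) by linarith
qed

text \<open>There are finitely many cells and finitely many circles, so the smallest margin of chosen interior points of
  the cells is positive.\<close>

lemma exists_roomy:
  assumes N: "normal_system n N" and "0 < n"
  shows "\<exists>t>0. roomy N t"
proof -
  have fin: "finite N" "0 \<notin> N" and ne: "N \<noteq> {}" 
    using normal_systemD[OF N] \<open>0 < n\<close> by auto
  have "\<exists>x\<in>S2. \<exists>m>0. \<forall>u\<in>N. (u \<in> A \<longrightarrow> m \<le> u \<bullet> x) \<and> (u \<notin> A \<longrightarrow> m \<le> - (u \<bullet> x))"
    if A: "A \<in> patterns N" for A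
  proof -
    obtain y where y: "\<forall>u\<in>N. u \<bullet> y \<noteq> 0" "A = {u \<in> N. 0 < u \<bullet> y}" using A by (auto simp: patterns_def)
    have "y \<noteq> 0" using y(1) ne by auto
    define x where "x = y /\<^sub>R norm y"
    have x: "x \<in> S2" "u \<bullet> x = (u \<bullet> y) / norm y" for u
      using \<open>y \<noteq> 0\<close> by (simp_all add: x_def divide_inverse)
    define m where "m = Min ((\<lambda>u. \<bar>u \<bullet> x\<bar>) ` N)"
    have "m \<in> (\<lambda>u. \<bar>u \<bullet> x\<bar>) ` N" unfolding m_def using fin ne by (intro Min_in) auto
    then have "0 < m" using y(1) \<open>y \<noteq> 0\<close> by (auto simp: x)
    have mle: "m \<le> \<bar>u \<bullet> x\<bar>" if "u \<in> N" for u unfolding m_def using fin that by (intro Min_le) auto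
    have sg: "0 < u \<bullet> x \<longleftrightarrow> u \<in> A" if "u \<in> N" for u
      using that y(2) \<open>y \<noteq> 0\<close> by (simp add: x zero_less_divide_iff)
    have "(u \<in> A \<longrightarrow> m \<le> u \<bullet> x) \<and> (u \<notin> A \<longrightarrow> m \<le> - (u \<bullet> x))" if "u \<in> N" for u
      using mle[OF that] sg[OF that] by (auto simp: abs_if split: if_splits)
    then show ?thesis using x(1) \<open>0 < m\<close> by blast
  qed
  then have "\<forall>A\<in>patterns N. \<exists>m. 0 < m \<and>
      (\<exists>x\<in>S2. \<forall>u\<in>N. (u \<in> A \<longrightarrow> m \<le> u \<bullet> x) \<and> (u \<notin> A \<longrightarrow> m \<le> - (u \<bullet> x)))" by blast
  from bchoice[OF this] obtain m where m: "\<forall>A\<in>patterns N. 0 < m A \<and>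
      (\<exists>x\<in>S2. \<forall>u\<in>N. (u \<in> A \<longrightarrow> m A \<le> u \<bullet> x) \<and> (u \<notin> A \<longrightarrow> m A \<le> - (u \<bullet> x)))" ..
  obtain y0 where "\<forall>u\<in>N. u \<bullet> y0 \<noteq> 0" using exists_off_planes[of UNIV N] fin by auto
  then have "patterns N \<noteq> {}" using patternsI by blast
  define t where "t = Min (m ` patterns N)"
  have "t \<in> m ` patterns N" unfolding t_def using fin \<open>patterns N \<noteq> {}\<close>
    by (intro Min_in) (auto simp: finite_patterns)
  then have "0 < t" using m by auto
  moreover have "roomy N t" unfolding roomy_def
  proof (intro allI impI)
    fix y assume y: "\<forall>u\<in>N. u \<bullet> y \<noteq> 0"
    let ?A = "{u \<in> N. 0 < u \<bullet> y}"
    have A: "?A \<in> patterns N" using y by (intro patternsI) blast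
    have "t \<le> m ?A" unfolding t_def using fin A by (intro Min_le) (auto simp: finite_patterns)
    obtain x where x: "x \<in> S2" "\<And>u. u \<in> N \<Longrightarrow> u \<in> ?A \<Longrightarrow> m ?A \<le> u \<bullet> x"
      "\<And>u. u \<in> N \<Longrightarrow> u \<notin> ?A \<Longrightarrow> m ?A \<le> - (u \<bullet> x)"
      using bspec[OF m A] by blast
    have "m ?A \<le> sgn (u \<bullet> y) * (u \<bullet> x)" if "u \<in> N" for u
    proof (cases "0 < u \<bullet> y")
      case True
      then show ?thesis using x(2)[OF that] that by simp
    next
      case False
      moreover have "u \<bullet> y \<noteq> 0" using y that by blast
      ultimately have "u \<bullet> y < 0" by linarith
      then show ?thesis using x(3)[OF that] False by simp
    qed
    then show "\<exists>x\<in>S2. \<forall>u\<in>N. t \<le> sgn (u \<bullet> y) * (u \<bullet> x)"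
      using x(1) \<open>t \<le> m ?A\<close> by (meson order_trans)
  qed
  ultimately show ?thesis by blast
qed

lemma common_convergent_subsequence:
  fixes u :: "nat \<Rightarrow> nat \<Rightarrow> 'a::metric_space"
  assumes "compact S" "\<And>k i. i < n \<Longrightarrow> u k i \<in> S"
  shows "\<exists>l r. strict_mono (r :: nat \<Rightarrow> nat) \<and> (\<forall>i<n. l i \<in> S \<and> (\<lambda>k. u (r k) i) \<longlonglongrightarrow> l i)"
  using assms(2)
proof (induction n)
  case 0
  show ?case by (intro exI[of _ "\<lambda>_. undefined"] exI[of _ id]) (simp add: strict_mono_def)
next
  case (Suc n)
  have "\<exists>l r. strict_mono (r :: nat \<Rightarrow> nat) \<and> (\<forall>i<n. l i \<in> S \<and> (\<lambda>k. u (r k) i) \<longlonglongrightarrow> l i)"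
    by (rule Suc.IH) (rule Suc.prems, simp)
  then obtain l r where r: "strict_mono (r :: nat \<Rightarrow> nat)"
    "\<forall>i<n. l i \<in> S \<and> (\<lambda>k. u (r k) i) \<longlonglongrightarrow> l i" by (elim exE conjE)
  have "\<forall>k. u (r k) n \<in> S" using Suc.prems by blast
  from seq_compactE[OF compact_imp_seq_compact[OF assms(1)] this]
  obtain x q where q: "x \<in> S" "strict_mono q" "((\<lambda>k. u (r k) n) \<circ> q) \<longlonglongrightarrow> x" .
  show ?case
  proof (intro exI conjI allI impI)
    show "strict_mono (r \<circ> q)" using r(1) q(2) by (rule strict_mono_o)
    fix i assume i: "i < Suc n"
    show "(l(n := x)) i \<in> S" using r(2) q(1) i by (auto simp: less_Suc_eq)
    show "(\<lambda>k. u ((r \<circ> q) k) i) \<longlonglongrightarrow> (l(n := x)) i"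
    proof (cases "i = n")
      case True
      then show ?thesis using q(3) by (simp add: o_def)
    next
      case False
      then have "(\<lambda>k. u (r k) i) \<longlonglongrightarrow> l i" using r(2) i by simp
      from LIMSEQ_subseq_LIMSEQ[OF this q(2)] show ?thesis using False by (simp add: o_def)
    qed
  qed
qed

text \<open>A maximizing sequence of arrangements has a subsequence along which the normals converge, with numbering.  Normals cannot merge in the limit, because
  roominess bounds the angles between them from below.  A vector off the limiting planes has the same signs with respect to
  late members of the sequence, and the centers of the caps for these members accumulate at a center for the
  limit.\<close>

lemma roomy_maximum_exists:
  assumes "0 < n"
  shows "\<exists>T N. 0 < T \<and> normal_system n N \<and> roomy N T \<and>
    (\<forall>M t. normal_system n M \<longrightarrow> roomy M t \<longrightarrow> t \<le> T)"
proof -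
  define R where "R = {t. \<exists>N. normal_system n N \<and> roomy N t}"
  define T where "T = Sup R"
  have bdd: "bdd_above R" using roomy_le_1[OF _ assms] by (auto simp: R_def bdd_above_def)
  obtain N0 t0 where t0: "normal_system n N0" "0 < t0" "roomy N0 t0"
    using normal_system_exists exists_roomy[OF _ assms] by metis
  have "t0 \<in> R" using t0 by (auto simp: R_def)
  then have "t0 \<le> T" unfolding T_def using bdd by (rule cSup_upper)
  then have "0 < T" using t0 by simp
  have "T \<in> closure R" unfolding T_def using \<open>t0 \<in> R\<close> bdd by (intro closure_contains_Sup) auto
  then obtain t where t: "\<And>k. t k \<in> R" "t \<longlonglongrightarrow> T" by (auto simp: closure_sequential)
  then obtain M where M: "\<And>k. normal_system n (M k)" "\<And>k. roomy (M k) (t k)"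
    unfolding R_def by (auto simp: choice_iff) metis
  have "\<exists>f. bij_betw f {..<n} (M k)" for k
    using normal_systemD(1,2)[OF M(1)[of k]] ex_bij_betw_nat_finite[of "M k"] by (simp add: atLeast0LessThan)
  then obtain u where u: "\<And>k. bij_betw (u k) {..<n} (M k)" by metis
  have Mu: "M k = u k ` {..<n}" for k using u[of k] by (simp add: bij_betw_def)
  have uM: "u k i \<in> M k" if "i < n" for k i using that Mu by blast
  have uS: "u k i \<in> S2" if "i < n" for k i using uM[OF that] normal_systemD(3)[OF M(1)] by blast
  obtain l r where r: "strict_mono r" and l: "\<And>i. i < n \<Longrightarrow> l i \<in> S2"
    and lim: "\<And>i. i < n \<Longrightarrow> (\<lambda>k. u (r k) i) \<longlonglongrightarrow> l i"
  proof -
    have "\<exists>l r. strict_mono (r :: nat \<Rightarrow> nat) \<and> (\<forall>i<n. l i \<in> S2 \<and> (\<lambda>k. u (r k) i) \<longlonglongrightarrow> l i)"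
      by (rule common_convergent_subsequence[OF compact_sphere uS])
    then obtain l r where "strict_mono (r :: nat \<Rightarrow> nat)"
      "\<forall>i<n. l i \<in> S2 \<and> (\<lambda>k. u (r k) i) \<longlonglongrightarrow> l i" by (elim exE conjE)
    then show thesis by (intro that[of r l]) simp_all
  qed
  have tr: "(\<lambda>k. t (r k)) \<longlonglongrightarrow> T" using LIMSEQ_subseq_LIMSEQ[OF t(2) r] by (simp add: o_def)
  have ev0: "\<forall>\<^sub>F k in sequentially. 0 < t (r k)" using order_tendstoD(1)[OF tr \<open>0 < T\<close>] .
  have sep: "l i \<noteq> l j \<and> l i \<noteq> - l j" if ij: "i < n" "j < n" "i \<noteq> j" for i j
  proof -
    have ev: "\<forall>\<^sub>F k in sequentially. 2 * (t (r k))\<^sup>2 \<le> 1 - \<bar>u (r k) i \<bullet> u (r k) j\<bar>"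
      using ev0
    proof eventually_elim
      case (elim k)
      have "u (r k) i \<noteq> u (r k) j" using u[of "r k"] ij by (auto simp: bij_betw_def inj_on_def)
      then show ?case using roomy_pair_abs[OF M(1) M(2)] elim uM ij by (meson less_imp_le)
    qed
    have "2 * T\<^sup>2 \<le> 1 - \<bar>l i \<bullet> l j\<bar>"
    proof (rule tendsto_le[OF sequentially_bot _ _ ev])
      show "(\<lambda>k. 2 * (t (r k))\<^sup>2) \<longlonglongrightarrow> 2 * T\<^sup>2" by (intro tendsto_intros tr)
      show "(\<lambda>k. 1 - \<bar>u (r k) i \<bullet> u (r k) j\<bar>) \<longlonglongrightarrow> 1 - \<bar>l i \<bullet> l j\<bar>"
        by (intro tendsto_intros lim ij)
    qed
    moreover have "0 < T\<^sup>2" using \<open>0 < T\<close> by simp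
    ultimately have "\<bar>l i \<bullet> l j\<bar> < 1" by linarith
    moreover have "l j \<bullet> l j = 1" using l[OF ij(2)] by (simp add: norm_eq_1)
    ultimately show ?thesis by auto
  qed
  define N where "N = l ` {..<n}"
  have N: "normal_system n N"
  proof -
    have "inj_on l {..<n}" using sep by (auto simp: inj_on_def)
    moreover have "- l i \<noteq> l j" if "i < n" "j < n" for i j
    proof (cases "i = j")
      case True
      have "l i \<bullet> l i = 1" using l[OF that(1)] by (simp add: norm_eq_1)
      then have "- l i \<bullet> l i \<noteq> l i \<bullet> l i" by simp
      then show ?thesis using True by metis
    next
      case False
      then show ?thesis using sep[OF that(2,1)] by auto
    qed
    ultimately show ?thesis using l by (auto simp: normal_system_def N_def card_image)
  qed
  have "roomy N T" unfolding roomy_def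
  proof (intro allI impI)
    fix y assume y: "\<forall>v\<in>N. v \<bullet> y \<noteq> 0"
    have ev: "\<forall>\<^sub>F k in sequentially. sgn (u (r k) i \<bullet> y) = sgn (l i \<bullet> y)" if i: "i < n" for i
    proof -
      have li: "(\<lambda>k. u (r k) i \<bullet> y) \<longlonglongrightarrow> l i \<bullet> y" by (intro tendsto_intros lim i)
      have "l i \<bullet> y \<noteq> 0" using y i by (auto simp: N_def)
      then consider "0 < l i \<bullet> y" | "l i \<bullet> y < 0" by linarith
      then show ?thesis
      proof cases
        case 1
        from order_tendstoD(1)[OF li 1] show ?thesis by eventually_elim (use 1 in simp)
      next
        case 2
        from order_tendstoD(2)[OF li 2] show ?thesis by eventually_elim (use 2 in simp)
      qed
    qed
    have "\<forall>\<^sub>F k in sequentially. \<forall>i\<in>{..<n}. sgn (u (r k) i \<bullet> y) = sgn (l i \<bullet> y)"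
      using ev by (intro eventually_ball_finite) auto
    then obtain K where K: "\<And>k i. K \<le> k \<Longrightarrow> i < n \<Longrightarrow> sgn (u (r k) i \<bullet> y) = sgn (l i \<bullet> y)"
      by (auto simp: eventually_sequentially)
    have "\<exists>x\<in>S2. \<forall>i<n. t (r (k + K)) \<le> sgn (l i \<bullet> y) * (u (r (k + K)) i \<bullet> x)" for k
    proof -
      have "\<forall>v\<in>M (r (k + K)). v \<bullet> y \<noteq> 0"
      proof
        fix v assume "v \<in> M (r (k + K))"
        then obtain i where "i < n" "v = u (r (k + K)) i" using Mu by auto
        moreover have "l i \<bullet> y \<noteq> 0" if "i < n" for i using y that by (auto simp: N_def)
        ultimately show "v \<bullet> y \<noteq> 0" using K[of "k + K" i] by (metis le_add2 sgn_zero_iff)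
      qed
      then obtain x where "x \<in> S2" "\<forall>v\<in>M (r (k + K)). t (r (k + K)) \<le> sgn (v \<bullet> y) * (v \<bullet> x)"
        using M(2)[of "r (k + K)"] unfolding roomy_def by blast
      then show ?thesis using K[of "k + K"] uM by (metis le_add2)
    qed
    then obtain x where x: "\<And>k. x k \<in> S2" "\<And>k i. i < n \<Longrightarrow> t (r (k + K)) \<le> sgn (l i \<bullet> y) * (u (r (k + K)) i \<bullet> x k)"
      by metis
    have "\<forall>k. x k \<in> S2" using x(1) by blast
    from seq_compactE[OF compact_imp_seq_compact[OF compact_sphere] this]
    obtain z q where q: "z \<in> S2" "strict_mono q" "(x \<circ> q) \<longlonglongrightarrow> z" .
    have sm: "strict_mono (\<lambda>k. q k + K)" using q(2) by (simp add: strict_mono_def)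
    have "T \<le> sgn (l i \<bullet> y) * (l i \<bullet> z)" if i: "i < n" for i
    proof (rule tendsto_le[OF sequentially_bot])
      show "(\<lambda>k. t (r (q k + K))) \<longlonglongrightarrow> T" using LIMSEQ_subseq_LIMSEQ[OF tr sm] by (simp add: o_def)
      have "(\<lambda>k. u (r (q k + K)) i) \<longlonglongrightarrow> l i" using LIMSEQ_subseq_LIMSEQ[OF lim[OF i] sm] by (simp add: o_def)
      then show "(\<lambda>k. sgn (l i \<bullet> y) * (u (r (q k + K)) i \<bullet> x (q k))) \<longlonglongrightarrow> sgn (l i \<bullet> y) * (l i \<bullet> z)"
        using q(3) by (intro tendsto_intros) (simp_all add: o_def)
      show "\<forall>\<^sub>F k in sequentially. t (r (q k + K)) \<le> sgn (l i \<bullet> y) * (u (r (q k + K)) i \<bullet> x (q k))"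
        using x(2)[OF i] by simp
    qed
    then show "\<exists>x\<in>S2. \<forall>v\<in>N. T \<le> sgn (v \<bullet> y) * (v \<bullet> x)"
      using q(1) by (intro bexI[of _ z]) (simp_all add: N_def)
  qed
  moreover have "s \<le> T" if "normal_system n M'" "roomy M' s" for M' s
    unfolding T_def using that bdd by (intro cSup_upper) (auto simp: R_def)
  ultimately show ?thesis using \<open>0 < T\<close> N by blast
qed


section \<open>Orthogonality and angles of great circles\<close>

lemma central_plane_hyperplane:
  fixes u :: "real ^ 3" assumes "u \<noteq> 0" shows "central_plane {x. orthogonal u x}"
  using assms by (simp add: central_plane_def orthogonal_def subspace_hyperplane dim_hyperplane)

lemma polar_eq_plane: "polar u = S2 \<inter> {x. orthogonal u x}"
  by (auto simp: polar_def orthogonal_def inner_commute)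

lemma orthogonal_circles_polar:
  assumes "u \<in> S2" "v \<in> S2"
  shows "orthogonal_circles (polar u) (polar v) \<longleftrightarrow> u \<bullet> v = 0"
proof
  assume "orthogonal_circles (polar u) (polar v)"
  then obtain a b where ab: "a \<noteq> 0" "b \<noteq> 0" "orthogonal a b"
    "polar u = S2 \<inter> {x. orthogonal a x}" "polar v = S2 \<inter> {x. orthogonal b x}"
    unfolding orthogonal_circles_def orthogonal_planes_def by blast
  have sc: "polar (w /\<^sub>R norm w) = S2 \<inter> {x. orthogonal w x}" "w /\<^sub>R norm w \<in> S2" if "w \<noteq> 0" for w
    using that by (auto simp: polar_def orthogonal_def inner_commute)
  have "polar u = polar (a /\<^sub>R norm a)" "polar v = polar (b /\<^sub>R norm b)"
    using ab sc by simp_all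
  then have uv: "u = a /\<^sub>R norm a \<or> u = - (a /\<^sub>R norm a)" "v = b /\<^sub>R norm b \<or> v = - (b /\<^sub>R norm b)"
    using polar_eq_iff[OF assms(1) sc(2)[OF ab(1)]] polar_eq_iff[OF assms(2) sc(2)[OF ab(2)]] by blast+
  have "a \<bullet> b = 0" using ab(3) by (simp add: orthogonal_def)
  then show "u \<bullet> v = 0" using uv by auto
next
  assume uv: "u \<bullet> v = 0"
  have nz: "u \<noteq> 0" "v \<noteq> 0" using assms by auto
  have "orthogonal_planes {x. orthogonal u x} {x. orthogonal v x}"
    unfolding orthogonal_planes_def using nz uv by (auto simp: orthogonal_def)
  then show "orthogonal_circles (polar u) (polar v)"
    unfolding orthogonal_circles_def using central_plane_hyperplane nz polar_eq_plane by metis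
qed

text \<open>The plane orthogonal to both \<open>u\<close> and \<open>p\<close> is a line, spanned by their cross product.\<close>

lemma tangent_eq_cross:
  assumes "u \<in> S2" "p \<in> S2" "u \<bullet> p = 0" "s \<in> S2" "u \<bullet> s = 0" "s \<bullet> p = 0"
  shows "s = cross3 u p \<or> s = - cross3 u p"
proof (rule cross_eq_0_imp_parallel)
  show "cross3 u p \<in> S2" using norm_cross_dot[of u p] assms by (simp add: power2_eq_1_iff)
  have "cross3 s (cross3 u p) = (s \<bullet> p) *\<^sub>R u - (s \<bullet> u) *\<^sub>R p"
    by (simp add: vec_eq_iff forall_3) (simp add: cross3_simps)
  then show "cross3 s (cross3 u p) = 0" using assms by (simp add: inner_commute)
qed fact

text \<open>The tangents at \<open>p\<close> arise from the normals by a quarter turn about \<open>p\<close>, so they enclose the same angle.\<close>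

lemma meet_at_angle_polar:
  assumes S: "u \<in> S2" "v \<in> S2" "p \<in> S2"
  shows "meet_at_angle (polar u) (polar v) p \<alpha> \<longleftrightarrow> u \<bullet> p = 0 \<and> v \<bullet> p = 0 \<and> \<alpha> = arccos \<bar>u \<bullet> v\<bar>"
proof -
  have cc: "cross3 u p \<bullet> cross3 v p = u \<bullet> v" if "u \<bullet> p = 0" "v \<bullet> p = 0"
  proof -
    have "cross3 u p \<bullet> cross3 v p = (u \<bullet> v) * (p \<bullet> p) - (u \<bullet> p) * (v \<bullet> p)"
      by (simp add: cross3_simps)
    then show ?thesis using that S by (simp add: norm_eq_1)
  qed
  show ?thesis
  proof
    assume "meet_at_angle (polar u) (polar v) p \<alpha>"
    then obtain s t where st: "p \<in> polar u" "p \<in> polar v" "s \<in> polar u" "t \<in> polar v"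
      "s \<bullet> p = 0" "t \<bullet> p = 0" "\<alpha> = arccos \<bar>s \<bullet> t\<bar>"
      unfolding meet_at_angle_def orthogonal_def by blast
    have p: "u \<bullet> p = 0" "v \<bullet> p = 0" using st by (simp_all add: polar_def inner_commute)
    have "s = cross3 u p \<or> s = - cross3 u p" "t = cross3 v p \<or> t = - cross3 v p"
    proof -
      have "s \<in> S2" "u \<bullet> s = 0" "t \<in> S2" "v \<bullet> t = 0"
        using st(3,4) by (simp_all add: polar_def inner_commute)
      then show "s = cross3 u p \<or> s = - cross3 u p" "t = cross3 v p \<or> t = - cross3 v p"
        using tangent_eq_cross[OF S(1,3) p(1) _ _ st(5)] tangent_eq_cross[OF S(2,3) p(2) _ _ st(6)]
        by blast+
    qed
    then have "\<bar>s \<bullet> t\<bar> = \<bar>u \<bullet> v\<bar>" using cc[OF p] by auto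
    then show "u \<bullet> p = 0 \<and> v \<bullet> p = 0 \<and> \<alpha> = arccos \<bar>u \<bullet> v\<bar>" using p st by simp
  next
    assume h: "u \<bullet> p = 0 \<and> v \<bullet> p = 0 \<and> \<alpha> = arccos \<bar>u \<bullet> v\<bar>"
    have tan: "cross3 w p \<in> polar w" "orthogonal (cross3 w p) p" if "w \<in> S2" "w \<bullet> p = 0" for w
      using norm_cross_dot[of w p] that S by (auto simp: polar_def power2_eq_1_iff dot_cross_self orthogonal_def)
    have "p \<in> polar u" "p \<in> polar v" using h S by (simp_all add: polar_def inner_commute)
    then show "meet_at_angle (polar u) (polar v) p \<alpha>"
      unfolding meet_at_angle_def using tan[OF S(1)] tan[OF S(2)] cc h by metis
  qed
qed

lemma meet_at_60_polar:
  assumes S: "u \<in> S2" "v \<in> S2" "p \<in> S2"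
  shows "meet_at_angle (polar u) (polar v) p (pi / 3) \<longleftrightarrow> u \<bullet> p = 0 \<and> v \<bullet> p = 0 \<and> \<bar>u \<bullet> v\<bar> = 1/2"
proof -
  have "\<bar>u \<bullet> v\<bar> \<le> 1" using Cauchy_Schwarz_ineq2[of u v] S by simp
  moreover have "arccos (1/2) = pi / 3" using arccos_cos[of "pi/3"] by (simp add: cos_60)
  ultimately have "pi / 3 = arccos \<bar>u \<bullet> v\<bar> \<longleftrightarrow> \<bar>u \<bullet> v\<bar> = 1/2"
    using arccos_eq_iff[of "1/2" "\<bar>u \<bullet> v\<bar>"] by auto
  then show ?thesis using meet_at_angle_polar[OF S] by simp
qed


section \<open>Optimal arrangements\<close>

lemma arcsin_in_quadrant:
  assumes "0 < T" "T \<le> 1"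
  shows "0 < arcsin T" "arcsin T \<le> pi / 2" "sin (arcsin T) = T"
  using assms arcsin_less_arcsin[of 0 T] arcsin_ubound[of T] by simp_all

lemma r_gc_eq_arcsin:
  assumes n: "0 < n" and N: "normal_system n N" "roomy N T" and T: "0 < T"
    and max: "\<And>M t. normal_system n M \<Longrightarrow> roomy M t \<Longrightarrow> 0 < t \<Longrightarrow> t \<le> T"
  shows "r_gc n = arcsin T"
  unfolding r_gc_def
proof (rule Greatest_equality)
  have T1: "T \<le> 1" using roomy_le_1[OF N(1) n N(2)] .
  have r: "0 < arcsin T" "arcsin T \<le> pi / 2" "sin (arcsin T) = T"
    using arcsin_in_quadrant[OF T T1] by auto
  then have "cells_contain_caps (polar ` N) (arcsin T)"
    using cells_contain_caps_iff_roomy[OF N(1) n r(1,2)] N(2) by simp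
  moreover have "arrangement n (polar ` N)" using N(1) arrangement_iff_normal_system by blast
  ultimately show "0 < arcsin T \<and> arcsin T \<le> pi / 2 \<and> (\<exists>F. arrangement n F \<and> cells_contain_caps F (arcsin T))"
    using r by blast
next
  fix r assume r: "0 < r \<and> r \<le> pi / 2 \<and> (\<exists>F. arrangement n F \<and> cells_contain_caps F r)"
  then obtain M where M: "normal_system n M" "cells_contain_caps (polar ` M) r"
    using arrangement_iff_normal_system by metis
  then have "roomy M (sin r)" using cells_contain_caps_iff_roomy[OF M(1) n] r by blast
  moreover have "0 < sin r" using r by (intro sin_gt_zero) auto
  ultimately have "sin r \<le> T" using max M(1) by blast
  moreover have "T \<le> 1" using roomy_le_1[OF N(1) n N(2)] .
  ultimately have "arcsin (sin r) \<le> arcsin T" using T \<open>0 < sin r\<close> by (intro arcsin_le_arcsin) auto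
  then show "r \<le> arcsin T" using r by (simp add: arcsin_sin)
qed

lemma optimal_iff_roomy:
  assumes "0 < n" "r_gc n = arcsin T" "0 < T" "T \<le> 1" "normal_system n N"
  shows "optimal n (polar ` N) \<longleftrightarrow> roomy N T"
proof -
  have r: "0 < arcsin T" "arcsin T \<le> pi / 2" "sin (arcsin T) = T"
    using arcsin_in_quadrant[OF assms(3,4)] by auto
  have "arrangement n (polar ` N)" using assms(5) arrangement_iff_normal_system by blast
  then show ?thesis
    using cells_contain_caps_iff_roomy[OF assms(5,1) r(1,2)] r(3) assms(2) by (simp add: optimal_def)
qed

lemma le_one_over_sqrt:
  assumes "t\<^sup>2 \<le> 1 / n" shows "t \<le> 1 / sqrt n"
  using real_le_rsqrt[OF assms] by (simp add: real_sqrt_divide)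

lemma r_gc_2: "r_gc 2 = arcsin (1 / sqrt 2)"
proof (rule r_gc_eq_arcsin)
  have "card ({axis 1 1, axis 2 1} :: (real ^ 3) set) = 2" by (simp add: axis_eq_axis)
  moreover have "normal_system (card ({axis 1 1, axis 2 1} :: (real ^ 3) set)) {axis 1 1, axis 2 1}"
    by (rule normal_system_orthonormal) (auto simp: inner_axis_axis)
  ultimately show N: "normal_system 2 {axis 1 1, axis 2 1}" by simp
  have "roomy {axis 1 1, axis 2 1} (1 / sqrt (card {axis 1 1, axis 2 1 :: real ^ 3}))"
    by (rule roomy_orthonormal) (auto simp: inner_axis_axis)
  then show "roomy {axis 1 1, axis 2 1} (1 / sqrt 2)" using normal_systemD(2)[OF N] by simp
  fix M t assume M: "normal_system 2 M" "roomy M t" "0 < (t::real)"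
  obtain u v where "u \<in> M" "v \<in> M" "u \<noteq> v"
    using normal_systemD(2)[OF M(1)] by (auto simp: card_2_iff)
  from roomy_pair_abs[OF M(1,2) _ this] have "2 * t\<^sup>2 \<le> 1 - \<bar>u \<bullet> v\<bar>" using M(3) by simp
  then have "t\<^sup>2 \<le> 1 / 2" by linarith
  then show "t \<le> 1 / sqrt 2" by (rule le_one_over_sqrt)
qed simp_all

lemma optimal_2:
  assumes arr: "arrangement 2 {G1, G2}"
  shows "optimal 2 {G1, G2} \<longleftrightarrow> orthogonal_circles G1 G2"
proof -
  obtain u v where uv: "u \<in> S2" "v \<in> S2" "G1 = polar u" "G2 = polar v"
    using arr by (auto simp: arrangement_def great_circle_iff_polar)
  have F: "{G1, G2} = polar ` {u, v}" using uv by simp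
  have N: "normal_system 2 {u, v}"
    using arr uv by (intro normal_systemI) (auto simp: F card_insert_if)
  have ne: "u \<noteq> v" using normal_systemD(2)[OF N] by auto
  have "optimal 2 {G1, G2} \<longleftrightarrow> roomy {u, v} (1 / sqrt 2)"
    unfolding F by (rule optimal_iff_roomy[OF _ r_gc_2 _ _ N]) simp_all
  also have "\<dots> \<longleftrightarrow> u \<bullet> v = 0"
  proof
    assume "roomy {u, v} (1 / sqrt 2)"
    from roomy_pair_abs[OF N this _ _ _ ne] show "u \<bullet> v = 0" by (simp add: power_divide)
  next
    assume "u \<bullet> v = 0"
    then have "roomy {u, v} (1 / sqrt (card {u, v}))"
      using uv by (intro roomy_orthonormal) (auto simp: inner_commute)
    then show "roomy {u, v} (1 / sqrt 2)" using normal_systemD(2)[OF N] by simp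
  qed
  also have "\<dots> \<longleftrightarrow> orthogonal_circles G1 G2" using orthogonal_circles_polar uv by simp
  finally show ?thesis .
qed

lemma r_gc_3: "r_gc 3 = arcsin (1 / sqrt 3)"
proof (rule r_gc_eq_arcsin)
  have "card ({axis 1 1, axis 2 1, axis 3 1} :: (real ^ 3) set) = 3" by (simp add: axis_eq_axis)
  moreover have "normal_system (card ({axis 1 1, axis 2 1, axis 3 1} :: (real ^ 3) set)) {axis 1 1, axis 2 1, axis 3 1}"
    by (rule normal_system_orthonormal) (auto simp: inner_axis_axis)
  ultimately show N: "normal_system 3 {axis 1 1, axis 2 1, axis 3 1}" by simp
  have "roomy {axis 1 1, axis 2 1, axis 3 1} (1 / sqrt (card {axis 1 1, axis 2 1, axis 3 1 :: real ^ 3}))"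
    by (rule roomy_orthonormal) (auto simp: inner_axis_axis)
  then show "roomy {axis 1 1, axis 2 1, axis 3 1} (1 / sqrt 3)" using normal_systemD(2)[OF N] by simp
  fix M t assume M: "normal_system 3 M" "roomy M t" "0 < (t::real)"
  obtain u v w where uvw: "M = {u, v, w}" "u \<noteq> v" "u \<noteq> w" "v \<noteq> w"
    using normal_systemD(2)[OF M(1)] by (auto simp: card_3_iff)
  have "t\<^sup>2 \<le> 1 / 3" using roomy_three(1)[OF M(1,2) _ _ _ _ uvw(2-4)] uvw(1) M(3) by simp
  then show "t \<le> 1 / sqrt 3" by (rule le_one_over_sqrt)
qed simp_all

lemma optimal_3:
  assumes arr: "arrangement 3 {G1, G2, G3}"
  shows "optimal 3 {G1, G2, G3} \<longleftrightarrow>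
    orthogonal_circles G1 G2 \<and> orthogonal_circles G1 G3 \<and> orthogonal_circles G2 G3"
proof -
  obtain u v w where uvw: "u \<in> S2" "v \<in> S2" "w \<in> S2" "G1 = polar u" "G2 = polar v" "G3 = polar w"
    using arr by (auto simp: arrangement_def great_circle_iff_polar)
  have F: "{G1, G2, G3} = polar ` {u, v, w}" using uvw by simp
  have N: "normal_system 3 {u, v, w}"
    using arr uvw by (intro normal_systemI) (auto simp: F card_insert_if)
  have ne: "u \<noteq> v" "u \<noteq> w" "v \<noteq> w" using normal_systemD(2)[OF N] by (auto simp: card_insert_if split: if_splits)
  have "optimal 3 {G1, G2, G3} \<longleftrightarrow> roomy {u, v, w} (1 / sqrt 3)"
    unfolding F by (rule optimal_iff_roomy[OF _ r_gc_3 _ _ N]) simp_all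
  also have "\<dots> \<longleftrightarrow> u \<bullet> v = 0 \<and> u \<bullet> w = 0 \<and> v \<bullet> w = 0"
  proof
    assume "roomy {u, v, w} (1 / sqrt 3)"
    from roomy_three(2)[OF N this _ _ _ _ ne]
    show "u \<bullet> v = 0 \<and> u \<bullet> w = 0 \<and> v \<bullet> w = 0" by (simp add: power_divide)
  next
    assume "u \<bullet> v = 0 \<and> u \<bullet> w = 0 \<and> v \<bullet> w = 0"
    then have "roomy {u, v, w} (1 / sqrt (card {u, v, w}))"
      using uvw by (intro roomy_orthonormal) (auto simp: inner_commute)
    then show "roomy {u, v, w} (1 / sqrt 3)" using normal_systemD(2)[OF N] by simp
  qed
  also have "\<dots> \<longleftrightarrow> orthogonal_circles G1 G2 \<and> orthogonal_circles G1 G3 \<and> orthogonal_circles G2 G3"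
    using orthogonal_circles_polar uvw by simp
  finally show ?thesis .
qed

text \<open>The circles are three meridians at angles \<open>\<pi>/3\<close> and the equator; \<open>a\<close>, \<open>b\<close>, \<open>c\<close> are the third roots of unity in
  the horizontal plane.\<close>

lemma r_gc_4: "r_gc 4 = arcsin (1 / sqrt 5)"
proof (rule r_gc_eq_arcsin)
  define a b c d :: "real ^ 3" where "a = vector [1, 0, 0]" and "b = vector [-1/2, sqrt 3 / 2, 0]"
    and "c = vector [-1/2, - sqrt 3 / 2, 0]" and "d = vector [0, 0, 1]"
  note defs = a_def b_def c_def d_def
  have ip: "a \<bullet> b = -1/2" "a \<bullet> c = -1/2" "b \<bullet> c = -1/2" "a \<bullet> d = 0" "b \<bullet> d = 0" "c \<bullet> d = 0"
    "a \<bullet> a = 1" "b \<bullet> b = 1" "c \<bullet> c = 1" "d \<bullet> d = 1"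
    by (simp_all add: defs inner_vec_def sum_3)
  have S: "a \<in> S2" "b \<in> S2" "c \<in> S2" "d \<in> S2" using ip by (simp_all add: norm_eq_1)
  have ip': "b \<bullet> a = -1/2" "c \<bullet> a = -1/2" "c \<bullet> b = -1/2" "d \<bullet> a = 0" "d \<bullet> b = 0" "d \<bullet> c = 0"
    using ip by (simp_all add: inner_commute)
  have "a \<noteq> b" "a \<noteq> c" "a \<noteq> d" "b \<noteq> c" "b \<noteq> d" "c \<noteq> d"
    using ip by auto
  then have "card {a, b, c, d} = 4" by simp
  moreover have "- u \<notin> {a, b, c, d}" if u: "u \<in> {a, b, c, d}" for u
  proof
    assume v: "- u \<in> {a, b, c, d}"
    have "x \<bullet> y \<noteq> -1" if "x \<in> {a, b, c, d}" "y \<in> {a, b, c, d}" for x y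
      using that ip ip' by auto
    then have "u \<bullet> (- u) \<noteq> -1" using u v by blast
    moreover have "u \<bullet> u = 1" using u ip by auto
    ultimately show False by simp
  qed
  ultimately show "normal_system 4 {a, b, c, d}" using S unfolding normal_system_def by blast
  show "roomy {a, b, c, d} (1 / sqrt 5)"
    by (rule roomy_near_pencil_60[OF S]) (simp_all add: ip)
  fix M t assume "normal_system 4 M" "roomy M t" "0 < (t::real)"
  then have "t\<^sup>2 \<le> 1 / 5" using roomy_four(1) by simp
  then show "t \<le> 1 / sqrt 5" by (rule le_one_over_sqrt)
qed simp_all

lemma optimal_4:
  assumes arr: "arrangement 4 F"
  shows "optimal 4 F \<longleftrightarrow>
            (\<exists>G1 G2 G3 G4 p. F = {G1, G2, G3, G4} \<and> p \<in> S2 \<and>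
               meet_at_angle G1 G2 p (pi / 3) \<and>
               meet_at_angle G1 G3 p (pi / 3) \<and>
               meet_at_angle G2 G3 p (pi / 3) \<and>
               G4 = polar p)"
proof
  assume opt: "optimal 4 F"
  obtain N where N: "normal_system 4 N" "F = polar ` N" using arr arrangement_iff_normal_system by metis
  have "optimal 4 (polar ` N) \<longleftrightarrow> roomy N (1 / sqrt 5)"
    by (rule optimal_iff_roomy[OF _ r_gc_4 _ _ N(1)]) simp_all
  then have R: "roomy N (1 / sqrt 5)" using opt N(2) by simp
  obtain a b c d where abcd: "N = {a, b, c, d}" "\<bar>a \<bullet> b\<bar> = 1/2" "\<bar>a \<bullet> c\<bar> = 1/2" "\<bar>b \<bullet> c\<bar> = 1/2"
    "a \<bullet> d = 0" "b \<bullet> d = 0" "c \<bullet> d = 0"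
    using roomy_four(2)[OF N(1) R] by (auto simp: power_divide)
  have S: "a \<in> S2" "b \<in> S2" "c \<in> S2" "d \<in> S2" using normal_systemD(3)[OF N(1)] abcd(1) by auto
  show "\<exists>G1 G2 G3 G4 p. F = {G1, G2, G3, G4} \<and> p \<in> S2 \<and> meet_at_angle G1 G2 p (pi / 3) \<and>
      meet_at_angle G1 G3 p (pi / 3) \<and> meet_at_angle G2 G3 p (pi / 3) \<and> G4 = polar p"
  proof (intro exI conjI)
    show "F = {polar a, polar b, polar c, polar d}" using N(2) abcd(1) by simp
    show "meet_at_angle (polar a) (polar b) d (pi / 3)" "meet_at_angle (polar a) (polar c) d (pi / 3)"
      "meet_at_angle (polar b) (polar c) d (pi / 3)"
      using meet_at_60_polar S abcd(2-7) by simp_all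
  qed (use S in simp_all)
next
  assume "\<exists>G1 G2 G3 G4 p. F = {G1, G2, G3, G4} \<and> p \<in> S2 \<and> meet_at_angle G1 G2 p (pi / 3) \<and>
      meet_at_angle G1 G3 p (pi / 3) \<and> meet_at_angle G2 G3 p (pi / 3) \<and> G4 = polar p"
  then obtain G1 G2 G3 p where G: "F = {G1, G2, G3, polar p}" "p \<in> S2" "meet_at_angle G1 G2 p (pi / 3)"
    "meet_at_angle G1 G3 p (pi / 3)" "meet_at_angle G2 G3 p (pi / 3)" by blast
  obtain a b c where abc: "a \<in> S2" "b \<in> S2" "c \<in> S2" "G1 = polar a" "G2 = polar b" "G3 = polar c"
    using arr G(1) by (auto simp: arrangement_def great_circle_iff_polar)
  have F: "F = polar ` {a, b, c, p}" using G(1) abc by simp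
  have N: "normal_system 4 {a, b, c, p}"
    using arr abc G(2) by (intro normal_systemI) (auto simp: F card_insert_if)
  have m: "a \<bullet> p = 0" "b \<bullet> p = 0" "c \<bullet> p = 0" "\<bar>a \<bullet> b\<bar> = 1/2" "\<bar>a \<bullet> c\<bar> = 1/2" "\<bar>b \<bullet> c\<bar> = 1/2"
    using G(2-5) abc meet_at_60_polar by simp_all
  have "roomy {a, b, c, p} (1 / sqrt 5)" by (rule roomy_near_pencil_60) (use abc G m in simp_all)
  moreover have "optimal 4 (polar ` {a, b, c, p}) \<longleftrightarrow> roomy {a, b, c, p} (1 / sqrt 5)"
    by (rule optimal_iff_roomy[OF _ r_gc_4 _ _ N]) simp_all
  ultimately show "optimal 4 F" using F by simp
qed

lemma r_gc_5_or_more: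
  fixes n :: nat assumes n: "4 < n"
  shows "r_gc n \<le> arccos (1 / (sqrt 2 * sin (real n / (real n - 1) * (pi / 4))))"
proof -
  obtain T N where T: "0 < T" "normal_system n N" "roomy N T"
    "\<And>M t. normal_system n M \<Longrightarrow> roomy M t \<Longrightarrow> t \<le> T"
    using roomy_maximum_exists[of n] n by auto
  have T1: "T \<le> 1" using roomy_le_1[OF T(2) _ T(3)] n by simp
  have r: "r_gc n = arcsin T" using n T by (intro r_gc_eq_arcsin) auto
  define \<epsilon> where "\<epsilon> = pi / (4 * real (n - 1))"
  define S where "S = sin (pi / (2 * real (n - 1)))"
  have S2: "S = sin (2 * \<epsilon>)" by (simp add: S_def \<epsilon>_def)
  have e: "0 < \<epsilon>" "\<epsilon> < pi / 2" using n by (auto simp: \<epsilon>_def field_simps)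
  have key: "T\<^sup>2 * (1 + S) \<le> S" unfolding S_def using n T by (intro roomy_five_or_more) auto
  have S0: "0 < S" unfolding S2 using e by (intro sin_gt_zero) auto
  have "real n / (real n - 1) * (pi / 4) = pi / 4 + \<epsilon>"
    using n by (simp add: \<epsilon>_def of_nat_diff field_simps)
  moreover have "sqrt 2 * sin (pi / 4 + \<epsilon>) = cos \<epsilon> + sin \<epsilon>"
    by (simp add: sin_add sin_45 cos_45 algebra_simps)
  ultimately have B: "sqrt 2 * sin (real n / (real n - 1) * (pi / 4)) = cos \<epsilon> + sin \<epsilon>" by simp
  have pos: "0 < cos \<epsilon> + sin \<epsilon>" using e by (intro add_pos_pos cos_gt_zero sin_gt_zero) auto
  have sq: "(cos \<epsilon> + sin \<epsilon>)\<^sup>2 = 1 + S"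
    using sin_cos_squared_add[of \<epsilon>] by (simp add: S2 sin_double power2_sum)
  have "1 \<le> (1 - T\<^sup>2) * (1 + S)" using key by (simp add: algebra_simps)
  then have "(1 / (cos \<epsilon> + sin \<epsilon>))\<^sup>2 \<le> 1 - T\<^sup>2"
    using S0 by (simp add: power_divide sq field_simps)
  then have "1 / (cos \<epsilon> + sin \<epsilon>) \<le> sqrt (1 - T\<^sup>2)" by (rule real_le_rsqrt)
  also have "\<dots> = cos (arcsin T)" using T(1) T1 by (simp add: cos_arcsin)
  finally have "arccos (cos (arcsin T)) \<le> arccos (1 / (cos \<epsilon> + sin \<epsilon>))"
    using pos by (intro arccos_le_arccos) (auto intro: order_trans[of _ 0])
  moreover have "arccos (cos (arcsin T)) = arcsin T"
    using arcsin_in_quadrant[OF T(1) T1] pi_gt_zero by (intro arccos_cos) linarith+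
  ultimately show ?thesis unfolding r B by (simp only:)
qed

theorem theorem4:
  shows
    "(r_gc 2 = pi / 4 \<and>
      (\<forall>G1 G2. arrangement 2 {G1, G2} \<longrightarrow>
         (optimal 2 {G1, G2} \<longleftrightarrow> orthogonal_circles G1 G2))) \<and>
     (r_gc 3 = arcsin (1 / sqrt 3) \<and>
      (\<forall>G1 G2 G3. arrangement 3 {G1, G2, G3} \<longrightarrow>
         (optimal 3 {G1, G2, G3} \<longleftrightarrow>
            orthogonal_circles G1 G2 \<and> orthogonal_circles G1 G3 \<and> orthogonal_circles G2 G3))) \<and>
     (r_gc 4 = arcsin (1 / sqrt 5) \<and>
      (\<forall>F. arrangement 4 F \<longrightarrow>
         (optimal 4 F \<longleftrightarrow>
            (\<exists>G1 G2 G3 G4 p. F = {G1, G2, G3, G4} \<and> p \<in> S2 \<and>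
               meet_at_angle G1 G2 p (pi / 3) \<and>
               meet_at_angle G1 G3 p (pi / 3) \<and>
               meet_at_angle G2 G3 p (pi / 3) \<and>
               G4 = polar p)))) \<and>
     (\<forall>n::nat. n > 4 \<longrightarrow>
         r_gc n \<le> arccos (1 / (sqrt 2 * sin (real n / (real n - 1) * (pi / 4)))))"
proof (intro conjI allI impI)
  have "1 / sqrt 2 = sin (pi / 4)" by (simp add: sin_45 field_simps)
  then have "arcsin (1 / sqrt 2) = pi / 4" by (simp only:) (rule arcsin_sin; simp)
  then show "r_gc 2 = pi / 4" using r_gc_2 by simp
qed (simp_all only: r_gc_3 r_gc_4 optimal_2 optimal_3 optimal_4 r_gc_5_or_more)

end
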